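(* Let $\mathcal S$ be a known, possibly infinite, set of finite-dimensional linear subspaces of $\mathbb R^n$. Let $\mathbf y=\mathbf A\mathbf x+\mathbf e$, where $\mathbf x\in\mathcal U$ and $\mathbf A$ is an $m\times n$ matrix ($m<n$) with entries independently drawn from the standard normal distribution, and where the noise $\mathbf e\in\mathbb R^m$ has bounded energy and does not depend on $\mathbf A$. Let $\mathbf x^t$ be the iterates of the GCoSaMP algorithm (described in the context) run on $\mathbf A,\mathbf y,\mathcal S$. Then $$\|\mathbf x^t-\mathbf x\|_2\le\frac{4\rho_2(\eta)}{\sqrt{1-\rho_1^2(\eta)}}\,\|\mathbf x^{t-1}-\mathbf x\|_2+\left(\frac{4\xi_2(\eta)}{\sqrt{1-\rho_1^2(\eta)}}+\frac{2\xi_1(\eta)}{1-\rho_1(\eta)}\right)\|\mathbf e\|_2$$ holds for all $t$, with probability at least $1-6e^{-\eta^2/2}$, where $$\rho_1(\eta)=1-\mu_1\bigl[b_m-w(\mathcal U^4\cap\mathbb S^{n-1})-\eta\bigr]^2,\qquad \xi_1(\eta)=\mu_1\bigl[w(\mathcal U^3\cap\mathbb S^{n-1})+\eta\bigr],$$ $$\rho_2(\eta)=1-\mu_2\bigl[b_m-w(\mathcal U^4\cap\mathbb S^{n-1})-\eta\bigr]^2,\qquad \xi_2(\eta)=\mu_2\bigl[w(\mathcal U^4\cap\mathbb S^{n-1})+\eta\bigr],$$ and $\mu_1$, $\mu_2$ and $\eta$ are positive parameters satisfying $$\mu_1\le\bigl(b_m+w(\mathcal U^4\cap\mathbb S^{n-1})+\eta\bigr)^{-2},\qquad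 \mu_2\le\bigl(b_m+w(\mathcal U^4\cap\mathbb S^{n-1})+\eta\bigr)^{-2}.$$ The iterates converge if $m>14.5^2\bigl(w(\mathcal U^4\cap\mathbb S^{n-1})+\eta\bigr)^2+1$.
   Context: Notation. $\|\cdot\|_2$ is the Euclidean norm; $\mathbb S^{n-1}$ is the unit Euclidean sphere of $\mathbb R^n$; $\mathbf A^*$ is the transpose of $\mathbf A$; $\mathbf P_{\mathcal V}$ is the orthogonal projection onto the linear subspace $\mathcal V$. The sum of sets is $\mathcal K_1+\mathcal K_2=\{\mathbf x_1+\mathbf x_2:\mathbf x_1\in\mathcal K_1,\ \mathbf x_2\in\mathcal K_2\}$. For an integer $B\ge1$, $\mathcal S^B=\{\sum_{i=1}^B\mathcal V_i:\mathcal V_i\in\mathcal S\}$ (so $\mathcal S^1=\mathcal S$), and $\mathcal U^B\subset\mathbb R^n$ is the union of all subspaces belonging to $\mathcal S^B$; $\mathcal U=\mathcal U^1$. Thus $\mathbf x\in\mathcal U$ means that $\mathbf x\in\mathcal V_0$ for some (unknown) $\mathcal V_0\in\mathcal S$. The Gaussian mean width of a set $\mathcal K\subset\mathbb R^n$ is $w(\mathcal K)=\mathbb E_{\mathbf g}\{\sup_{\mathbf z\in\mathcal K}\langle\mathbf g,\mathbf z\rangle\}$ with $\mathbf g\sim\mathcal N(\mathbf 0,\mathbf I_n)$. Also $b_m=\mathbb E\|\mathbf g\|_2$ for $\mathbf g\sim\mathcal N(\mathbf 0,\mathbf I_m)$. GCoSaMP algorithm. Input: $\mathbf A$, $\mathbf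 y$, $\mathcal S$ and a stopping criterion. Initialize $\mathbf r=\mathbf y$, $\mathbf x^0=\mathbf 0$, $t=0$, $\mathcal V^0=\varnothing$ (no subspace selected yet, i.e. $\mathcal V^0$ is treated as $\{\mathbf 0\}$ in the sum below). While the stopping criterion is not met, increase $t$ by 1 and compute: 1. $\tilde{\mathbf v}=\mathbf A^*\mathbf r$; 2. $\mathcal V_\Delta^t=\operatorname{argmin}_{\mathcal V\in\mathcal S^2}\|\tilde{\mathbf v}-\mathbf P_{\mathcal V}\tilde{\mathbf v}\|_2$; 3. $\tilde{\mathcal V}^t=\mathcal V^{t-1}+\mathcal V_\Delta^t$; 4. $\tilde{\mathbf x}^t=\operatorname{argmin}_{\mathbf z}\|\mathbf y-\mathbf A\mathbf z\|_2$ subject to $\mathbf z\in\tilde{\mathcal V}^t$; 5. $\mathcal V^t=\operatorname{argmin}_{\mathcal V\in\mathcal S}\|\tilde{\mathbf x}^t-\mathbf P_{\mathcal V}\tilde{\mathbf x}^t\|_2$; 6. $\mathbf x^t=\mathbf P_{\mathcal V^t}\tilde{\mathbf x}^t$; 7. $\mathbf r=\mathbf y-\mathbf A\mathbf x^t$. The output is the last $\mathbf x^t$.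
   Formalization: Assumes additionally that w(U^4∩S^{n-1})+η < b_m (the bound fails or is undefined otherwise); "the iterates converge" means geometric decay of the error to the noise level for suitable admissible μ1, μ2, and x^t→x when e=0. *)

theory Defs
  imports "HOL-Probability.Probability" "HOL-Library.Set_Algebras"
begin

definition subspace_sums :: "nat \<Rightarrow> 'a::euclidean_space set set \<Rightarrow> 'a set set" where
  "subspace_sums B S = {(\<Sum>i<B. V i) | V. \<forall>i<B. V i \<in> S}"

definition union_sums :: "nat \<Rightarrow> 'a::euclidean_space set set \<Rightarrow> 'a set" where
  "union_sums B S = \<Union> (subspace_sums B S)"

definition orth_proj :: "'a::euclidean_space set \<Rightarrow> 'a \<Rightarrow> 'a" where
  "orth_proj V x = (THE p. p \<in> V \<and> (\<forall>v\<in>V. orthogonal (x - p) v))"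

definition std_gaussian_vec :: "(real^'n::finite) measure" where
  "std_gaussian_vec = density lborel (\<lambda>g. \<Prod>i\<in>UNIV. std_normal_density (g $ i))"

text \<open>The supremum over the empty set is taken to be 0, since \<open>Sup {}\<close> is unspecified on the
  reals. Below this matters only when all subspaces of the family are trivial.\<close>

definition gaussian_mean_width :: "(real^'n::finite) set \<Rightarrow> real" where
  "gaussian_mean_width K =
     (if K = {} then 0 else LINT g|std_gaussian_vec. (SUP z\<in>K. g \<bullet> z))"

definition gaussian_mean_norm :: "'m::finite itself \<Rightarrow> real" where
  "gaussian_mean_norm _ = (LINT g|(std_gaussian_vec :: (real^'m) measure). norm g)"

text \<open>One iteration, from the iterate \<open>x\<close> with selected subspace \<open>V\<close> to \<open>x'\<close> with \<open>V'\<close>. It is a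
  relation: each argmin may have several minimizers, or none when the family is infinite.\<close>

definition gcosamp_step ::
  "real^'n^'m \<Rightarrow> real^'m \<Rightarrow> (real^'n) set set \<Rightarrow>
   real^'n \<Rightarrow> (real^'n) set \<Rightarrow> real^'n \<Rightarrow> (real^'n) set \<Rightarrow> bool" where
  "gcosamp_step A y S x V x' V' \<longleftrightarrow>
     (let r = y - A *v x; v = transpose A *v r in
      \<exists>W z. is_arg_min (\<lambda>U. norm (v - orth_proj U v)) (\<lambda>U. U \<in> subspace_sums 2 S) W \<and>
        is_arg_min (\<lambda>u. norm (y - A *v u)) (\<lambda>u. u \<in> V + W) z \<and>
        is_arg_min (\<lambda>U. norm (z - orth_proj U z)) (\<lambda>U. U \<in> S) V' \<and>
        x' = orth_proj V' z)"

text \<open>\<open>X 0, \<dots>, X T\<close> are the iterates of a run of (at least) \<open>T\<close> iterations; the stopping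
  criterion enters only through \<open>T\<close>.\<close>

definition gcosamp_run ::
  "real^'n^'m \<Rightarrow> real^'m \<Rightarrow> (real^'n) set set \<Rightarrow> nat \<Rightarrow> (nat \<Rightarrow> real^'n) \<Rightarrow> bool" where
  "gcosamp_run A y S T X \<longleftrightarrow>
     (\<exists>V. X 0 = 0 \<and> V 0 = {0} \<and>
       (\<forall>t<T. gcosamp_step A y S (X t) (V t) (X (Suc t)) (V (Suc t))))"

definition rho_param :: "real \<Rightarrow> real \<Rightarrow> real \<Rightarrow> real \<Rightarrow> real" where
  "rho_param b w \<eta> \<mu> = 1 - \<mu> * (b - w - \<eta>)\<^sup>2"

definition xi_param :: "real \<Rightarrow> real \<Rightarrow> real \<Rightarrow> real" where
  "xi_param w \<eta> \<mu> = \<mu> * (w + \<eta>)"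

text \<open>Coefficients of the previous error and of the noise norm in the error recursion.\<close>

definition error_coeff :: "real \<Rightarrow> real \<Rightarrow> real" where
  "error_coeff \<rho>1 \<rho>2 = 4 * \<rho>2 / sqrt (1 - \<rho>1\<^sup>2)"

definition noise_coeff :: "real \<Rightarrow> real \<Rightarrow> real \<Rightarrow> real" where
  "noise_coeff \<rho>1 \<xi>1 \<xi>2 = 4 * \<xi>2 / sqrt (1 - \<rho>1\<^sup>2) + 2 * \<xi>1 / (1 - \<rho>1)"

end

theory Submission
  imports Defs
begin

text \<open>The recursion follows from restricted estimates that hold with high probability:
  \<open>b - w4 - \<eta> \<le> \<parallel>A z\<parallel> \<le> b + w4 + \<eta>\<close> for unit vectors \<open>z\<close> in the sums of four subspaces, and
  \<open>\<langle>A z, e\<rangle> \<le> (w + \<eta>) \<parallel>e\<parallel>\<close> for the noise, with \<open>w = w3\<close> and \<open>w = w4\<close>.  The four events are instances of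
  one inequality: for a 1-Lipschitz \<open>N\<close> and \<open>K\<close> in the unit sphere,
  \<open>E exp (s * sup z\<in>K. N (A z)) \<le> exp (s\<^sup>2 / 2 + s * (E N g + w K))\<close>, applied to \<open>N = norm\<close>, \<open>N = - norm\<close> and
  linear functionals.  To prove it, add an independent scalar Gaussian \<open>c\<close> and compare the processes
  \<open>N (A z) + c\<close> and \<open>N g + h \<bullet> z\<close> by Gaussian interpolation, as in Gordon's inequality.  On the right,
  concentration of \<open>N g\<close> and of \<open>sup z\<in>K. h \<bullet> z\<close> costs two factors \<open>exp (s\<^sup>2 / 2)\<close>; one of them is cancelled
  by \<open>E exp (s * c)\<close> on the left, so the sharp sub-Gaussian constant survives.\<close>

section \<open>The standard Gaussian measure on a Euclidean space\<close>

text \<open>The norm and suprema over infinite sets are not smooth, while interpolation needs two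
  bounded derivatives. Three approximations, each removed by a limit, bridge this gap: a soft
  maximum over a finite set (\<alpha> to infinity), finite sets exhausting a countable one, and a
  smoothed norm (\<epsilon> to 0). Density and homogeneity then carry the bounds to whole subspaces.
  Concentration comes from the same interpolation, used in many small decoupling steps instead of a
  differential inequality. Random noise is frozen by Fubini; this is where its independence of
  \<open>A\<close> enters. The numbers of subspaces arise as follows. The chosen \<open>W\<close>, a
  sum of two, competes with \<open>V + V0\<close>, which contains x - xp; both fit into a sum of
  four, as does \<open>V0 + (V + W)\<close>, which contains the least-squares error. The part of
  that error that meets the noise lies in \<open>V + W\<close>, a sum of three. Each of the two best
  approximations, by \<open>W\<close> and by \<open>V'\<close>, costs a factor 2; together they give
  the 4 of \<open>error_coeff\<close>.\<close>

definition gauss_density :: "'a::euclidean_space \<Rightarrow> real" where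
  "gauss_density x = exp (- (x \<bullet> x) / 2) / sqrt (2 * pi) ^ DIM('a)"

text \<open>Available on every Euclidean space, so that vectors, matrices, scalars and pairs of them
  share one calculus; independence is encoded by the product type through
  \<open>gauss_pair_measure\<close>.\<close>

definition gauss :: "'a::euclidean_space measure" where
  "gauss = density lborel gauss_density"

lemma gauss_density_eq_prod: "gauss_density x = (\<Prod>b\<in>Basis. std_normal_density (x \<bullet> b))"
proof -
  have "(\<Prod>b\<in>Basis. std_normal_density (x \<bullet> b))
     = (\<Prod>b\<in>(Basis::'a set). 1 / sqrt (2 * pi)) * exp (\<Sum>b\<in>Basis. - (x \<bullet> b)\<^sup>2 / 2)"
    by (simp add: std_normal_density_def prod.distrib exp_sum prod_dividef power_one_over)
  also have "(\<Sum>b\<in>Basis. - (x \<bullet> b)\<^sup>2 / 2) = - (\<Sum>b\<in>Basis. (x \<bullet> b) * (x \<bullet> b)) / 2"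
    by (simp add: sum_negf sum_divide_distrib power2_eq_square)
  also have "(\<Sum>b\<in>Basis. (x \<bullet> b) * (x \<bullet> b)) = x \<bullet> x"
    by (rule euclidean_inner[symmetric])
  finally show ?thesis
    by (simp add: gauss_density_def power_one_over)
qed

lemma gauss_density_nonneg [simp]: "0 \<le> gauss_density x"
  by (simp add: gauss_density_def)

lemma continuous_gauss_density [continuous_intros]:
  "continuous_on S f \<Longrightarrow> continuous_on S (\<lambda>x. gauss_density (f x))"
  unfolding gauss_density_def by (intro continuous_intros) auto

lemma measurable_gauss_density [measurable]: "gauss_density \<in> borel_measurable borel"
  by (intro borel_measurable_continuous_onI continuous_intros)

lemma space_gauss [simp]: "space gauss = UNIV"
  and sets_gauss [simp, measurable_cong]: "sets gauss = sets borel"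
  by (simp_all add: gauss_def)

lemma nn_integral_std_normal: "(\<integral>\<^sup>+t. ennreal (std_normal_density t) \<partial>lborel) = 1"
  using prob_space.emeasure_space_1[OF prob_space_normal_density[of 1 0]]
  by (simp add: emeasure_density)

lemma prob_space_gauss: "prob_space (gauss :: 'a::euclidean_space measure)"
proof
  have "emeasure (gauss :: 'a measure) UNIV = (\<integral>\<^sup>+x. (\<Prod>b\<in>Basis. ennreal (std_normal_density (x \<bullet> b))) \<partial>(lborel :: 'a measure))"
    by (simp add: gauss_def emeasure_density gauss_density_eq_prod prod_ennreal)
  also have "\<dots> = 1"
    by (subst nn_integral_lborel_prod) (auto simp: nn_integral_std_normal)
  finally show "emeasure (gauss :: 'a measure) (space gauss) = 1" by simp
qed

interpretation gauss: prob_space "gauss :: 'a::euclidean_space measure"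
  by (rule prob_space_gauss)

interpretation gauss_pair: pair_sigma_finite "gauss :: 'a::euclidean_space measure" "gauss :: 'b::euclidean_space measure" ..

interpretation lborel_gauss: pair_sigma_finite "lborel :: real measure" "gauss :: 'a::euclidean_space measure" ..

lemma gauss_pair_measure:
  "(gauss :: ('a::euclidean_space \<times> 'b::euclidean_space) measure) = gauss \<Otimes>\<^sub>M gauss"
proof -
  have "gauss \<Otimes>\<^sub>M gauss = density (lborel \<Otimes>\<^sub>M lborel)
     (\<lambda>(x::'a, y::'b). ennreal (gauss_density x) * ennreal (gauss_density y))"
    unfolding gauss_def
    by (rule pair_measure_density)
      (auto simp flip: gauss_def intro: gauss.sigma_finite_measure_axioms lborel.sigma_finite_measure_axioms)
  also have "\<dots> = density (lborel \<Otimes>\<^sub>M lborel) gauss_density"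
    by (rule arg_cong[where f = "density _"])
      (auto simp: fun_eq_iff gauss_density_def ennreal_mult'[symmetric] inner_prod_def exp_add[symmetric] power_add
        add_divide_distrib field_simps)
  finally show ?thesis by (simp add: gauss_def lborel_prod)
qed

lemma integrable_std_normal_exp_abs:
  fixes c :: real assumes "0 \<le> c"
  shows "(\<integral>\<^sup>+t. ennreal (std_normal_density t * exp (c * \<bar>t\<bar>)) \<partial>lborel) < \<infinity>"
proof -
  \<comment> \<open>Completing the square turns an exponential tilt of the density into a shifted
    normal density, which is integrable.\<close>
  have *: "std_normal_density t * exp (c * \<bar>t\<bar>)
      \<le> exp (c\<^sup>2 / 2) * normal_density c 1 t + exp (c\<^sup>2 / 2) * normal_density (-c) 1 t" for t
  proof -
    have "exp (c * \<bar>t\<bar>) \<le> exp (c * t) + exp (- (c * t))"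
      by (cases "t \<ge> 0") auto
    then have "std_normal_density t * exp (c * \<bar>t\<bar>)
       \<le> std_normal_density t * exp (c * t) + std_normal_density t * exp (- (c * t))"
      by (metis distrib_left mult_left_mono normal_density_nonneg)
    also have "std_normal_density t * exp (c * t) = exp (c\<^sup>2 / 2) * normal_density c 1 t"
      by (simp add: normal_density_def mult_exp_exp power2_eq_square field_simps)
    also have "std_normal_density t * exp (- (c * t)) = exp (c\<^sup>2 / 2) * normal_density (-c) 1 t"
      by (simp add: normal_density_def mult_exp_exp power2_eq_square field_simps)
    finally show ?thesis .
  qed
  have "integrable lborel (\<lambda>t. exp (c\<^sup>2 / 2) * normal_density c 1 t + exp (c\<^sup>2 / 2) * normal_density (-c) 1 t)"
    by (intro Bochner_Integration.integrable_add integrable_mult_right integrable_normal_density) auto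
  then have "integrable lborel (\<lambda>t. std_normal_density t * exp (c * \<bar>t\<bar>))"
    by (rule Bochner_Integration.integrable_bound) (use * in auto)
  then show ?thesis
    by (simp add: integrable_iff_bounded less_top)
qed

text \<open>The l1 norm dominates the Euclidean norm, and its exponential factors over the
  coordinates.\<close>

lemma integrable_gauss_exp_norm:
  "integrable gauss (\<lambda>x::'a::euclidean_space. exp (c * norm x))"
proof -
  define d where "d = max c 0"
  have d: "0 \<le> d" "c \<le> d" by (auto simp: d_def)
  have le: "exp (c * norm x) \<le> (\<Prod>b\<in>Basis. exp (d * \<bar>x \<bullet> b\<bar>))" for x :: 'a
  proof -
    have "c * norm x \<le> d * norm x" using d by (intro mult_right_mono) auto
    also have "\<dots> \<le> d * (\<Sum>b\<in>Basis. \<bar>x \<bullet> b\<bar>)"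
      using d by (intro mult_left_mono norm_le_l1) auto
    finally show ?thesis
      by (simp add: exp_sum[symmetric] sum_distrib_left)
  qed
  have "(\<integral>\<^sup>+x. ennreal (exp (c * norm x)) \<partial>(gauss :: 'a measure))
      = (\<integral>\<^sup>+x. ennreal (gauss_density x) * ennreal (exp (c * norm x)) \<partial>(lborel :: 'a measure))"
    unfolding gauss_def by (subst nn_integral_density) auto
  also have "\<dots> \<le> (\<integral>\<^sup>+x. (\<Prod>b\<in>Basis. ennreal (std_normal_density (x \<bullet> b) * exp (d * \<bar>x \<bullet> b\<bar>))) \<partial>(lborel :: 'a measure))"
  proof (rule nn_integral_mono)
    fix x :: 'a
    have "gauss_density x * exp (c * norm x) \<le> (\<Prod>b\<in>Basis. std_normal_density (x \<bullet> b) * exp (d * \<bar>x \<bullet> b\<bar>))"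
      using le[of x] by (simp add: prod.distrib gauss_density_eq_prod[symmetric] mult_left_mono)
    then show "ennreal (gauss_density x) * ennreal (exp (c * norm x))
      \<le> (\<Prod>b\<in>Basis. ennreal (std_normal_density (x \<bullet> b) * exp (d * \<bar>x \<bullet> b\<bar>)))"
      by (subst prod_ennreal) (auto simp: ennreal_mult'[symmetric] ennreal_leI)
  qed
  also have "\<dots> = (\<Prod>b\<in>(Basis::'a set). (\<integral>\<^sup>+t. ennreal (std_normal_density t * exp (d * \<bar>t\<bar>)) \<partial>lborel))"
    by (subst nn_integral_lborel_prod) auto
  also have "\<dots> < \<infinity>"
    using integrable_std_normal_exp_abs[OF d(1)] by (auto simp: power_less_top_ennreal)
  finally show ?thesis
    by (intro integrableI_bounded) auto
qed

section \<open>Functions of at most exponential growth\<close>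

definition exp_bounded :: "('a::real_normed_vector \<Rightarrow> 'b::real_normed_vector) \<Rightarrow> bool" where
  "exp_bounded f \<longleftrightarrow> (\<exists>C c. \<forall>x. norm (f x) \<le> C * exp (c * norm x))"

lemma exp_boundedE:
  assumes "exp_bounded f"
  obtains C c where "0 \<le> C" "0 \<le> c" "\<And>x. norm (f x) \<le> C * exp (c * norm x)"
proof -
  from assms obtain C c where *: "norm (f x) \<le> C * exp (c * norm x)" for x
    by (auto simp: exp_bounded_def)
  have "norm (f x) \<le> \<bar>C\<bar> * exp (\<bar>c\<bar> * norm x)" for x
  proof -
    have "C * exp (c * norm x) \<le> \<bar>C\<bar> * exp (\<bar>c\<bar> * norm x)"
      by (intro mult_mono) (auto simp: mult_right_mono)
    with *[of x] show ?thesis by linarith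
  qed
  then show ?thesis by (intro that[of "\<bar>C\<bar>" "\<bar>c\<bar>"]) auto
qed

lemma exp_boundedI: "(\<And>x. norm (f x) \<le> C * exp (c * norm x)) \<Longrightarrow> exp_bounded f"
  by (auto simp: exp_bounded_def)

lemma exp_bounded_bounded: "(\<And>x. norm (f x) \<le> C) \<Longrightarrow> exp_bounded f"
  by (rule exp_boundedI[of _ C 0]) auto

lemma exp_bounded_const: "exp_bounded (\<lambda>_. c)"
  by (rule exp_bounded_bounded[of _ "norm c"]) simp

lemma exp_bounded_linear_growth:
  fixes f :: "'a::real_normed_vector \<Rightarrow> 'b::real_normed_vector"
  assumes "\<And>x. norm (f x) \<le> C + D * norm x"
  shows "exp_bounded f"
proof (rule exp_boundedI[of _ "\<bar>C\<bar> + \<bar>D\<bar>" 1])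
  fix x :: 'a
  have "1 \<le> exp (norm x)" "norm x \<le> exp (norm x)"
    using exp_ge_add_one_self[of "norm x"] norm_ge_zero[of x] by linarith+
  then have "\<bar>C\<bar> * 1 \<le> \<bar>C\<bar> * exp (norm x)" "\<bar>D\<bar> * norm x \<le> \<bar>D\<bar> * exp (norm x)"
    by (intro mult_left_mono; simp)+
  moreover have "D * norm x \<le> \<bar>D\<bar> * norm x" by (auto intro!: mult_right_mono)
  ultimately show "norm (f x) \<le> (\<bar>C\<bar> + \<bar>D\<bar>) * exp (1 * norm x)"
    using assms[of x] by (simp add: distrib_right)
qed

lemma exp_bounded_add: "exp_bounded f \<Longrightarrow> exp_bounded g \<Longrightarrow> exp_bounded (\<lambda>x. f x + g x)"
proof (elim exp_boundedE)
  fix C c D d :: real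
  assume *: "0 \<le> C" "0 \<le> c" "\<And>x. norm (f x) \<le> C * exp (c * norm x)"
    "0 \<le> D" "0 \<le> d" "\<And>x. norm (g x) \<le> D * exp (d * norm x)"
  have "norm (f x + g x) \<le> (C + D) * exp ((c + d) * norm x)" for x
  proof -
    have "C * exp (c * norm x) \<le> C * exp ((c + d) * norm x)" "D * exp (d * norm x) \<le> D * exp ((c + d) * norm x)"
      using * by (auto intro!: mult_left_mono mult_right_mono)
    then show ?thesis
      using *(3,6)[of x] norm_triangle_ineq[of "f x" "g x"] by (simp add: distrib_right)
  qed
  then show ?thesis by (rule exp_boundedI)
qed

lemma exp_bounded_mult:
  fixes f g :: "_ \<Rightarrow> real"
  shows "exp_bounded f \<Longrightarrow> exp_bounded g \<Longrightarrow> exp_bounded (\<lambda>x. f x * g x)"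
proof (elim exp_boundedE)
  fix C c D d :: real
  assume *: "0 \<le> C" "0 \<le> c" "\<And>x. norm (f x) \<le> C * exp (c * norm x)"
    "0 \<le> D" "0 \<le> d" "\<And>x. norm (g x) \<le> D * exp (d * norm x)"
  have "norm (f x * g x) \<le> (C * D) * exp ((c + d) * norm x)" for x
  proof -
    have "norm (f x) * norm (g x) \<le> (C * exp (c * norm x)) * (D * exp (d * norm x))"
      using * by (intro mult_mono) auto
    moreover have "exp ((c + d) * norm x) = exp (c * norm x) * exp (d * norm x)"
      by (simp add: distrib_right exp_add)
    ultimately show ?thesis
      by (simp add: abs_mult mult_ac)
  qed
  then show ?thesis by (rule exp_boundedI)
qed

lemma exp_bounded_compose:
  assumes "exp_bounded f" "\<And>x. norm (h x) \<le> B * norm x"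
  shows "exp_bounded (\<lambda>x. f (h x))"
  using assms(1)
proof (elim exp_boundedE)
  fix C c :: real
  assume *: "0 \<le> C" "0 \<le> c" "\<And>x. norm (f x) \<le> C * exp (c * norm x)"
  have "norm (f (h x)) \<le> C * exp ((c * B) * norm x)" for x
  proof -
    have "C * exp (c * norm (h x)) \<le> C * exp (c * B * norm x)"
      using * assms(2)[of x] by (auto intro!: mult_left_mono simp: mult.assoc)
    with *(3)[of "h x"] show ?thesis by linarith
  qed
  then show ?thesis by (rule exp_boundedI)
qed

lemma exp_bounded_inner: "exp_bounded (\<lambda>x. x \<bullet> b)"
  by (rule exp_bounded_linear_growth[of _ 0 "norm b"])
    (use Cauchy_Schwarz_ineq2 in \<open>auto simp: mult.commute\<close>)

lemma exp_bounded_sum: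
  assumes "\<And>i. i \<in> I \<Longrightarrow> exp_bounded (f i)"
  shows "exp_bounded (\<lambda>x. \<Sum>i\<in>I. f i x)"
  using assms
proof (induction I rule: infinite_finite_induct)
  case (insert i I)
  then show ?case by (auto intro: exp_bounded_add)
qed (auto intro: exp_bounded_bounded[of _ 0])

text \<open>Integrability in the interpolation arguments is reduced to continuity and growth, both
  of which are stable under sums, products and linear substitutions.\<close>

lemma integrable_gauss:
  fixes f :: "'a::euclidean_space \<Rightarrow> real"
  assumes "continuous_on UNIV f" "exp_bounded f"
  shows "integrable gauss f"
  using assms(2)
proof (elim exp_boundedE)
  fix C c :: real
  assume *: "0 \<le> C" "0 \<le> c" "\<And>x. norm (f x) \<le> C * exp (c * norm x)"
  have "f \<in> borel_measurable borel"
    using assms(1) by (rule borel_measurable_continuous_onI)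
  moreover have "integrable gauss (\<lambda>x::'a. C * exp (c * norm x))"
    by (intro integrable_mult_right integrable_gauss_exp_norm)
  ultimately show ?thesis
    by (intro Bochner_Integration.integrable_bound[of gauss "\<lambda>x. C * exp (c * norm x)" f])
      (use * in \<open>auto intro: order_trans simp: measurable_cong_sets[OF sets_gauss refl]\<close>)
qed

text \<open>Avoids differentiation under the integral sign: the fundamental theorem of calculus on each
  fibre is combined with Fubini's theorem.\<close>

lemma integral_diff_eq_integral_deriv:
  fixes \<phi> \<phi>' :: "real \<Rightarrow> 'p \<Rightarrow> real"
  assumes "sigma_finite_measure M" "a \<le> b"
    and deriv: "\<And>p t. p \<in> space M \<Longrightarrow> t \<in> {a..b} \<Longrightarrow> ((\<lambda>t. \<phi> t p) has_real_derivative \<phi>' t p) (at t)"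
    and cont: "\<And>p. p \<in> space M \<Longrightarrow> continuous_on {a..b} (\<lambda>t. \<phi>' t p)"
    and int: "integrable (lborel \<Otimes>\<^sub>M M) (\<lambda>(t, p). indicator {a..b} t * \<phi>' t p)"
  shows "(\<integral>p. \<phi> b p - \<phi> a p \<partial>M) = (\<integral>t. indicator {a..b} t * (\<integral>p. \<phi>' t p \<partial>M) \<partial>lborel)"
proof -
  interpret M: sigma_finite_measure M by fact
  interpret P: pair_sigma_finite lborel M ..
  have "(\<integral>p. \<phi> b p - \<phi> a p \<partial>M) = (\<integral>p. (\<integral>t. indicator {a..b} t * \<phi>' t p \<partial>lborel) \<partial>M)"
  proof (rule Bochner_Integration.integral_cong[OF refl])
    fix p assume p: "p \<in> space M"
    have "(\<integral>t. indicator {a..b} t *\<^sub>R \<phi>' t p \<partial>lborel) = \<phi> b p - \<phi> a p"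
      by (rule integral_FTC_atLeastAtMost[OF \<open>a \<le> b\<close>])
        (use deriv[OF p] cont[OF p] in \<open>auto intro: has_vector_derivative_at_within
          simp: has_real_derivative_iff_has_vector_derivative\<close>)
    then show "\<phi> b p - \<phi> a p = (\<integral>t. indicator {a..b} t * \<phi>' t p \<partial>lborel)" by simp
  qed
  also have "\<dots> = (\<integral>t. (\<integral>p. indicator {a..b} t * \<phi>' t p \<partial>M) \<partial>lborel)"
    using P.Fubini_integral[OF int] by simp
  finally show ?thesis by simp
qed

section \<open>Gaussian integration by parts\<close>

lemma integral_lborel_translate:
  fixes f :: "'a::euclidean_space \<Rightarrow> real"
  assumes "f \<in> borel_measurable borel"
  shows "(\<integral>x. f (c + x) \<partial>lborel) = (\<integral>x. f x \<partial>lborel)"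
proof -
  have "(\<integral>x. f x \<partial>lborel) = (\<integral>x. f x \<partial>(distr lborel borel ((+) c)))"
    by (simp add: lborel_distr_plus)
  also have "\<dots> = (\<integral>x. f (c + x) \<partial>lborel)"
    by (subst integral_distr) (use assms in auto)
  finally show ?thesis by simp
qed

lemma integrable_lborel_translate:
  fixes f :: "'a::euclidean_space \<Rightarrow> real"
  assumes "integrable lborel f"
  shows "integrable lborel (\<lambda>x. f (c + x))"
proof -
  have "integrable (distr lborel borel ((+) c)) f"
    using assms by (simp add: lborel_distr_plus)
  then show ?thesis
    by (subst (asm) integrable_distr_eq) (use assms in auto)
qed

text \<open>Translation invariance makes the integral of f (x + b) - f x vanish. The fundamental
  theorem of calculus along the segment rewrites it as an average over t of integrals of translates
  of f', which all agree. No decay at infinity has to be discussed.\<close>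

lemma integral_directional_deriv_eq_0:
  fixes f f' :: "'a::euclidean_space \<Rightarrow> real"
  assumes f: "integrable lborel f" and f': "integrable lborel f'"
    and cont: "continuous_on UNIV f'"
    and deriv: "\<And>x. ((\<lambda>t. f (x + t *\<^sub>R b)) has_real_derivative f' x) (at 0)"
  shows "(\<integral>x. f' x \<partial>lborel) = 0"
proof -
  have [measurable]: "f \<in> borel_measurable borel" "f' \<in> borel_measurable borel"
    using f f' by auto
  have d: "((\<lambda>t. f (t *\<^sub>R b + x)) has_real_derivative f' (t *\<^sub>R b + x)) (at t)" for x t
    using DERIV_shift[of "\<lambda>t. f (t *\<^sub>R b + x)" "f' (t *\<^sub>R b + x)" 0 t] deriv[of "t *\<^sub>R b + x"]
    by (simp add: algebra_simps)
  have m: "(\<lambda>(t, x). indicator {0..1::real} t * f' (t *\<^sub>R b + x)) \<in> borel_measurable (lborel \<Otimes>\<^sub>M lborel)"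
    by measurable
  have int: "integrable (lborel \<Otimes>\<^sub>M lborel) (\<lambda>(t, x). indicator {0..1::real} t * f' (t *\<^sub>R b + x))"
  proof (rule lborel_pair.Fubini_integrable[OF m], goal_cases)
    case 1
    have "(\<integral>x. norm (indicator {0..1} t * f' (t *\<^sub>R b + x)) \<partial>lborel) = indicator {0..1} t * (\<integral>x. \<bar>f' x\<bar> \<partial>lborel)" for t :: real
      by (subst integral_lborel_translate[symmetric, of "\<lambda>x. \<bar>f' x\<bar>" "t *\<^sub>R b"]) (auto simp: abs_mult)
    then show ?case by (auto simp: integrable_mult_left)
  next
    case 2
    then show ?case by (auto intro!: AE_I2 integrable_mult_right integrable_lborel_translate f')
  qed
  have "(\<integral>x. f (1 *\<^sub>R b + x) - f (0 *\<^sub>R b + x) \<partial>lborel)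
     = (\<integral>t. indicator {0..1} t * (\<integral>x. f' (t *\<^sub>R b + x) \<partial>lborel) \<partial>lborel)"
    by (rule integral_diff_eq_integral_deriv[OF lborel.sigma_finite_measure_axioms _ d _ int])
      (auto intro!: continuous_intros continuous_on_compose2[OF cont])
  moreover have "(\<integral>x. f (1 *\<^sub>R b + x) - f (0 *\<^sub>R b + x) \<partial>lborel) = 0"
    by (subst Bochner_Integration.integral_diff) (auto intro!: integrable_lborel_translate f simp: integral_lborel_translate f)
  ultimately show ?thesis
    by (simp add: integral_lborel_translate)
qed

text \<open>The integral of the derivative of \<open>gauss_density x * f x\<close> along b vanishes,
  and differentiating the density produces the factor -(x \<bullet> b). This is Stein's identity; b
  may be any vector.\<close>

lemma gauss_integration_by_parts:
  fixes f f' :: "'a::euclidean_space \<Rightarrow> real"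
  assumes cont: "continuous_on UNIV f" "continuous_on UNIV f'"
    and bdd: "exp_bounded f" "exp_bounded f'"
    and deriv: "\<And>x. ((\<lambda>t. f (x + t *\<^sub>R b)) has_real_derivative f' x) (at 0)"
  shows "(\<integral>x. (x \<bullet> b) * f x \<partial>gauss) = (\<integral>x. f' x \<partial>gauss)"
proof -
  let ?g = "gauss_density :: 'a \<Rightarrow> real"
  have cont_xf: "continuous_on UNIV (\<lambda>x. (x \<bullet> b) * f x)"
    by (intro continuous_intros cont)
  have int: "integrable gauss f" "integrable gauss f'" "integrable gauss (\<lambda>x. (x \<bullet> b) * f x)"
    using cont cont_xf bdd by (auto intro!: integrable_gauss exp_bounded_mult exp_bounded_inner)
  have [measurable]: "f \<in> borel_measurable borel" "f' \<in> borel_measurable borel"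
    using cont by (auto intro: borel_measurable_continuous_onI)
  have intl: "integrable lborel (\<lambda>x. ?g x * h x)" if "integrable gauss h" "h \<in> borel_measurable borel" for h :: "'a \<Rightarrow> real"
    using that unfolding gauss_def by (subst (asm) integrable_density) auto
  have eq: "(\<integral>x. h x \<partial>gauss) = (\<integral>x. ?g x * h x \<partial>lborel)" if "h \<in> borel_measurable borel" for h :: "'a \<Rightarrow> real"
    using that unfolding gauss_def by (subst integral_density) auto
  have dg: "((\<lambda>t. ?g (x + t *\<^sub>R b)) has_real_derivative - (x \<bullet> b) * ?g x) (at 0)" for x
  proof -
    have "(x + t *\<^sub>R b) \<bullet> (x + t *\<^sub>R b) = x \<bullet> x + 2 * (x \<bullet> b) * t + (b \<bullet> b) * t\<^sup>2" for t
      by (simp add: inner_add inner_commute power2_eq_square algebra_simps)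
    then show ?thesis
      unfolding gauss_density_def by (auto intro!: derivative_eq_intros)
  qed
  have "(\<integral>x. ?g x * f' x - ?g x * ((x \<bullet> b) * f x) \<partial>lborel) = 0"
  proof (rule integral_directional_deriv_eq_0)
    show "integrable lborel (\<lambda>x. ?g x * f x)"
      using int by (intro intl) auto
    show "integrable lborel (\<lambda>x. ?g x * f' x - ?g x * ((x \<bullet> b) * f x))"
      using int by (intro Bochner_Integration.integrable_diff intl) auto
    show "continuous_on UNIV (\<lambda>x. ?g x * f' x - ?g x * ((x \<bullet> b) * f x))"
      using cont by (intro continuous_intros)
    show "((\<lambda>t. ?g (x + t *\<^sub>R b) * f (x + t *\<^sub>R b)) has_real_derivative
         ?g x * f' x - ?g x * ((x \<bullet> b) * f x)) (at 0)" for x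
      using DERIV_mult[OF dg[of x] deriv[of x]] by (simp add: algebra_simps)
  qed
  moreover have "(\<integral>x. ?g x * f' x - ?g x * ((x \<bullet> b) * f x) \<partial>lborel)
      = (\<integral>x. ?g x * f' x \<partial>lborel) - (\<integral>x. ?g x * ((x \<bullet> b) * f x) \<partial>lborel)"
    using int by (intro Bochner_Integration.integral_diff intl) auto
  ultimately show ?thesis by (simp add: eq)
qed

section \<open>Gaussian interpolation\<close>

text \<open>\<open>D p v\<close> and \<open>Q p v\<close> are the first and second derivative of \<open>q\<close> at \<open>p\<close> in direction \<open>v\<close>.\<close>

definition bounded_C2 ::
  "('a::euclidean_space \<Rightarrow> real) \<Rightarrow> ('a \<Rightarrow> 'a \<Rightarrow> real) \<Rightarrow> ('a \<Rightarrow> 'a \<Rightarrow> real) \<Rightarrow> bool" where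
  "bounded_C2 q D Q \<longleftrightarrow>
     (\<forall>p. (q has_derivative D p) (at p)) \<and>
     (\<forall>v. continuous_on UNIV (\<lambda>p. D p v)) \<and> (\<exists>B. \<forall>p v. \<bar>D p v\<bar> \<le> B * norm v) \<and>
     (\<forall>p v. ((\<lambda>t. D (p + t *\<^sub>R v) v) has_real_derivative Q p v) (at 0)) \<and>
     (\<forall>v. continuous_on UNIV (\<lambda>p. Q p v)) \<and> (\<exists>B. \<forall>p v. \<bar>Q p v\<bar> \<le> B * (norm v)\<^sup>2)"

section \<open>Calculus of functions with bounded first and second derivatives\<close>

context
  fixes q :: "'a::euclidean_space \<Rightarrow> real" and D Q
  assumes q: "bounded_C2 q D Q"
begin

lemma C2_has_derivative: "(q has_derivative D p) (at p)"
  and C2_cont_D: "continuous_on UNIV (\<lambda>p. D p v)"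
  and C2_has_derivative2: "((\<lambda>t. D (p + t *\<^sub>R v) v) has_real_derivative Q p v) (at 0)"
  and C2_cont_Q: "continuous_on UNIV (\<lambda>p. Q p v)"
  using q by (auto simp: bounded_C2_def)

lemma C2_linear_D: "linear (D p)"
  using C2_has_derivative has_derivative_linear by blast

lemma C2_bound_D:
  obtains B where "0 \<le> B" "\<And>p v. \<bar>D p v\<bar> \<le> B * norm v"
proof -
  from q obtain B where B: "\<And>p v. \<bar>D p v\<bar> \<le> B * norm v" by (auto simp: bounded_C2_def)
  have "B * norm v \<le> \<bar>B\<bar> * norm v" for v :: 'a by (auto intro: mult_right_mono)
  with B show ?thesis by (intro that[of "\<bar>B\<bar>"]) (auto intro: order_trans)
qed

lemma C2_bound_Q:
  obtains B where "0 \<le> B" "\<And>p v. \<bar>Q p v\<bar> \<le> B * (norm v)\<^sup>2"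
proof -
  from q obtain B where B: "\<And>p v. \<bar>Q p v\<bar> \<le> B * (norm v)\<^sup>2" by (auto simp: bounded_C2_def)
  have "B * (norm v)\<^sup>2 \<le> \<bar>B\<bar> * (norm v)\<^sup>2" for v :: 'a by (auto intro: mult_right_mono)
  with B show ?thesis by (intro that[of "\<bar>B\<bar>"]) (auto intro: order_trans)
qed

lemma C2_lipschitz:
  assumes "\<And>p v. \<bar>D p v\<bar> \<le> B * norm v"
  shows "\<bar>q x - q y\<bar> \<le> B * norm (x - y)"
proof -
  have "norm (q x - q y) \<le> B * norm (x - y)"
  proof (rule differentiable_bound[of UNIV q D B x y])
    show "onorm (D z) \<le> B" for z
      using assms by (intro onorm_le) auto
  qed (use C2_has_derivative in auto)
  then show ?thesis by simp
qed

lemma C2_continuous: "continuous_on UNIV q"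
  using C2_has_derivative by (meson continuous_at_imp_continuous_on has_derivative_continuous)

lemma C2_exp_bounded: "exp_bounded q"
proof -
  obtain B where "\<And>p v. \<bar>D p v\<bar> \<le> B * norm v" using C2_bound_D by metis
  from C2_lipschitz[OF this, of _ 0] have "\<bar>q x\<bar> \<le> \<bar>q 0\<bar> + B * norm x" for x
    by (smt (verit) diff_zero)
  then show ?thesis
    by (intro exp_bounded_linear_growth[of q "\<bar>q 0\<bar>" B]) auto
qed

lemma C2_exp_bounded_exp: "exp_bounded (\<lambda>x. exp (c * q x))"
proof -
  obtain B where "\<And>p v. \<bar>D p v\<bar> \<le> B * norm v" using C2_bound_D by metis
  from C2_lipschitz[OF this, of _ 0] have *: "\<bar>q x - q 0\<bar> \<le> B * norm x" for x
    by simp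
  have "c * q x \<le> c * q 0 + \<bar>c\<bar> * B * norm x" for x
  proof -
    have "c * q x - c * q 0 \<le> \<bar>c\<bar> * \<bar>q x - q 0\<bar>"
      by (metis abs_le_D1 abs_mult order_refl right_diff_distrib)
    also have "\<dots> \<le> \<bar>c\<bar> * (B * norm x)" by (intro mult_left_mono *) auto
    finally show ?thesis by (simp add: algebra_simps)
  qed
  then show ?thesis
    by (intro exp_boundedI[of _ "exp (c * q 0)" "\<bar>c\<bar> * B"]) (auto simp: exp_add[symmetric])
qed

lemma C2_integrable: "integrable gauss q"
  and C2_integrable_exp: "integrable gauss (\<lambda>x. exp (c * q x))"
  by (auto intro!: integrable_gauss C2_exp_bounded C2_exp_bounded_exp continuous_intros C2_continuous)

text \<open>\<open>Q\<close> is only a second derivative along lines and is not assumed to be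
  quadratic in v, so homogeneity is derived from the chain rule and uniqueness of derivatives. It
  evaluates \<open>Q\<close> in the directions \<open>(z $ j) *\<^sub>R axis i 1\<close> produced by
  matrix units.\<close>

lemma C2_second_scale: "Q p (c *\<^sub>R v) = c\<^sup>2 * Q p v"
proof -
  have "((\<lambda>t. D (p + (t * c) *\<^sub>R v) v) has_real_derivative Q p v * c) (at 0)"
    by (rule DERIV_chain'[of "\<lambda>t. t * c" c, where g = "\<lambda>s. D (p + s *\<^sub>R v) v", simplified mult.commute])
      (auto intro!: derivative_eq_intros simp: C2_has_derivative2)
  then have "((\<lambda>t. c * D (p + (t * c) *\<^sub>R v) v) has_real_derivative c * (Q p v * c)) (at 0)"
    by (rule DERIV_cmult)
  moreover have "c * D (p + (t * c) *\<^sub>R v) v = D (p + t *\<^sub>R (c *\<^sub>R v)) (c *\<^sub>R v)" for t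
    using linear_cmul[OF C2_linear_D] by simp
  ultimately have "((\<lambda>t. D (p + t *\<^sub>R (c *\<^sub>R v)) (c *\<^sub>R v)) has_real_derivative c * (Q p v * c)) (at 0)"
    by simp
  from DERIV_unique[OF C2_has_derivative2 this] show ?thesis
    by (simp add: power2_eq_square mult_ac)
qed

lemma C2_exp_second:
  "((\<lambda>t. exp (q (p + t *\<^sub>R v)) * D (p + t *\<^sub>R v) v) has_real_derivative
     exp (q p) * ((D p v)\<^sup>2 + Q p v)) (at 0)"
proof -
  have "((\<lambda>t. p + t *\<^sub>R v) has_derivative (\<lambda>h. h *\<^sub>R v)) (at 0)"
    by (auto intro!: derivative_eq_intros)
  from has_derivative_compose[OF this, of q "D p"] C2_has_derivative[of p]
  have "((\<lambda>t. q (p + t *\<^sub>R v)) has_derivative (\<lambda>h. D p (h *\<^sub>R v))) (at 0)"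
    by simp
  then have "((\<lambda>t. q (p + t *\<^sub>R v)) has_real_derivative D p v) (at 0)"
    by (rule has_derivative_imp_has_field_derivative) (simp add: linear_cmul[OF C2_linear_D] mult.commute)
  from DERIV_mult[OF DERIV_fun_exp[OF this] C2_has_derivative2[of p v]]
  show ?thesis by (simp add: algebra_simps power2_eq_square)
qed

lemma C2_add:
  assumes q': "bounded_C2 q' D' Q'"
  shows "bounded_C2 (\<lambda>x. q x + q' x) (\<lambda>p v. D p v + D' p v) (\<lambda>p v. Q p v + Q' p v)"
proof -
  obtain B B' where B: "\<And>p v. \<bar>D p v\<bar> \<le> B * norm v" "\<And>p v. \<bar>D' p v\<bar> \<le> B' * norm v"
    using q q' by (auto simp: bounded_C2_def)
  have 1: "\<bar>D p v + D' p v\<bar> \<le> (B + B') * norm v" for p v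
    using abs_triangle_ineq[of "D p v" "D' p v"] B(1)[of p v] B(2)[of p v] by (simp add: distrib_right)
  obtain B B' where B: "\<And>p v. \<bar>Q p v\<bar> \<le> B * (norm v)\<^sup>2" "\<And>p v. \<bar>Q' p v\<bar> \<le> B' * (norm v)\<^sup>2"
    using q q' by (auto simp: bounded_C2_def)
  have 2: "\<bar>Q p v + Q' p v\<bar> \<le> (B + B') * (norm v)\<^sup>2" for p v
    using abs_triangle_ineq[of "Q p v" "Q' p v"] B(1)[of p v] B(2)[of p v] by (simp add: distrib_right)
  show ?thesis
    using q q' 1 2 unfolding bounded_C2_def
    by (auto intro!: has_derivative_add DERIV_add continuous_on_add)
qed

lemma C2_cmult: "bounded_C2 (\<lambda>x. c * q x) (\<lambda>p v. c * D p v) (\<lambda>p v. c * Q p v)"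
proof -
  obtain B where B: "\<And>p v. \<bar>D p v\<bar> \<le> B * norm v" using C2_bound_D by metis
  have 1: "\<bar>c * D p v\<bar> \<le> \<bar>c\<bar> * B * norm v" for p v
    using mult_left_mono[OF B[of p v], of "\<bar>c\<bar>"] by (simp add: abs_mult mult.assoc)
  obtain B where B: "\<And>p v. \<bar>Q p v\<bar> \<le> B * (norm v)\<^sup>2" using C2_bound_Q by metis
  have 2: "\<bar>c * Q p v\<bar> \<le> \<bar>c\<bar> * B * (norm v)\<^sup>2" for p v
    using mult_left_mono[OF B[of p v], of "\<bar>c\<bar>"] by (simp add: abs_mult mult.assoc)
  show ?thesis
    using q 1 2 unfolding bounded_C2_def
    by (auto intro!: has_derivative_mult_right DERIV_cmult continuous_on_mult_left)
qed

lemma C2_compose_linear: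
  fixes L :: "'b::euclidean_space \<Rightarrow> 'a"
  assumes L: "linear L"
  shows "bounded_C2 (\<lambda>x. q (L x)) (\<lambda>p v. D (L p) (L v)) (\<lambda>p v. Q (L p) (L v))"
proof -
  obtain b where b: "norm (L v) \<le> b * norm v" for v
    using linear_bounded[OF L] by auto
  have LL: "(L has_derivative L) (at p)" for p
    using L by (simp add: linear_conv_bounded_linear bounded_linear_imp_has_derivative)
  have cL: "continuous_on UNIV L"
    using LL by (meson continuous_at_imp_continuous_on has_derivative_continuous)
  obtain B where B: "0 \<le> B" "\<And>p v. \<bar>D p v\<bar> \<le> B * norm v" using C2_bound_D by metis
  have 1: "\<bar>D (L p) (L v)\<bar> \<le> (B * b) * norm v" for p v
    using mult_left_mono[OF b[of v] B(1)] B(2)[of "L p" "L v"] by (simp add: mult.assoc)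
  obtain B where B: "0 \<le> B" "\<And>p v. \<bar>Q p v\<bar> \<le> B * (norm v)\<^sup>2" using C2_bound_Q by metis
  have 2: "\<bar>Q (L p) (L v)\<bar> \<le> (B * b\<^sup>2) * (norm v)\<^sup>2" for p v
  proof -
    have "(norm (L v))\<^sup>2 \<le> b\<^sup>2 * (norm v)\<^sup>2"
      using power_mono[OF b[of v], of 2] by (simp add: power_mult_distrib)
    from mult_left_mono[OF this B(1)] B(2)[of "L p" "L v"] show ?thesis by (simp add: mult.assoc)
  qed
  have 3: "((\<lambda>t. D (L (p + t *\<^sub>R v)) (L v)) has_real_derivative Q (L p) (L v)) (at 0)" for p v
    using C2_has_derivative2[of "L p" "L v"] by (simp add: linear_add[OF L] linear_cmul[OF L])
  show ?thesis
    using 1 2 3 unfolding bounded_C2_def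
    by (auto intro!: has_derivative_compose[OF LL C2_has_derivative] continuous_on_compose2[OF C2_cont_D cL] continuous_on_compose2[OF C2_cont_Q cL])
qed

end

lemma C2_linear:
  fixes L :: "'a::euclidean_space \<Rightarrow> real"
  assumes L: "linear L"
  shows "bounded_C2 L (\<lambda>p. L) (\<lambda>p v. 0)"
proof -
  obtain b where b: "\<bar>L v\<bar> \<le> b * norm v" for v
    using linear_bounded[OF L] by auto
  show ?thesis
    using L b unfolding bounded_C2_def
    by (auto simp: linear_conv_bounded_linear bounded_linear_imp_has_derivative intro: exI[of _ 0])
qed

section \<open>Interpolation between the two components of a Gaussian pair\<close>

lemma integral_gauss_fst:
  fixes f :: "'a::euclidean_space \<Rightarrow> real"
  assumes [measurable]: "f \<in> borel_measurable borel"
  shows "(\<integral>p. f (fst p) \<partial>(gauss :: ('a \<times> 'b::euclidean_space) measure)) = (\<integral>x. f x \<partial>gauss)"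
proof -
  have "(\<integral>x. f x \<partial>(gauss :: 'a measure)) = (\<integral>x. f x \<partial>(distr (gauss \<Otimes>\<^sub>M (gauss :: 'b measure)) gauss fst))"
    by (simp add: gauss.distr_pair_fst)
  also have "\<dots> = (\<integral>p. f (fst p) \<partial>(gauss \<Otimes>\<^sub>M (gauss :: 'b measure)))"
    by (subst integral_distr) auto
  finally show ?thesis by (simp add: gauss_pair_measure)
qed

lemma integral_gauss_snd:
  fixes f :: "'b::euclidean_space \<Rightarrow> real"
  assumes [measurable]: "f \<in> borel_measurable borel"
  shows "(\<integral>p. f (snd p) \<partial>(gauss :: ('a::euclidean_space \<times> 'b) measure)) = (\<integral>x. f x \<partial>gauss)"
proof -
  have "(\<integral>p. f (fst p) \<partial>(gauss :: ('b \<times> 'a) measure)) = (\<integral>p. f (snd p) \<partial>(gauss :: ('a \<times> 'b) measure))"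
    unfolding gauss_pair_measure
    by (subst gauss_pair.integral_product_swap[symmetric]) (auto intro!: Bochner_Integration.integral_cong)
  then show ?thesis by (simp add: integral_gauss_fst)
qed

lemma sum_Basis_prod:
  fixes f :: "'a::euclidean_space \<times> 'b::euclidean_space \<Rightarrow> real"
  shows "sum f Basis = (\<Sum>b\<in>Basis. f (b, 0)) + (\<Sum>b\<in>Basis. f (0, b))"
proof -
  have "inj_on (\<lambda>u. (u::'a, 0::'b)) Basis" "inj_on (\<lambda>u. (0::'a, u::'b)) Basis"
    by (auto intro!: inj_onI)
  then show ?thesis
    unfolding Basis_prod_def
    by (subst sum.union_disjoint) (auto simp: Basis_prod_def sum.reindex)
qed

text \<open>The path \<open>(sin t * x, cos t * y)\<close> leads from \<open>(0, y)\<close> to \<open>(x, 0)\<close>.  Integration by parts turns the derivative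
  of \<open>E exp q\<close> along it into the difference of the Laplacians of \<open>exp q\<close> in the two variables.\<close>

lemma gauss_exp_interpolation:
  fixes q :: "'a::euclidean_space \<times> 'b::euclidean_space \<Rightarrow> real"
  assumes q: "bounded_C2 q D Q"
    and le: "\<And>p. (\<Sum>b\<in>Basis. (D p (b, 0))\<^sup>2 + Q p (b, 0)) - (\<Sum>b\<in>Basis. (D p (0, b))\<^sup>2 + Q p (0, b)) \<le> 2 * \<kappa>"
  shows "(\<integral>x. exp (q (x, 0)) \<partial>gauss) \<le> exp \<kappa> * (\<integral>y. exp (q (0, y)) \<partial>gauss)"
proof -
  define Z where "Z t p = (sin t *\<^sub>R fst p, cos t *\<^sub>R snd p)" for t and p :: "'a \<times> 'b"
  define f where "f p = exp (q p)" for p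
  \<comment> \<open>The second derivative of \<open>exp q\<close> along v, see
    \<open>C2_exp_second\<close>.\<close>
  define h where "h v p = f p * ((D p v)\<^sup>2 + Q p v)" for v p
  \<comment> \<open>The derivative of \<open>f (Z t p)\<close> in t, with the velocity of the path
    expanded in the basis.\<close>
  define U where "U t p = (\<Sum>b\<in>Basis. (cos t * (p \<bullet> (b, 0))) * (f (Z t p) * D (Z t p) (b, 0)))
      - (\<Sum>b\<in>Basis. (sin t * (p \<bullet> (0, b))) * (f (Z t p) * D (Z t p) (0, b)))" for t p
  \<comment> \<open>An integrating factor: the derivative 2 sin t cos t of (sin t)^2 is, up to
    \<kappa>, the factor that integration by parts produces, and (sin t)^2 rises from 0 to 1, which
    yields exp \<kappa> in total.\<close>
  define \<phi> where "\<phi> t p = exp (- \<kappa> * (sin t)\<^sup>2) * f (Z t p)" for t p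
  define \<phi>' where "\<phi>' t p = exp (- \<kappa> * (sin t)\<^sup>2) * (U t p - 2 * \<kappa> * sin t * cos t * f (Z t p))" for t p
  note contD = C2_cont_D[OF q] and contQ = C2_cont_Q[OF q] and contq = C2_continuous[OF q]
  have normZ: "norm (Z t p) \<le> 1 * norm p" for t p
  proof -
    have "(sin t * norm (fst p))\<^sup>2 \<le> (norm (fst p))\<^sup>2" "(cos t * norm (snd p))\<^sup>2 \<le> (norm (snd p))\<^sup>2"
      using abs_square_le_1[of "sin t"] abs_square_le_1[of "cos t"]
      by (auto simp: power_mult_distrib mult_left_le_one_le)
    then show ?thesis
      unfolding Z_def norm_prod_def by (auto simp: power_mult_distrib)
  qed
  obtain B where B: "0 \<le> B" "\<And>p v. \<bar>D p v\<bar> \<le> B * norm v" using C2_bound_D[OF q] by metis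
  have bddD: "exp_bounded (\<lambda>p. D p v)" for v
    by (rule exp_bounded_bounded[of _ "B * norm v"]) (use B in auto)
  obtain BQ where BQ: "\<And>p v. \<bar>Q p v\<bar> \<le> BQ * (norm v)\<^sup>2" using C2_bound_Q[OF q] by metis
  have bddQ: "exp_bounded (\<lambda>p. Q p v)" for v
    by (rule exp_bounded_bounded[of _ "BQ * (norm v)\<^sup>2"]) (use BQ in auto)
  have bddf: "exp_bounded f"
    unfolding f_def using C2_exp_bounded_exp[OF q, of 1] by simp
  have bddh: "exp_bounded (h v)" for v
    unfolding h_def[abs_def] power2_eq_square by (intro exp_bounded_mult exp_bounded_add bddf bddD bddQ)
  have contf: "continuous_on UNIV f" unfolding f_def by (intro continuous_intros contq)
  have conth: "continuous_on UNIV (h v)" for v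
    unfolding h_def[abs_def] by (intro continuous_intros contf contD contQ)
  have contZ: "continuous_on UNIV (\<lambda>(t, p). Z t p)"
    unfolding Z_def case_prod_beta by (intro continuous_intros)
  have cZ: "continuous_on UNIV (\<lambda>x. g (Z (fst x) (snd x)))" if "continuous_on UNIV g" for g :: "_ \<Rightarrow> real"
    using continuous_on_compose2[OF that contZ] by (simp add: case_prod_beta)
  have contphi': "continuous_on UNIV (\<lambda>(t, p). \<phi>' t p)"
    unfolding \<phi>'_def U_def case_prod_beta by (intro continuous_intros cZ contf contD)
  have contphi'1: "continuous_on S (\<lambda>t. \<phi>' t p)" for p S
    by (rule continuous_on_compose2[OF contphi', of _ "\<lambda>t. (t, p)", simplified case_prod_conv]) (auto intro!: continuous_intros)
  have Zadd1: "Z t (p + s *\<^sub>R (b, 0)) = Z t p + (s * sin t) *\<^sub>R (b, 0)"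
    and Zadd2: "Z t (p + s *\<^sub>R (0, c)) = Z t p + (s * cos t) *\<^sub>R (0, c)" for s t p b c
    by (auto simp: Z_def algebra_simps)
  have fZ: "((\<lambda>s. f (Z t p + (s * c) *\<^sub>R v) * D (Z t p + (s * c) *\<^sub>R v) v) has_real_derivative c * h v (Z t p)) (at 0)" for t p c v
  proof -
    have 1: "((\<lambda>s. s * c) has_real_derivative c) (at 0)"
      by (auto intro!: derivative_eq_intros)
    have 2: "((\<lambda>s. f (Z t p + s *\<^sub>R v) * D (Z t p + s *\<^sub>R v) v) has_real_derivative h v (Z t p)) (at (0 * c))"
      using C2_exp_second[OF q, of "Z t p" v] by (simp add: f_def h_def)
    show ?thesis
      using DERIV_chain'[OF 1 2] by (simp add: mult.commute)
  qed
  have cZt: "continuous_on UNIV (\<lambda>p. g (Z t p))" if "continuous_on UNIV g" for g :: "_ \<Rightarrow> real" and t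
    by (rule continuous_on_compose2[OF that]) (auto simp: Z_def intro!: continuous_intros)
  have bZt: "exp_bounded (\<lambda>p. g (Z t p))" if "exp_bounded g" for g :: "_ \<Rightarrow> real" and t
    by (rule exp_bounded_compose[OF that normZ])
  \<comment> \<open>The chain rule contributes sin t here and cos t in \<open>ibp2\<close>. Together
    with the opposite factors in \<open>U\<close>, both sums get the same weight sin t cos t, which
    is nonnegative on the interval.\<close>
  have ibp1: "(\<integral>p. (p \<bullet> (b, 0)) * (f (Z t p) * D (Z t p) (b, 0)) \<partial>gauss) = sin t * (\<integral>p. h (b, 0) (Z t p) \<partial>gauss)" for t b
  proof (subst gauss_integration_by_parts[where f' = "\<lambda>p. sin t * h (b, 0) (Z t p)"])
    show "((\<lambda>s. f (Z t (x + s *\<^sub>R (b, 0))) * D (Z t (x + s *\<^sub>R (b, 0))) (b, 0)) has_real_derivative sin t * h (b, 0) (Z t x)) (at 0)" for x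
      unfolding Zadd1 by (rule fZ)
  qed (auto intro!: continuous_intros cZt[OF contf] cZt[OF contD] cZt[OF conth] exp_bounded_mult
      bZt[OF bddf] bZt[OF bddD] bZt[OF bddh] exp_bounded_const)
  have ibp2: "(\<integral>p. (p \<bullet> (0, b)) * (f (Z t p) * D (Z t p) (0, b)) \<partial>gauss) = cos t * (\<integral>p. h (0, b) (Z t p) \<partial>gauss)" for t b
  proof (subst gauss_integration_by_parts[where f' = "\<lambda>p. cos t * h (0, b) (Z t p)"])
    show "((\<lambda>s. f (Z t (x + s *\<^sub>R (0, b))) * D (Z t (x + s *\<^sub>R (0, b))) (0, b)) has_real_derivative cos t * h (0, b) (Z t x)) (at 0)" for x
      unfolding Zadd2 by (rule fZ)
  qed (auto intro!: continuous_intros cZt[OF contf] cZt[OF contD] cZt[OF conth] exp_bounded_mult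
      bZt[OF bddf] bZt[OF bddD] bZt[OF bddh] exp_bounded_const)
  have inth: "integrable gauss (\<lambda>p. h v (Z t p))" for v t
    by (intro integrable_gauss cZt conth bZt bddh)
  have intfZ: "integrable gauss (\<lambda>p. f (Z t p))" for t
    by (intro integrable_gauss cZt contf bZt bddf)
  have intU: "integrable gauss (\<lambda>p. (p \<bullet> v) * (f (Z t p) * D (Z t p) w))" for v w t
    by (intro integrable_gauss continuous_intros cZt[OF contf] cZt[OF contD] exp_bounded_mult
        bZt[OF bddf] bZt[OF bddD] exp_bounded_inner)
  have inner_le: "(\<integral>p. \<phi>' t p \<partial>gauss) \<le> 0" if t: "t \<in> {0..pi/2}" for t
  proof -
    have sc: "0 \<le> sin t" "0 \<le> cos t" using t by (auto intro: sin_ge_zero cos_ge_zero)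
    have "(\<integral>p. U t p \<partial>gauss) = (\<Sum>b\<in>Basis. cos t * (sin t * (\<integral>p. h (b, 0) (Z t p) \<partial>gauss)))
        - (\<Sum>b\<in>Basis. sin t * (cos t * (\<integral>p. h (0, b) (Z t p) \<partial>gauss)))"
      unfolding U_def mult.assoc
      by (subst Bochner_Integration.integral_diff Bochner_Integration.integral_sum;
          auto intro!: intU Bochner_Integration.integrable_sum integrable_mult_right
            simp: ibp1 ibp2 Bochner_Integration.integral_sum intU integrable_mult_right)+
    also have "\<dots> = (sin t * cos t) * (\<integral>p. (\<Sum>b\<in>Basis. h (b, 0) (Z t p)) - (\<Sum>b\<in>Basis. h (0, b) (Z t p)) \<partial>gauss)"
      by (subst Bochner_Integration.integral_diff)
        (auto intro!: inth simp: Bochner_Integration.integral_sum inth sum_distrib_left algebra_simps)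
    also have "\<dots> \<le> (sin t * cos t) * (\<integral>p. 2 * \<kappa> * f (Z t p) \<partial>gauss)"
    proof (intro mult_left_mono integral_mono)
      fix p :: "'a \<times> 'b"
      have "(\<Sum>b\<in>Basis. h (b, 0) (Z t p)) - (\<Sum>b\<in>Basis. h (0, b) (Z t p))
        = f (Z t p) * ((\<Sum>b\<in>Basis. (D (Z t p) (b, 0))\<^sup>2 + Q (Z t p) (b, 0)) - (\<Sum>b\<in>Basis. (D (Z t p) (0, b))\<^sup>2 + Q (Z t p) (0, b)))"
        by (simp add: h_def sum_distrib_left right_diff_distrib)
      also have "\<dots> \<le> f (Z t p) * (2 * \<kappa>)"
        by (intro mult_left_mono le) (auto simp: f_def)
      finally show "(\<Sum>b\<in>Basis. h (b, 0) (Z t p)) - (\<Sum>b\<in>Basis. h (0, b) (Z t p)) \<le> 2 * \<kappa> * f (Z t p)"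
        by (simp add: mult_ac)
    qed (use sc inth intfZ in \<open>auto intro!: Bochner_Integration.integrable_diff\<close>)
    finally have "(\<integral>p. U t p \<partial>gauss) - 2 * \<kappa> * sin t * cos t * (\<integral>p. f (Z t p) \<partial>gauss) \<le> 0"
      by (simp add: mult_ac)
    moreover have "(\<integral>p. \<phi>' t p \<partial>gauss) = exp (- \<kappa> * (sin t)\<^sup>2) * ((\<integral>p. U t p \<partial>gauss) - 2 * \<kappa> * sin t * cos t * (\<integral>p. f (Z t p) \<partial>gauss))"
    proof -
      have "integrable gauss (\<lambda>p. U t p)"
        unfolding U_def mult.assoc by (auto intro!: intU Bochner_Integration.integrable_diff Bochner_Integration.integrable_sum integrable_mult_right)
      then show ?thesis
        unfolding \<phi>'_def
        by (simp add: Bochner_Integration.integral_diff intfZ)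
    qed
    ultimately show ?thesis
      by (simp add: mult_nonneg_nonpos)
  qed
  have deriv: "((\<lambda>t. \<phi> t p) has_real_derivative \<phi>' t p) (at t)" for t p
  proof -
    let ?W = "(cos t *\<^sub>R fst p, (- sin t) *\<^sub>R snd p)"
    have "((\<lambda>t. Z t p) has_derivative (\<lambda>h. h *\<^sub>R ?W)) (at t)"
      unfolding Z_def by (auto intro!: derivative_eq_intros ext simp: algebra_simps)
    from has_derivative_compose[OF this C2_has_derivative[OF q]]
    have "((\<lambda>t. q (Z t p)) has_derivative (\<lambda>h. D (Z t p) (h *\<^sub>R ?W))) (at t)" .
    then have "((\<lambda>t. q (Z t p)) has_real_derivative D (Z t p) ?W) (at t)"
      by (rule has_derivative_imp_has_field_derivative)
        (simp add: linear_cmul[OF C2_linear_D[OF q]] mult.commute del: scaleR_Pair)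
    from DERIV_fun_exp[OF this]
    have "((\<lambda>t. f (Z t p)) has_real_derivative f (Z t p) * D (Z t p) ?W) (at t)"
      by (simp add: f_def)
    moreover have "f (Z t p) * D (Z t p) ?W = U t p"
    proof -
      have "D (Z t p) ?W = D (Z t p) (\<Sum>b\<in>Basis. (?W \<bullet> b) *\<^sub>R b)"
        by (simp add: euclidean_representation)
      also have "\<dots> = (\<Sum>b\<in>Basis. (?W \<bullet> b) * D (Z t p) b)"
        by (simp add: linear_sum[OF C2_linear_D[OF q]] linear_cmul[OF C2_linear_D[OF q]])
      also have "\<dots> = (\<Sum>b\<in>Basis. (cos t * (p \<bullet> (b, 0))) * D (Z t p) (b, 0)) - (\<Sum>b\<in>Basis. (sin t * (p \<bullet> (0, b))) * D (Z t p) (0, b))"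
        by (subst sum_Basis_prod) (simp add: inner_prod_def sum_negf)
      finally show ?thesis
        by (simp add: U_def right_diff_distrib sum_distrib_left mult_ac)
    qed
    ultimately have "((\<lambda>t. f (Z t p)) has_real_derivative U t p) (at t)" by simp
    then show ?thesis
      unfolding \<phi>_def \<phi>'_def
      by (auto intro!: derivative_eq_intros simp: algebra_simps)
  qed
  have int: "integrable (lborel \<Otimes>\<^sub>M gauss) (\<lambda>(t, p). indicator {0..pi/2} t * \<phi>' t p)"
  proof -
    obtain C c where Cc: "0 \<le> C" "0 \<le> c" "\<And>p. norm (f p) \<le> C * exp (c * norm p)"
      using exp_boundedE[OF bddf] by blast
    \<comment> \<open>A majorant independent of t, obtained from \<open>normZ\<close>; it makes the
      derivative integrable over the product of the interval and the Gaussian space.\<close>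
    define G where "G p = exp \<bar>\<kappa>\<bar> * ((C * exp (c * norm p)) * (2 * (\<Sum>b\<in>(Basis :: ('a \<times> 'b) set). norm p * B) + 2 * \<bar>\<kappa>\<bar>))" for p :: "'a \<times> 'b"
    have intG: "integrable gauss G"
      unfolding G_def
      by (intro integrable_gauss continuous_intros exp_bounded_mult exp_bounded_add exp_bounded_sum)
        (auto intro: exp_bounded_const exp_boundedI[of "\<lambda>p. exp (c * norm p)" 1 c] exp_bounded_linear_growth[of norm 0 1])
    have bound: "\<bar>\<phi>' t p\<bar> \<le> G p" for t p
    proof -
      have fle: "0 \<le> f (Z t p)" "f (Z t p) \<le> C * exp (c * norm p)"
      proof -
        have "C * exp (c * norm (Z t p)) \<le> C * exp (c * norm p)"
          using normZ[of t p] Cc by (auto intro!: mult_left_mono)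
        then show "f (Z t p) \<le> C * exp (c * norm p)" using Cc(3)[of "Z t p"] by auto
      qed (simp add: f_def)
      have one: "\<bar>(\<sigma> * (p \<bullet> v)) * (f (Z t p) * D (Z t p) v)\<bar> \<le> f (Z t p) * (norm p * B)"
        if "\<bar>\<sigma>\<bar> \<le> 1" "v \<in> Basis" for \<sigma> v
      proof -
        have "\<bar>\<sigma>\<bar> * \<bar>p \<bullet> v\<bar> \<le> 1 * norm p" using that by (intro mult_mono Basis_le_norm) auto
        moreover have "\<bar>D (Z t p) v\<bar> \<le> B" using B(2)[of "Z t p" v] that by simp
        ultimately have "(\<bar>\<sigma>\<bar> * \<bar>p \<bullet> v\<bar>) * \<bar>D (Z t p) v\<bar> \<le> norm p * B" using B(1) by (intro mult_mono) auto
        from mult_left_mono[OF this fle(1)] show ?thesis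
          using fle(1) by (simp add: abs_mult mult_ac)
      qed
      have "\<bar>U t p\<bar> \<le> (\<Sum>b\<in>(Basis::'a set). f (Z t p) * (norm p * B)) + (\<Sum>b\<in>(Basis::'b set). f (Z t p) * (norm p * B))"
        unfolding U_def
        by (intro order_trans[OF abs_triangle_ineq4] add_mono order_trans[OF sum_abs] sum_mono one)
          (auto simp: Basis_prod_def abs_cos_le_one abs_sin_le_one)
      also have "\<dots> = f (Z t p) * (\<Sum>b\<in>(Basis :: ('a \<times> 'b) set). norm p * B)"
        by (simp add: algebra_simps)
      also have "\<dots> \<le> f (Z t p) * (2 * (\<Sum>b\<in>(Basis :: ('a \<times> 'b) set). norm p * B))"
        using fle B by (intro mult_left_mono) auto
      finally have 1: "\<bar>U t p\<bar> \<le> f (Z t p) * (2 * (\<Sum>b\<in>(Basis :: ('a \<times> 'b) set). norm p * B))" .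
      have "\<bar>sin t\<bar> * \<bar>cos t\<bar> \<le> 1 * 1" by (intro mult_mono) auto
      then have "\<bar>\<kappa>\<bar> * (\<bar>sin t\<bar> * \<bar>cos t\<bar>) \<le> \<bar>\<kappa>\<bar> * 1" by (intro mult_left_mono) auto
      from mult_left_mono[OF this fle(1)]
      have 2: "\<bar>2 * \<kappa> * sin t * cos t * f (Z t p)\<bar> \<le> f (Z t p) * (2 * \<bar>\<kappa>\<bar>)"
        using fle(1) by (simp add: abs_mult mult_ac)
      have "- \<kappa> * (sin t)\<^sup>2 \<le> \<bar>\<kappa>\<bar> * (sin t)\<^sup>2"
        by (intro mult_right_mono) auto
      also have "\<dots> \<le> \<bar>\<kappa>\<bar> * 1"
        using abs_square_le_1[of "sin t"] by (intro mult_left_mono) auto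
      finally have 3: "exp (- \<kappa> * (sin t)\<^sup>2) \<le> exp \<bar>\<kappa>\<bar>" by simp
      have "\<bar>U t p - 2 * \<kappa> * sin t * cos t * f (Z t p)\<bar> \<le> f (Z t p) * (2 * (\<Sum>b\<in>(Basis :: ('a \<times> 'b) set). norm p * B) + 2 * \<bar>\<kappa>\<bar>)"
        using 1 2 unfolding distrib_left by linarith
      also have "\<dots> \<le> (C * exp (c * norm p)) * (2 * (\<Sum>b\<in>(Basis :: ('a \<times> 'b) set). norm p * B) + 2 * \<bar>\<kappa>\<bar>)"
        using fle B by (intro mult_right_mono) auto
      finally show ?thesis
        unfolding \<phi>'_def G_def abs_mult using 3 by (intro mult_mono) auto
    qed
    have Gi: "integrable (lborel \<Otimes>\<^sub>M gauss) (\<lambda>(t::real, p). indicator {0..pi/2} t * G p)"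
      using intG
      by (intro lborel_gauss.Fubini_integrable) (auto simp: abs_mult intro!: integrable_mult_left)
    show ?thesis
    proof (rule Bochner_Integration.integrable_bound[OF Gi])
      have "(\<lambda>(t, p). \<phi>' t p) \<in> borel_measurable (borel \<Otimes>\<^sub>M borel)"
        unfolding borel_prod by (intro borel_measurable_continuous_onI contphi')
      then have [measurable]: "(\<lambda>x. \<phi>' (fst x) (snd x)) \<in> borel_measurable (lborel \<Otimes>\<^sub>M gauss)"
        by (simp add: case_prod_beta measurable_cong_sets[OF sets_pair_measure_cong[OF sets_lborel sets_gauss] refl])
      show "(\<lambda>(t, p). indicator {0..pi/2} t * \<phi>' t p) \<in> borel_measurable (lborel \<Otimes>\<^sub>M gauss)"
        unfolding case_prod_beta by measurable
      show "AE x in lborel \<Otimes>\<^sub>M gauss. norm (case x of (t, p) \<Rightarrow> indicator {0..pi/2} t * \<phi>' t p)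
          \<le> norm (case x of (t, p) \<Rightarrow> indicator {0..pi/2} t * G p)"
        by (intro AE_I2) (auto simp: abs_mult split: split_indicator intro: order_trans[OF bound abs_ge_self])
    qed
  qed
  have "(\<integral>p. \<phi> (pi/2) p - \<phi> 0 p \<partial>gauss) = (\<integral>t. indicator {0..pi/2} t * (\<integral>p. \<phi>' t p \<partial>gauss) \<partial>lborel)"
    by (rule integral_diff_eq_integral_deriv[OF gauss.sigma_finite_measure_axioms _ deriv contphi'1 int]) auto
  also have "\<dots> \<le> (\<integral>t. 0 \<partial>(lborel :: real measure))"
    by (rule integral_mono_AE') (auto simp: inner_le split: split_indicator intro!: AE_I2)
  finally have "(\<integral>p. \<phi> (pi/2) p - \<phi> 0 p \<partial>gauss) \<le> 0" by simp
  moreover have "(\<integral>p. \<phi> (pi/2) p - \<phi> 0 p \<partial>gauss) = (\<integral>p. \<phi> (pi/2) p \<partial>gauss) - (\<integral>p. \<phi> 0 p \<partial>gauss)"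
    by (rule Bochner_Integration.integral_diff) (auto simp: \<phi>_def intro!: intfZ)
  moreover have "continuous_on UNIV (\<lambda>x. f (x, 0))" "continuous_on UNIV (\<lambda>y. f (0, y))"
    by (auto intro!: continuous_on_compose2[OF contf] continuous_intros)
  then have [measurable]: "(\<lambda>x. f (x, 0)) \<in> borel_measurable borel" "(\<lambda>y. f (0, y)) \<in> borel_measurable borel"
    by (auto intro: borel_measurable_continuous_onI)
  have "(\<integral>p. \<phi> (pi/2) p \<partial>gauss) = exp (- \<kappa>) * (\<integral>x. f (x, 0) \<partial>gauss)"
    unfolding \<phi>_def Z_def by (simp add: integral_gauss_fst[of "\<lambda>x. f (x, 0)"])
  moreover have "(\<integral>p. \<phi> 0 p \<partial>gauss) = (\<integral>y. f (0, y) \<partial>gauss)"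
    unfolding \<phi>_def Z_def by (simp add: integral_gauss_snd[of "\<lambda>y. f (0, y)"])
  ultimately have "exp (- \<kappa>) * (\<integral>x. f (x, 0) \<partial>gauss) \<le> (\<integral>y. f (0, y) \<partial>gauss)"
    by linarith
  then have "exp \<kappa> * (exp (- \<kappa>) * (\<integral>x. f (x, 0) \<partial>gauss)) \<le> exp \<kappa> * (\<integral>y. f (0, y) \<partial>gauss)"
    by (intro mult_left_mono) auto
  then show ?thesis
    by (simp add: f_def mult.assoc[symmetric] exp_minus)
qed

section \<open>Soft maximum and Gaussian concentration\<close>

text \<open>A smooth substitute for the maximum over K, too large by at most ln (card K) / \<alpha>.
  Its second derivative grows with \<alpha>, but with a sign that the comparison can
  exploit.\<close>

definition softmax :: "real \<Rightarrow> 'i set \<Rightarrow> ('i \<Rightarrow> real) \<Rightarrow> real" where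
  "softmax \<alpha> K f = ln (\<Sum>z\<in>K. exp (\<alpha> * f z)) / \<alpha>"

context
  fixes \<alpha> :: real and K :: "'i set"
  assumes \<alpha>: "0 < \<alpha>" and K: "finite K" "K \<noteq> {}"
begin

lemma sum_exp_pos: "0 < (\<Sum>z\<in>K. exp (\<alpha> * f z))"
  by (rule sum_pos) (use K in auto)

lemma softmax_ge: "z \<in> K \<Longrightarrow> f z \<le> softmax \<alpha> K f"
proof -
  assume z: "z \<in> K"
  have "exp (\<alpha> * f z) \<le> (\<Sum>z\<in>K. exp (\<alpha> * f z))"
    by (rule member_le_sum) (use z K in auto)
  then have "\<alpha> * f z \<le> ln (\<Sum>z\<in>K. exp (\<alpha> * f z))"
    by (subst ln_ge_iff) (auto simp: sum_exp_pos)
  then show ?thesis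
    using \<alpha> by (simp add: softmax_def pos_le_divide_eq mult.commute)
qed

lemma softmax_le:
  assumes "\<And>z. z \<in> K \<Longrightarrow> f z \<le> c"
  shows "softmax \<alpha> K f \<le> c + ln (real (card K)) / \<alpha>"
proof -
  have card: "0 < real (card K)" using K by (simp add: card_gt_0_iff)
  have "(\<Sum>z\<in>K. exp (\<alpha> * f z)) \<le> (\<Sum>z\<in>K. exp (\<alpha> * c))"
    using assms \<alpha> by (intro sum_mono) auto
  then have "ln (\<Sum>z\<in>K. exp (\<alpha> * f z)) \<le> ln (real (card K) * exp (\<alpha> * c))"
    using card by (subst ln_le_cancel_iff) (auto simp: sum_exp_pos)
  also have "\<dots> = ln (real (card K)) + \<alpha> * c"
    using card by (simp add: ln_mult)
  finally show ?thesis
    using \<alpha> by (simp add: softmax_def field_simps)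
qed

lemma softmax_add: "softmax \<alpha> K (\<lambda>z. f z + c) = softmax \<alpha> K f + c"
proof -
  have "(\<Sum>z\<in>K. exp (\<alpha> * (f z + c))) = (\<Sum>z\<in>K. exp (\<alpha> * f z)) * exp (\<alpha> * c)"
    by (simp add: distrib_left exp_add sum_distrib_right)
  then show ?thesis
    using \<alpha> sum_exp_pos[of f] by (simp add: softmax_def ln_mult field_simps)
qed

text \<open>The Gibbs weights: a probability vector on K, formed by the partial derivatives of
  \<open>softmax\<close> in the values \<open>f z\<close>.\<close>

definition softmax_weight :: "('i \<Rightarrow> real) \<Rightarrow> 'i \<Rightarrow> real" where
  "softmax_weight f z = exp (\<alpha> * f z) / (\<Sum>z\<in>K. exp (\<alpha> * f z))"

lemma softmax_weight_nonneg: "0 \<le> softmax_weight f z"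
  using sum_exp_pos[of f] by (simp add: softmax_weight_def)

lemma softmax_weight_sum: "(\<Sum>z\<in>K. softmax_weight f z) = 1"
  using sum_exp_pos[of f] by (simp add: softmax_weight_def sum_divide_distrib[symmetric])

lemma softmax_average_le:
  assumes "\<And>z. z \<in> K \<Longrightarrow> \<bar>g z\<bar> \<le> c"
  shows "\<bar>\<Sum>z\<in>K. softmax_weight f z * g z\<bar> \<le> c"
proof -
  have "\<bar>\<Sum>z\<in>K. softmax_weight f z * g z\<bar> \<le> (\<Sum>z\<in>K. softmax_weight f z * c)"
    by (rule order_trans[OF sum_abs sum_mono])
      (auto simp: abs_mult softmax_weight_nonneg intro!: mult_left_mono assms)
  also have "\<dots> = c"
    by (simp add: sum_distrib_right[symmetric] softmax_weight_sum)
  finally show ?thesis .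
qed

text \<open>Under the Gibbs weights the first derivative is the mean of D, and the second is the
  mean of Q plus \<alpha> times the variance of D. The bounds survive because a mean does not exceed
  the largest value.\<close>

lemma C2_softmax:
  fixes a :: "'i \<Rightarrow> 'a::euclidean_space \<Rightarrow> real"
  assumes a: "\<And>z. z \<in> K \<Longrightarrow> bounded_C2 (a z) (D z) (Q z)"
  defines "W p z \<equiv> softmax_weight (\<lambda>z. a z p) z"
  shows "bounded_C2 (\<lambda>p. softmax \<alpha> K (\<lambda>z. a z p)) (\<lambda>p v. \<Sum>z\<in>K. W p z * D z p v)
    (\<lambda>p v. (\<Sum>z\<in>K. W p z * (Q z p v + \<alpha> * (D z p v)\<^sup>2)) - \<alpha> * (\<Sum>z\<in>K. W p z * D z p v)\<^sup>2)"
proof -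
  define E where "E z p = exp (\<alpha> * a z p)" for z p
  define S where "S p = (\<Sum>z\<in>K. E z p)" for p
  have S: "0 < S p" for p unfolding S_def E_def by (rule sum_exp_pos)
  have W: "W p z = E z p / S p" for p z by (simp add: W_def softmax_weight_def E_def S_def)
  have W_le: "\<bar>\<Sum>z\<in>K. W p z * g z\<bar> \<le> c" if "\<And>z. z \<in> K \<Longrightarrow> \<bar>g z\<bar> \<le> c" for p g c
    unfolding W_def using that by (rule softmax_average_le)
  have contE: "continuous_on UNIV (E z)" if "z \<in> K" for z
    unfolding E_def[abs_def] by (intro continuous_intros C2_continuous[OF a[OF that]])
  have contS: "continuous_on UNIV S"
    unfolding S_def[abs_def] by (intro continuous_intros contE)
  have contW: "continuous_on UNIV (\<lambda>p. W p z)" if "z \<in> K" for z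
    unfolding W using S by (intro continuous_intros contE contS that) (auto simp: less_imp_neq[symmetric])
  have derivE: "(E z has_derivative (\<lambda>v. \<alpha> * (E z p * D z p v))) (at p)" if "z \<in> K" for z p
    unfolding E_def[abs_def]
    by (rule has_derivative_eq_rhs, rule has_derivative_exp, rule has_derivative_mult_right,
        rule C2_has_derivative[OF a[OF that]]) (auto simp: mult_ac)
  have derivS: "(S has_derivative (\<lambda>v. \<Sum>z\<in>K. \<alpha> * (E z p * D z p v))) (at p)" for p
    unfolding S_def[abs_def] by (intro has_derivative_sum derivE)
  have 1: "((\<lambda>p. softmax \<alpha> K (\<lambda>z. a z p)) has_derivative (\<lambda>v. \<Sum>z\<in>K. W p z * D z p v)) (at p)" for p
  proof -
    have "((\<lambda>p. inverse \<alpha> * ln (S p)) has_derivative (\<lambda>v. (1 / S p * (\<Sum>z\<in>K. \<alpha> * (E z p * D z p v))) / \<alpha>)) (at p)"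
      by (rule has_derivative_eq_rhs, rule has_derivative_mult_right, rule has_derivative_ln, rule S, rule derivS)
        (auto simp: divide_inverse mult_ac)
    moreover have "(1 / S p * (\<Sum>z\<in>K. \<alpha> * (E z p * D z p v))) / \<alpha> = (\<Sum>z\<in>K. W p z * D z p v)" for v
      using \<alpha> by (simp add: W sum_distrib_left[symmetric] sum_divide_distrib)
    ultimately show ?thesis by (simp add: softmax_def S_def E_def divide_inverse mult.commute)
  qed
  have 2: "((\<lambda>t. \<Sum>z\<in>K. W (p + t *\<^sub>R v) z * D z (p + t *\<^sub>R v) v) has_real_derivative
      (\<Sum>z\<in>K. W p z * (Q z p v + \<alpha> * (D z p v)\<^sup>2)) - \<alpha> * (\<Sum>z\<in>K. W p z * D z p v)\<^sup>2) (at 0)" for p v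
  proof -
    have "((\<lambda>t. E z (p + t *\<^sub>R v) * D z (p + t *\<^sub>R v) v) has_real_derivative
        E z p * (Q z p v + \<alpha> * (D z p v)\<^sup>2)) (at 0)" if "z \<in> K" for z
    proof -
      have "((\<lambda>t. exp (\<alpha> * a z (p + t *\<^sub>R v)) * (\<alpha> * D z (p + t *\<^sub>R v) v) / \<alpha>) has_real_derivative
          exp (\<alpha> * a z p) * ((\<alpha> * D z p v)\<^sup>2 + \<alpha> * Q z p v) / \<alpha>) (at 0)"
        by (intro DERIV_cdivide C2_exp_second C2_cmult a that)
      moreover have "exp (\<alpha> * a z p) * ((\<alpha> * D z p v)\<^sup>2 + \<alpha> * Q z p v) / \<alpha> = E z p * (Q z p v + \<alpha> * (D z p v)\<^sup>2)"
        using \<alpha> by (simp add: E_def field_simps power2_eq_square)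
      ultimately show ?thesis
        using \<alpha> by (simp add: E_def)
    qed
    then have n: "((\<lambda>t. \<Sum>z\<in>K. E z (p + t *\<^sub>R v) * D z (p + t *\<^sub>R v) v) has_real_derivative
        (\<Sum>z\<in>K. E z p * (Q z p v + \<alpha> * (D z p v)\<^sup>2))) (at 0)"
      by (intro DERIV_sum)
    have pv: "((\<lambda>t. p + t *\<^sub>R v) has_derivative (\<lambda>h. h *\<^sub>R v)) (at 0)"
      by (auto intro!: derivative_eq_intros)
    have "((\<lambda>t. S (p + t *\<^sub>R v)) has_derivative (\<lambda>h. \<Sum>z\<in>K. \<alpha> * (E z p * D z p (h *\<^sub>R v)))) (at 0)"
      using has_derivative_compose[OF pv, of S] derivS[of p] by simp
    then have d: "((\<lambda>t. S (p + t *\<^sub>R v)) has_real_derivative (\<Sum>z\<in>K. \<alpha> * (E z p * D z p v))) (at 0)"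
      by (rule has_derivative_imp_has_field_derivative)
        (auto simp: linear_cmul[OF C2_linear_D[OF a]] sum_distrib_left mult_ac intro!: sum.cong)
    have "((\<lambda>t. (\<Sum>z\<in>K. E z (p + t *\<^sub>R v) * D z (p + t *\<^sub>R v) v) / S (p + t *\<^sub>R v)) has_real_derivative
       ((\<Sum>z\<in>K. E z p * (Q z p v + \<alpha> * (D z p v)\<^sup>2)) * S p
        - (\<Sum>z\<in>K. E z p * D z p v) * (\<Sum>z\<in>K. \<alpha> * (E z p * D z p v))) / (S p * S p)) (at 0)"
      using DERIV_divide[OF n d] S[of p] by (simp add: less_imp_neq[symmetric])
    moreover have "((\<Sum>z\<in>K. E z p * (Q z p v + \<alpha> * (D z p v)\<^sup>2)) * S p
        - (\<Sum>z\<in>K. E z p * D z p v) * (\<Sum>z\<in>K. \<alpha> * (E z p * D z p v))) / (S p * S p)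
       = (\<Sum>z\<in>K. E z p * (Q z p v + \<alpha> * (D z p v)\<^sup>2)) / S p - \<alpha> * ((\<Sum>z\<in>K. E z p * D z p v) / S p)\<^sup>2"
      using S[of p] by (simp add: sum_distrib_left[symmetric] field_simps power2_eq_square)
    ultimately show ?thesis
      by (simp add: W sum_divide_distrib)
  qed
  obtain B where B: "\<And>z. z \<in> K \<Longrightarrow> 0 \<le> B z" "\<And>z p v. z \<in> K \<Longrightarrow> \<bar>D z p v\<bar> \<le> B z * norm v"
  proof -
    have "\<exists>B. \<forall>z\<in>K. 0 \<le> B z \<and> (\<forall>p v. \<bar>D z p v\<bar> \<le> B z * norm v)"
      by (intro bchoice ballI) (meson C2_bound_D a)
    then show ?thesis using that by blast
  qed
  define C where "C = (\<Sum>z\<in>K. B z)"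
  have "0 \<le> C" unfolding C_def using B by (auto intro: sum_nonneg)
  have C: "\<bar>D z p v\<bar> \<le> C * norm v" if "z \<in> K" for z p v
  proof -
    have "B z \<le> C" unfolding C_def using that K B by (intro member_le_sum) auto
    then show ?thesis using B(2)[OF that, of p v] by (meson mult_right_mono norm_ge_zero order_trans)
  qed
  have 3: "\<bar>\<Sum>z\<in>K. W p z * D z p v\<bar> \<le> C * norm v" for p v
    by (intro W_le C)
  obtain B' where B': "\<And>z. z \<in> K \<Longrightarrow> 0 \<le> B' z" "\<And>z p v. z \<in> K \<Longrightarrow> \<bar>Q z p v\<bar> \<le> B' z * (norm v)\<^sup>2"
  proof -
    have "\<exists>B. \<forall>z\<in>K. 0 \<le> B z \<and> (\<forall>p v. \<bar>Q z p v\<bar> \<le> B z * (norm v)\<^sup>2)"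
      by (intro bchoice ballI) (meson C2_bound_Q a)
    then show ?thesis using that by blast
  qed
  define C' where "C' = (\<Sum>z\<in>K. B' z)"
  have C': "\<bar>Q z p v\<bar> \<le> C' * (norm v)\<^sup>2" if "z \<in> K" for z p v
  proof -
    have "B' z \<le> C'" unfolding C'_def using that K B' by (intro member_le_sum) auto
    then show ?thesis using B'(2)[OF that, of p v] by (meson mult_right_mono zero_le_power2 order_trans)
  qed
  have sq: "x\<^sup>2 \<le> C\<^sup>2 * (norm v)\<^sup>2" if "\<bar>x\<bar> \<le> C * norm v" for x and v :: 'a
    using power_mono[OF that, of 2] by (simp add: power_mult_distrib)
  have 4: "\<bar>(\<Sum>z\<in>K. W p z * (Q z p v + \<alpha> * (D z p v)\<^sup>2)) - \<alpha> * (\<Sum>z\<in>K. W p z * D z p v)\<^sup>2\<bar>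
     \<le> (C' + 2 * \<alpha> * C\<^sup>2) * (norm v)\<^sup>2" for p v
  proof -
    have "\<bar>\<Sum>z\<in>K. W p z * (Q z p v + \<alpha> * (D z p v)\<^sup>2)\<bar> \<le> C' * (norm v)\<^sup>2 + \<alpha> * (C\<^sup>2 * (norm v)\<^sup>2)"
    proof (rule W_le)
      fix z assume z: "z \<in> K"
      have "\<bar>\<alpha> * (D z p v)\<^sup>2\<bar> \<le> \<alpha> * (C\<^sup>2 * (norm v)\<^sup>2)"
        using \<alpha> sq[OF C[OF z]] by (auto simp: abs_mult)
      then show "\<bar>Q z p v + \<alpha> * (D z p v)\<^sup>2\<bar> \<le> C' * (norm v)\<^sup>2 + \<alpha> * (C\<^sup>2 * (norm v)\<^sup>2)"
        using C'[OF z, of p v] by linarith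
    qed
    moreover have "\<bar>\<alpha> * (\<Sum>z\<in>K. W p z * D z p v)\<^sup>2\<bar> \<le> \<alpha> * (C\<^sup>2 * (norm v)\<^sup>2)"
      using \<alpha> sq[OF 3, of p v] by (auto simp: abs_mult)
    moreover have "C' * (norm v)\<^sup>2 + \<alpha> * (C\<^sup>2 * (norm v)\<^sup>2) + \<alpha> * (C\<^sup>2 * (norm v)\<^sup>2) = (C' + 2 * \<alpha> * C\<^sup>2) * (norm v)\<^sup>2"
      by (simp add: algebra_simps)
    ultimately show ?thesis by linarith
  qed
  show ?thesis
    unfolding bounded_C2_def
    using 1 2 3 4
    by (auto intro!: continuous_intros contW C2_cont_D[OF a] C2_cont_Q[OF a])
qed

end

text \<open>Each functional is the inner product with a vector. Testing it on that very vector shows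
  that its length is at most 1, and Cauchy-Schwarz finishes.\<close>

lemma sum_linear_functionals_le_1:
  fixes f g :: "'a::euclidean_space \<Rightarrow> real"
  assumes "linear f" "linear g" and f: "\<And>v. \<bar>f v\<bar> \<le> norm v" and g: "\<And>v. \<bar>g v\<bar> \<le> norm v"
  shows "(\<Sum>b\<in>Basis. f b * g b) \<le> 1"
proof -
  define vec where "vec f = (\<Sum>b\<in>Basis. f b *\<^sub>R b)" for f :: "'a \<Rightarrow> real"
  have inner: "vec f \<bullet> b = f b" if "b \<in> Basis" for f b
    using that by (simp add: vec_def inner_sum_left inner_Basis if_distrib cong: if_cong)
  have norm: "norm (vec f) \<le> 1" if "linear f" "\<And>v. \<bar>f v\<bar> \<le> norm v" for f
  proof -
    have "f (vec f) = (\<Sum>b\<in>Basis. f b * f b)"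
      using that(1) by (simp add: vec_def linear_sum linear_cmul)
    also have "\<dots> = (norm (vec f))\<^sup>2"
      by (simp add: power2_norm_eq_inner euclidean_inner[of "vec f" "vec f"] inner)
    finally have "(norm (vec f))\<^sup>2 \<le> norm (vec f)" using that(2)[of "vec f"] by simp
    then show ?thesis
      by (cases "norm (vec f) = 0") (auto simp: power2_eq_square)
  qed
  have "(\<Sum>b\<in>Basis. f b * g b) = vec f \<bullet> vec g"
    by (simp add: euclidean_inner[of "vec f" "vec g"] inner)
  also have "\<dots> \<le> norm (vec f) * norm (vec g)" by (rule norm_cauchy_schwarz)
  also have "\<dots> \<le> 1 * 1" using norm assms by (intro mult_mono) auto
  finally show ?thesis by simp
qed

lemma measure_gauss_UNIV [simp]: "measure gauss UNIV = 1"
  using gauss.prob_space by simp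

lemma integral_gauss_mult:
  fixes f :: "'a::euclidean_space \<Rightarrow> real" and g :: "'b::euclidean_space \<Rightarrow> real"
  assumes "continuous_on UNIV f" "exp_bounded f" "continuous_on UNIV g" "exp_bounded g"
  shows "(\<integral>p. f (fst p) * g (snd p) \<partial>gauss) = (\<integral>x. f x \<partial>gauss) * (\<integral>y. g y \<partial>gauss)"
proof -
  have b: "exp_bounded (\<lambda>p::'a \<times> 'b. f (fst p))"
    by (rule exp_bounded_compose[OF assms(2), where B = 1]) (metis mult_1 norm_fst_le prod.collapse)
  have b': "exp_bounded (\<lambda>p::'a \<times> 'b. g (snd p))"
    by (rule exp_bounded_compose[OF assms(4), where B = 1]) (metis mult_1 norm_snd_le prod.collapse)
  have c: "continuous_on UNIV (\<lambda>p::'a \<times> 'b. f (fst p))" "continuous_on UNIV (\<lambda>p::'a \<times> 'b. g (snd p))"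
    by (auto intro!: continuous_on_compose2[OF assms(1)] continuous_on_compose2[OF assms(3)] continuous_intros)
  have "integrable gauss (\<lambda>p::'a \<times> 'b. f (fst p) * g (snd p))"
    by (intro integrable_gauss exp_bounded_mult continuous_on_mult b b' c)
  then have "(\<integral>p. f (fst p) * g (snd p) \<partial>gauss) = (\<integral>x. \<integral>y. f x * g y \<partial>gauss \<partial>gauss)"
    unfolding gauss_pair_measure
    by (subst gauss_pair.integral_fst'[symmetric]) auto
  also have "\<dots> = (\<integral>x. f x \<partial>gauss) * (\<integral>y. g y \<partial>gauss)"
    by simp
  finally show ?thesis .
qed

text \<open>Interpolating between an independent and an identical pair of Gaussians; dividing by \<open>E exp (- \<mu> * F)\<close>,
  which is at least \<open>exp (- \<mu> * E F)\<close> by convexity, gives a recursion in \<open>l\<close> for the Laplace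
  transform of \<open>F\<close>.\<close>

lemma laplace_decoupling:
  fixes F :: "'a::euclidean_space \<Rightarrow> real"
  assumes F: "bounded_C2 F D Q" and D: "\<And>p v. \<bar>D p v\<bar> \<le> norm v" and "0 \<le> l" "0 \<le> \<mu>"
  shows "(\<integral>x. exp (l * F x) \<partial>gauss) * (\<integral>x. exp (- \<mu> * F x) \<partial>gauss)
    \<le> exp (l * \<mu>) * (\<integral>x. exp ((l - \<mu>) * F x) \<partial>gauss)"
proof -
  \<comment> \<open>At ((x, x'), 0) the two arguments are independent, at (0, y) they
    coincide.\<close>
  define L1 L2 where "L1 p = fst (fst p) + snd p" and "L2 p = snd (fst p) + snd p" for p :: "('a \<times> 'a) \<times> 'a"
  have lin: "linear L1" "linear L2"
    unfolding L1_def L2_def by (intro bounded_linear.linear bounded_linear_intros)+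
  define q where "q p = l * F (L1 p) + (- \<mu>) * F (L2 p)" for p
  have C2: "bounded_C2 q (\<lambda>p v. l * D (L1 p) (L1 v) + (- \<mu>) * D (L2 p) (L2 v))
     (\<lambda>p v. l * Q (L1 p) (L1 v) + (- \<mu>) * Q (L2 p) (L2 v))"
    unfolding q_def
    by (rule C2_add[OF C2_cmult[OF C2_compose_linear[OF F lin(1)]] C2_cmult[OF C2_compose_linear[OF F lin(2)]]])
  have D0: "D p 0 = 0" and Q0: "Q p 0 = 0" for p
    using linear_0[OF C2_linear_D[OF F]] C2_second_scale[OF F, of p 0 0] by auto
  have "(\<integral>x. exp (q (x, 0)) \<partial>gauss) \<le> exp (l * \<mu>) * (\<integral>y. exp (q (0, y)) \<partial>gauss)"
  proof (rule gauss_exp_interpolation[OF C2])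
    fix p
    have "(\<Sum>b\<in>Basis. D (L1 p) b * D (L2 p) b) \<le> 1"
      by (intro sum_linear_functionals_le_1 C2_linear_D[OF F] D)
    then have *: "2 * (l * \<mu>) * (\<Sum>b\<in>Basis. D (L1 p) b * D (L2 p) b) \<le> 2 * (l * \<mu>) * 1"
      using assms by (intro mult_left_mono) auto
    \<comment> \<open>Each argument alone has the same law at both ends, so squares and second
      derivatives cancel and only the cross term survives.\<close>
    have "(\<Sum>b\<in>Basis. (l * D (L1 p) (L1 (b, 0)) + - \<mu> * D (L2 p) (L2 (b, 0)))\<^sup>2 +
             (l * Q (L1 p) (L1 (b, 0)) + - \<mu> * Q (L2 p) (L2 (b, 0)))) -
         (\<Sum>b\<in>Basis. (l * D (L1 p) (L1 (0, b)) + - \<mu> * D (L2 p) (L2 (0, b)))\<^sup>2 +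
             (l * Q (L1 p) (L1 (0, b)) + - \<mu> * Q (L2 p) (L2 (0, b))))
      = 2 * (l * \<mu>) * (\<Sum>b\<in>Basis. D (L1 p) b * D (L2 p) b)"
      by (subst sum_Basis_prod)
        (simp add: L1_def L2_def D0 Q0 sum.distrib sum_subtractf sum_distrib_left power2_eq_square algebra_simps)
    then show "(\<Sum>b\<in>Basis. (l * D (L1 p) (L1 (b, 0)) + - \<mu> * D (L2 p) (L2 (b, 0)))\<^sup>2 +
             (l * Q (L1 p) (L1 (b, 0)) + - \<mu> * Q (L2 p) (L2 (b, 0)))) -
         (\<Sum>b\<in>Basis. (l * D (L1 p) (L1 (0, b)) + - \<mu> * D (L2 p) (L2 (0, b)))\<^sup>2 +
             (l * Q (L1 p) (L1 (0, b)) + - \<mu> * Q (L2 p) (L2 (0, b)))) \<le> 2 * (l * \<mu>)"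
      using * by simp
  qed
  moreover have "(\<integral>x. exp (q (x, 0)) \<partial>gauss) = (\<integral>x. exp (l * F x) \<partial>gauss) * (\<integral>x. exp (- \<mu> * F x) \<partial>gauss)"
    by (subst integral_gauss_mult[symmetric])
      (auto simp: q_def L1_def L2_def mult_exp_exp intro!: C2_exp_bounded_exp[OF F] C2_exp_bounded_exp[OF F, of "- \<mu>", simplified]
        continuous_intros C2_continuous[OF F])
  moreover have "q (0, y) = (l - \<mu>) * F y" for y
    by (simp add: q_def L1_def L2_def algebra_simps)
  ultimately show ?thesis by simp
qed

text \<open>Jensen's inequality, by integrating the tangent of exp at the mean.\<close>

lemma exp_expectation_le:
  fixes F :: "'a::euclidean_space \<Rightarrow> real"
  assumes F: "integrable gauss F" "integrable gauss (\<lambda>x. exp (F x))"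
  shows "exp (\<integral>x. F x \<partial>gauss) \<le> (\<integral>x. exp (F x) \<partial>gauss)"
proof -
  define c where "c = (\<integral>x. F x \<partial>gauss)"
  have "exp c = (\<integral>x. exp c * (1 + (F x - c)) \<partial>gauss)"
    using F by (simp add: c_def Bochner_Integration.integral_diff)
  also have "\<dots> \<le> (\<integral>x. exp (F x) \<partial>gauss)"
  proof (rule integral_mono)
    show "exp c * (1 + (F x - c)) \<le> exp (F x)" for x
    proof -
      have "exp c * (1 + (F x - c)) \<le> exp c * exp (F x - c)"
        by (intro mult_left_mono exp_ge_add_one_self) auto
      also have "\<dots> = exp (F x)" by (simp add: mult_exp_exp)
      finally show ?thesis .
    qed
  qed (use F in auto)
  finally show ?thesis by (simp add: c_def)
qed

text \<open>The parameter l is reached in k + 1 decoupling steps of size \<mu> = l / (k + 1). Step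
  number j costs exp (j \<mu>^2), and the exponents add up to l^2 / 2 * (1 + 1 / (k + 1)), which
  tends to the sharp value l^2 / 2.\<close>

theorem gauss_concentration:
  fixes F :: "'a::euclidean_space \<Rightarrow> real"
  assumes F: "bounded_C2 F D Q" and D: "\<And>p v. \<bar>D p v\<bar> \<le> norm v" and l: "0 \<le> l"
  shows "(\<integral>x. exp (l * F x) \<partial>gauss) \<le> exp (l\<^sup>2 / 2 + l * (\<integral>x. F x \<partial>gauss))"
proof -
  define m where "m = (\<integral>x. F x \<partial>gauss)"
  define \<phi> where "\<phi> s = (\<integral>x. exp (s * F x) \<partial>gauss)" for s
  have jensen: "exp (s * m) \<le> \<phi> s" for s
    using exp_expectation_le[of "\<lambda>x. s * F x"] C2_integrable[OF F] C2_integrable_exp[OF F, of s]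
    by (simp add: m_def \<phi>_def)
  have bound: "\<phi> (real j * \<mu>) \<le> exp (\<mu>\<^sup>2 * (real j * (real j + 1) / 2) + real j * \<mu> * m)" if "0 \<le> \<mu>" for j \<mu>
  proof (induction j)
    case 0
    then show ?case by (simp add: \<phi>_def)
  next
    case (Suc j)
    have "\<phi> (real (Suc j) * \<mu>) * exp (- \<mu> * m) \<le> \<phi> (real (Suc j) * \<mu>) * \<phi> (- \<mu>)"
      by (intro mult_left_mono jensen) (auto simp: \<phi>_def)
    also have "\<dots> \<le> exp (real (Suc j) * \<mu> * \<mu>) * \<phi> (real (Suc j) * \<mu> - \<mu>)"
      unfolding \<phi>_def using that by (intro laplace_decoupling[OF F D]) auto
    also have "real (Suc j) * \<mu> - \<mu> = real j * \<mu>" by (simp add: algebra_simps)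
    also have "exp (real (Suc j) * \<mu> * \<mu>) * \<phi> (real j * \<mu>)
       \<le> exp (real (Suc j) * \<mu> * \<mu>) * exp (\<mu>\<^sup>2 * (real j * (real j + 1) / 2) + real j * \<mu> * m)"
      by (intro mult_left_mono Suc) auto
    finally have "\<phi> (real (Suc j) * \<mu>) * exp (- \<mu> * m) * exp (\<mu> * m)
      \<le> exp (real (Suc j) * \<mu> * \<mu>) * exp (\<mu>\<^sup>2 * (real j * (real j + 1) / 2) + real j * \<mu> * m) * exp (\<mu> * m)"
      by (intro mult_right_mono) auto
    moreover have "\<phi> (real (Suc j) * \<mu>) * exp (- \<mu> * m) * exp (\<mu> * m) = \<phi> (real (Suc j) * \<mu>)"
      by (simp add: mult.assoc mult_exp_exp)
    moreover have "exp (real (Suc j) * \<mu> * \<mu>) * exp (\<mu>\<^sup>2 * (real j * (real j + 1) / 2) + real j * \<mu> * m) * exp (\<mu> * m)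
      = exp (\<mu>\<^sup>2 * (real (Suc j) * (real (Suc j) + 1) / 2) + real (Suc j) * \<mu> * m)"
      unfolding mult_exp_exp by (rule arg_cong[where f = exp]) (simp add: field_simps power2_eq_square)
    ultimately show ?case by linarith
  qed
  have "\<phi> l \<le> exp (l\<^sup>2 / 2 * (1 + inverse (real (Suc k))) + l * m)" for k
  proof -
    have "(l / real (Suc k))\<^sup>2 * (real (Suc k) * (real (Suc k) + 1) / 2) = l\<^sup>2 / 2 * (1 + inverse (real (Suc k)))"
    proof -
      have "(l / n)\<^sup>2 * (n * (n + 1) / 2) = l\<^sup>2 / 2 * (1 + inverse n)" if "0 < n" for n :: real
        using that by (simp add: field_simps power2_eq_square)
      then show ?thesis using of_nat_0_less_iff by blast
    qed
    then show ?thesis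
      using bound[of "l / real (Suc k)" "Suc k"] l by (simp del: of_nat_Suc)
  qed
  moreover have "(\<lambda>k. exp (l\<^sup>2 / 2 * (1 + inverse (real (Suc k))) + l * m)) \<longlonglongrightarrow> exp (l\<^sup>2 / 2 * (1 + 0) + l * m)"
    by (intro tendsto_intros LIMSEQ_inverse_real_of_nat)
  ultimately have "\<phi> l \<le> exp (l\<^sup>2 / 2 * (1 + 0) + l * m)"
    by (intro LIMSEQ_le_const) auto
  then show ?thesis by (simp add: \<phi>_def m_def)
qed

section \<open>Comparison inequality for Gaussian matrices\<close>

lemma sum_Basis_vec: "sum f (Basis :: (real^'n) set) = (\<Sum>j\<in>UNIV. f (axis j 1))"
proof -
  have B: "(Basis :: (real^'n) set) = (\<lambda>j. axis j 1) ` UNIV" by (auto simp: Basis_vec_def)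
  have "inj (\<lambda>j::'n. axis j (1::real))" by (auto simp: inj_on_def axis_eq_axis)
  then show ?thesis unfolding B by (subst sum.reindex) auto
qed

lemma sum_Basis_matrix:
  "sum f (Basis :: (real^'n^'m) set) = (\<Sum>i\<in>UNIV. \<Sum>j\<in>UNIV. f (axis i (axis j 1)))"
proof -
  have B: "(Basis :: (real^'n^'m) set) = (\<lambda>(i, j). axis i (axis j 1)) ` UNIV"
    by (auto simp: Basis_vec_def image_iff)
  have "inj (\<lambda>(i::'m, j::'n). axis i (axis j (1::real)))"
    by (auto simp: inj_on_def axis_eq_axis)
  then have "sum f (Basis :: (real^'n^'m) set) = (\<Sum>(i, j)\<in>UNIV. f (axis i (axis j 1)))"
    unfolding B by (subst sum.reindex) (auto simp: case_prod_beta)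
  then show ?thesis
    by (simp add: sum.cartesian_product UNIV_Times_UNIV)
qed

lemma axis_matrix_vector_mult:
  fixes z :: "real^'n"
  shows "axis i (axis j 1) *v z = (z $ j) *\<^sub>R axis i 1"
  by (auto simp: vec_eq_iff matrix_vector_mult_def axis_def if_distrib[of "\<lambda>x. x * _"]
      if_distrib[of "\<lambda>x. x $ _"] cong: if_cong)

lemma linear_matrix_apply: "linear (\<lambda>A::real^'n^'m. A *v z)"
  by (simp add: linear_iff matrix_vector_mult_add_rdistrib scaleR_matrix_vector_assoc)

lemma integral_gauss_exp_real: "(\<integral>c. exp (l * c) \<partial>(gauss :: real measure)) = exp (l\<^sup>2 / 2)"
proof -
  have "(\<integral>c. exp (l * c) \<partial>(gauss :: real measure)) = (\<integral>c. gauss_density c * exp (l * c) \<partial>lborel)"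
    unfolding gauss_def by (subst integral_density) auto
  also have "\<dots> = (\<integral>c. exp (l\<^sup>2 / 2) * normal_density l 1 c \<partial>lborel)"
  proof (intro Bochner_Integration.integral_cong refl)
    fix c :: real
    have "- (c\<^sup>2 / 2) + l * c = l\<^sup>2 / 2 + - ((c - l)\<^sup>2 / 2)"
      by (simp add: power2_eq_square field_simps)
    then show "gauss_density c * exp (l * c) = exp (l\<^sup>2 / 2) * normal_density l 1 c"
      by (simp add: gauss_density_eq_prod normal_density_def mult_exp_exp)
  qed
  also have "\<dots> = exp (l\<^sup>2 / 2)"
    by simp
  finally show ?thesis .
qed

text \<open>The processes \<open>N (A z) + c\<close> and \<open>N g + h \<bullet> z\<close> have gradients of equal length for each \<open>z\<close>, while for
  \<open>z \<noteq> z'\<close> the inner products of the gradients differ by \<open>(1 - z \<bullet> z') * (1 - \<langle>\<nabla>N, \<nabla>N'\<rangle>) \<ge> 0\<close>.  This fixes the sign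
  in the interpolation because \<open>exp\<close> of the soft maximum has nonpositive mixed derivatives.\<close>

theorem gauss_matrix_laplace:
  fixes N :: "real^'m \<Rightarrow> real" and K :: "(real^'n) set"
  assumes N: "bounded_C2 N D Q" and D: "\<And>p v. \<bar>D p v\<bar> \<le> norm v"
    and K: "finite K" "K \<noteq> {}" "\<And>z. z \<in> K \<Longrightarrow> norm z = 1"
    and l: "0 \<le> l" "l \<le> \<alpha>" "0 < \<alpha>"
  shows "(\<integral>A. exp (l * softmax \<alpha> K (\<lambda>z. N (A *v z))) \<partial>(gauss :: (real^'n^'m) measure))
    \<le> exp (l\<^sup>2 / 2 + l * ((\<integral>g. N g \<partial>gauss) + (\<integral>h. softmax \<alpha> K (\<lambda>z. h \<bullet> z) \<partial>gauss)))"
proof -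
  \<comment> \<open>A point has the form ((A, c), (g, h)). For (g, h) = 0 the sum
    \<open>N (L z p) + u z p\<close> is the process of A and c, for (A, c) = 0 that of g and
    h.\<close>
  define L where "L z p = fst (fst p) *v z + fst (snd p)"
    for z and p :: "((real^'n^'m) \<times> real) \<times> ((real^'m) \<times> (real^'n))"
  define u where "u z p = snd (fst p) + snd (snd p) \<bullet> z"
    for z and p :: "((real^'n^'m) \<times> real) \<times> ((real^'m) \<times> (real^'n))"
  have linL: "linear (L z)" and linl: "linear (u z)" for z
    by (simp_all add: L_def u_def linear_iff matrix_vector_mult_add_rdistrib scaleR_matrix_vector_assoc
        inner_add_left algebra_simps)
  define a where "a z p = N (L z p) + u z p" for z p
  define d where "d z p v = D (L z p) (L z v) + u z v" for z p v
  define r where "r z p v = Q (L z p) (L z v) + 0" for z p v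
  have a: "bounded_C2 (a z) (d z) (r z)" for z
    unfolding a_def[abs_def] d_def[abs_def] r_def[abs_def]
    by (rule C2_add[OF C2_compose_linear[OF N linL] C2_linear[OF linl]])
  define q where "q p = l * softmax \<alpha> K (\<lambda>z. a z p)" for p
  define W where "W p z = softmax_weight \<alpha> K (\<lambda>z. a z p) z" for p z
  have W: "0 \<le> W p z" "(\<Sum>z\<in>K. W p z) = 1" for p z
    unfolding W_def using softmax_weight_nonneg[OF l(3) K(1,2)] softmax_weight_sum[OF l(3) K(1,2)] by auto
  have q: "bounded_C2 q (\<lambda>p v. l * (\<Sum>z\<in>K. W p z * d z p v))
    (\<lambda>p v. l * ((\<Sum>z\<in>K. W p z * (r z p v + \<alpha> * (d z p v)\<^sup>2)) - \<alpha> * (\<Sum>z\<in>K. W p z * d z p v)\<^sup>2))"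
    unfolding q_def W_def by (intro C2_cmult C2_softmax a l K)
  have D0: "D p 0 = 0" and Q0: "Q p 0 = 0" for p
    using linear_0[OF C2_linear_D[OF N]] C2_second_scale[OF N, of p 0 0] by auto
  have Dscale: "D p (c *\<^sub>R v) = c * D p v" for p c v
    using linear_cmul[OF C2_linear_D[OF N]] by simp
  \<comment> \<open>The difference of the traces over the two factors, whose sign
    \<open>gauss_exp_interpolation\<close> asks for.\<close>
  define \<Delta> where "\<Delta> f = (\<Sum>b\<in>Basis. f (b, 0)) - (\<Sum>b\<in>Basis. f (0, b))"
    for f :: "((real^'n^'m) \<times> real) \<times> ((real^'m) \<times> (real^'n)) \<Rightarrow> real"
  have \<Delta>_add: "\<Delta> (\<lambda>v. f v + g v) = \<Delta> f + \<Delta> g"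
    and \<Delta>_diff: "\<Delta> (\<lambda>v. f v - g v) = \<Delta> f - \<Delta> g"
    and \<Delta>_cmult: "\<Delta> (\<lambda>v. c * f v) = c * \<Delta> f" for f g c
    by (simp_all add: \<Delta>_def sum.distrib sum_subtractf sum_distrib_left algebra_simps)
  have \<Delta>_sum: "\<Delta> (\<lambda>v. \<Sum>i\<in>I. f i v) = (\<Sum>i\<in>I. \<Delta> (f i))" for f and I :: "(real^'n) set"
    unfolding \<Delta>_def sum_subtractf by (simp add: sum.swap[of _ I])
  have \<Delta>_expand: "\<Delta> f = (\<Sum>i\<in>UNIV. \<Sum>j\<in>UNIV. f ((axis i (axis j 1), 0), 0)) + f ((0, 1), 0)
      - (\<Sum>i\<in>UNIV. f (0, (axis i 1, 0))) - (\<Sum>j\<in>UNIV. f (0, (0, axis j 1)))" for f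
    by (simp add: \<Delta>_def sum_Basis_prod sum_Basis_matrix sum_Basis_vec)
  have sumsq: "(\<Sum>j\<in>UNIV. z $ j * z' $ j) = z \<bullet> z'" for z z' :: "real^'n"
    by (simp add: inner_vec_def)
  \<comment> \<open>The matrix direction (i, j) contributes the second derivative of N along axis i
    with weight \<open>(z $ j)\<^sup>2\<close>. On the sphere these weights add up to 1, matching
    the contribution of g.\<close>
  have \<Delta>r: "\<Delta> (r z p) = 0" if "z \<in> K" for z p
  proof -
    have "(\<Sum>i\<in>UNIV. \<Sum>j\<in>UNIV. (z $ j)\<^sup>2 * Q (L z p) (axis i 1)) = (\<Sum>i\<in>UNIV. Q (L z p) (axis i 1))"
      using sumsq[of z z] K(3)[OF that]
      by (simp add: sum_distrib_right[symmetric] power2_eq_square norm_eq_1)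
    then show ?thesis
      by (simp add: \<Delta>_expand r_def L_def axis_matrix_vector_mult C2_second_scale[OF N] Q0)
  qed
  have \<Delta>d: "\<Delta> (\<lambda>v. d z p v * d z' p v)
     = (1 - z \<bullet> z') * (1 - (\<Sum>b\<in>Basis. D (L z p) b * D (L z' p) b))" for z z' p
  proof -
    have "(\<Sum>i\<in>UNIV. \<Sum>j\<in>UNIV. (z $ j * D (L z p) (axis i 1)) * (z' $ j * D (L z' p) (axis i 1)))
       = (\<Sum>i\<in>UNIV. (\<Sum>j\<in>UNIV. z $ j * z' $ j) * (D (L z p) (axis i 1) * D (L z' p) (axis i 1)))"
      by (simp add: sum_distrib_left sum_distrib_right mult_ac)
    also have "\<dots> = (z \<bullet> z') * (\<Sum>b\<in>Basis. D (L z p) b * D (L z' p) b)"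
      by (simp add: sumsq sum_Basis_vec sum_distrib_left)
    finally show ?thesis
      using inner_commute[of z' z]
      by (simp add: \<Delta>_expand d_def L_def u_def axis_matrix_vector_mult Dscale D0 inner_axis' sumsq sum_Basis_vec
          algebra_simps)
  qed
  have \<Delta>d_nonneg: "0 \<le> \<Delta> (\<lambda>v. d z p v * d z' p v)" if "z \<in> K" "z' \<in> K" for z z' p
  proof -
    have "z \<bullet> z' \<le> 1" using norm_cauchy_schwarz[of z z'] K(3) that by simp
    moreover have "(\<Sum>b\<in>Basis. D (L z p) b * D (L z' p) b) \<le> 1"
      by (intro sum_linear_functionals_le_1 C2_linear_D[OF N] D)
    ultimately show ?thesis unfolding \<Delta>d by (intro mult_nonneg_nonneg) auto
  qed
  have \<Delta>d_diag: "\<Delta> (\<lambda>v. (d z p v)\<^sup>2) = 0" if "z \<in> K" for z p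
    using \<Delta>d[of z p z] K(3)[OF that] by (simp add: power2_eq_square norm_eq_1)
  have "(\<integral>x. exp (q (x, 0)) \<partial>gauss) \<le> exp 0 * (\<integral>y. exp (q (0, y)) \<partial>gauss)"
  proof (rule gauss_exp_interpolation[OF q])
    fix p
    let ?T = "\<lambda>v. (l * (\<Sum>z\<in>K. W p z * d z p v))\<^sup>2
      + l * ((\<Sum>z\<in>K. W p z * (r z p v + \<alpha> * (d z p v)\<^sup>2)) - \<alpha> * (\<Sum>z\<in>K. W p z * d z p v)\<^sup>2)"
    \<comment> \<open>The squared mean of d carries l^2 from exp and -(l \<alpha>) from the soft
      maximum. For l \<le> \<alpha> the net coefficient is nonpositive, the sign that goes with
      \<open>\<Delta>d_nonneg\<close>.\<close>
    have "?T = (\<lambda>v. l * (\<Sum>z\<in>K. W p z * (r z p v + \<alpha> * (d z p v)\<^sup>2))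
       - l * (\<alpha> - l) * (\<Sum>z\<in>K. \<Sum>z'\<in>K. (W p z * W p z') * (d z p v * d z' p v)))"
    proof
      fix v
      have "(\<Sum>z\<in>K. W p z * d z p v)\<^sup>2 = (\<Sum>z\<in>K. \<Sum>z'\<in>K. (W p z * W p z') * (d z p v * d z' p v))"
        by (simp add: power2_eq_square sum_product mult_ac)
      then show "?T v = l * (\<Sum>z\<in>K. W p z * (r z p v + \<alpha> * (d z p v)\<^sup>2))
       - l * (\<alpha> - l) * (\<Sum>z\<in>K. \<Sum>z'\<in>K. (W p z * W p z') * (d z p v * d z' p v))"
        by (simp add: power_mult_distrib power2_eq_square[of l] algebra_simps)
    qed
    then have "\<Delta> ?T = l * (\<Sum>z\<in>K. W p z * (\<Delta> (r z p) + \<alpha> * \<Delta> (\<lambda>v. (d z p v)\<^sup>2)))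
       - l * (\<alpha> - l) * (\<Sum>z\<in>K. \<Sum>z'\<in>K. (W p z * W p z') * \<Delta> (\<lambda>v. d z p v * d z' p v))"
      by (simp only: \<Delta>_diff \<Delta>_cmult \<Delta>_sum \<Delta>_add)
    also have "\<dots> = - (l * (\<alpha> - l) * (\<Sum>z\<in>K. \<Sum>z'\<in>K. (W p z * W p z') * \<Delta> (\<lambda>v. d z p v * d z' p v)))"
      by (simp add: \<Delta>r \<Delta>d_diag)
    also have "\<dots> \<le> 0"
      using l by (auto intro!: mult_nonneg_nonneg sum_nonneg W \<Delta>d_nonneg)
    finally show "(\<Sum>b\<in>Basis. ?T (b, 0)) - (\<Sum>b\<in>Basis. ?T (0, b)) \<le> 2 * 0"
      by (simp add: \<Delta>_def)
  qed
  moreover have "(\<integral>x. exp (q (x, 0)) \<partial>gauss)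
     = (\<integral>A. exp (l * softmax \<alpha> K (\<lambda>z. N (A *v z))) \<partial>(gauss :: (real^'n^'m) measure)) * exp (l\<^sup>2 / 2)"
  proof -
    have "q (x, 0) = l * softmax \<alpha> K (\<lambda>z. N (fst x *v z)) + l * snd x" for x
      unfolding q_def a_def L_def u_def
      by (simp add: softmax_add[OF l(3) K(1,2)] distrib_left)
    moreover have sm: "bounded_C2 (\<lambda>A::real^'n^'m. softmax \<alpha> K (\<lambda>z. N (A *v z)))
        (\<lambda>p v. \<Sum>z\<in>K. softmax_weight \<alpha> K (\<lambda>z. N (p *v z)) z * D (p *v z) (v *v z))
        (\<lambda>p v. (\<Sum>z\<in>K. softmax_weight \<alpha> K (\<lambda>z. N (p *v z)) z * (Q (p *v z) (v *v z) + \<alpha> * (D (p *v z) (v *v z))\<^sup>2))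
           - \<alpha> * (\<Sum>z\<in>K. softmax_weight \<alpha> K (\<lambda>z. N (p *v z)) z * D (p *v z) (v *v z))\<^sup>2)"
      by (rule C2_softmax[OF l(3) K(1,2) C2_compose_linear[OF N linear_matrix_apply]])
    have "(\<integral>x. exp (l * softmax \<alpha> K (\<lambda>z. N (fst x *v z))) * exp (l * snd x) \<partial>(gauss :: ((real^'n^'m) \<times> real) measure))
      = (\<integral>A. exp (l * softmax \<alpha> K (\<lambda>z. N (A *v z))) \<partial>(gauss :: (real^'n^'m) measure)) * (\<integral>c. exp (l * c) \<partial>gauss)"
      by (rule integral_gauss_mult)
        (auto intro!: C2_exp_bounded_exp[OF sm] C2_exp_bounded_exp[OF C2_linear[OF linear_id[unfolded id_def]]]
          continuous_intros C2_continuous[OF sm])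
    ultimately show ?thesis
      by (simp add: exp_add integral_gauss_exp_real)
  qed
  moreover have "(\<integral>y. exp (q (0, y)) \<partial>gauss)
      \<le> exp (l\<^sup>2 / 2 + l * ((\<integral>g. N g \<partial>gauss) + (\<integral>h. softmax \<alpha> K (\<lambda>z. h \<bullet> z) \<partial>gauss))) * exp (l\<^sup>2 / 2)"
  proof -
    have q0: "q (0, y) = l * N (fst y) + l * softmax \<alpha> K (\<lambda>z. snd y \<bullet> z)" for y
      unfolding q_def a_def L_def u_def
      using softmax_add[OF l(3) K(1,2), of "\<lambda>z. snd y \<bullet> z" "N (fst y)"]
      by (simp add: distrib_left add.commute)
    have lin: "linear (\<lambda>h::real^'n. h \<bullet> z)" for z
      by (intro bounded_linear.linear bounded_linear_inner_left)
    have sm: "bounded_C2 (\<lambda>h::real^'n. softmax \<alpha> K (\<lambda>z. h \<bullet> z))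
        (\<lambda>p v. \<Sum>z\<in>K. softmax_weight \<alpha> K (\<lambda>z. p \<bullet> z) z * (v \<bullet> z))
        (\<lambda>p v. (\<Sum>z\<in>K. softmax_weight \<alpha> K (\<lambda>z. p \<bullet> z) z * (0 + \<alpha> * (v \<bullet> z)\<^sup>2))
           - \<alpha> * (\<Sum>z\<in>K. softmax_weight \<alpha> K (\<lambda>z. p \<bullet> z) z * (v \<bullet> z))\<^sup>2)"
      by (rule C2_softmax[OF l(3) K(1,2) C2_linear[OF lin]])
    \<comment> \<open>The gradient is a mean of unit vectors, so \<open>gauss_concentration\<close>
      applies to the soft maximum with no loss in \<alpha>.\<close>
    have bound: "\<bar>\<Sum>z\<in>K. softmax_weight \<alpha> K (\<lambda>z. p \<bullet> z) z * (v \<bullet> z)\<bar> \<le> norm v" for p v :: "real^'n"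
      using Cauchy_Schwarz_ineq2[of v] K(3) by (intro softmax_average_le[OF l(3) K(1,2)]) (metis mult.right_neutral)
    have "(\<integral>y. exp (l * N (fst y)) * exp (l * softmax \<alpha> K (\<lambda>z. snd y \<bullet> z)) \<partial>gauss)
      = (\<integral>g. exp (l * N g) \<partial>gauss) * (\<integral>h. exp (l * softmax \<alpha> K (\<lambda>z. h \<bullet> z)) \<partial>gauss)"
      by (rule integral_gauss_mult)
        (auto intro!: C2_exp_bounded_exp[OF sm] C2_exp_bounded_exp[OF N] continuous_intros
          C2_continuous[OF sm] C2_continuous[OF N])
    also have "\<dots> \<le> exp (l\<^sup>2 / 2 + l * (\<integral>g. N g \<partial>gauss)) * exp (l\<^sup>2 / 2 + l * (\<integral>h. softmax \<alpha> K (\<lambda>z. h \<bullet> z) \<partial>gauss))"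
      by (intro mult_mono gauss_concentration[OF N D l(1)] gauss_concentration[OF sm bound l(1)]) auto
    finally show ?thesis
      by (simp add: q0 mult_exp_exp algebra_simps)
  qed
  ultimately have "(\<integral>A. exp (l * softmax \<alpha> K (\<lambda>z. N (A *v z))) \<partial>(gauss :: (real^'n^'m) measure)) * exp (l\<^sup>2 / 2)
     \<le> exp (l\<^sup>2 / 2 + l * ((\<integral>g. N g \<partial>gauss) + (\<integral>h. softmax \<alpha> K (\<lambda>z. h \<bullet> z) \<partial>gauss))) * exp (l\<^sup>2 / 2)"
    unfolding exp_zero mult_1_left by linarith
  then show ?thesis
    by (simp only: mult_le_cancel_right_pos exp_gt_zero)
qed

section \<open>Mean width and tail bounds\<close>

lemma std_gaussian_vec_eq_gauss: "std_gaussian_vec = (gauss :: (real^'n::finite) measure)"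
proof -
  have B: "(Basis :: (real^'n) set) = (\<lambda>j. axis j 1) ` UNIV" by (auto simp: Basis_vec_def)
  have "inj (\<lambda>j::'n. axis j (1::real))" by (auto simp: inj_on_def axis_eq_axis)
  then have "(\<Prod>i\<in>UNIV. std_normal_density (g $ i)) = gauss_density g" for g :: "real^'n"
    unfolding gauss_density_eq_prod B by (subst prod.reindex) (auto simp: inner_axis)
  then show ?thesis
    by (simp add: std_gaussian_vec_def gauss_def)
qed

context
  fixes K :: "'a::euclidean_space set"
  assumes K: "K \<subseteq> sphere 0 1" "K \<noteq> {}"
begin

lemma inner_sphere_le: "z \<in> K \<Longrightarrow> h \<bullet> z \<le> norm h"
  using norm_cauchy_schwarz[of h z] K by (auto simp: subset_iff)

lemma bdd_above_inner_sphere: "bdd_above ((\<lambda>z. h \<bullet> z) ` K)"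
  using inner_sphere_le by (auto intro!: bdd_aboveI[of _ "norm h"])

lemma SUP_inner_ge: "z \<in> K \<Longrightarrow> h \<bullet> z \<le> (SUP z\<in>K. h \<bullet> z)"
  by (rule cSUP_upper[OF _ bdd_above_inner_sphere])

lemma SUP_inner_diff_le: "(SUP z\<in>K. h \<bullet> z) \<le> (SUP z\<in>K. h' \<bullet> z) + norm (h - h')"
proof (rule cSUP_least[OF K(2)])
  fix z assume z: "z \<in> K"
  have "h \<bullet> z = h' \<bullet> z + (h - h') \<bullet> z" by (simp add: inner_diff_left)
  then show "h \<bullet> z \<le> (SUP z\<in>K. h' \<bullet> z) + norm (h - h')"
    using SUP_inner_ge[OF z, of h'] inner_sphere_le[OF z, of "h - h'"] by linarith
qed

lemma continuous_SUP_inner: "continuous_on UNIV (\<lambda>h. SUP z\<in>K. h \<bullet> z)"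
proof -
  have "\<bar>(SUP z\<in>K. h \<bullet> z) - (SUP z\<in>K. h' \<bullet> z)\<bar> \<le> 1 * norm (h - h')" for h h'
    using SUP_inner_diff_le[of h h'] SUP_inner_diff_le[of h' h] by (simp add: norm_minus_commute abs_le_iff)
  then have "1-lipschitz_on UNIV (\<lambda>h. SUP z\<in>K. h \<bullet> z)"
    by (auto intro!: lipschitz_onI simp: dist_norm)
  then show ?thesis by (rule lipschitz_on_continuous_on)
qed

lemma integrable_SUP_inner: "integrable gauss (\<lambda>h. SUP z\<in>K. h \<bullet> z)"
proof (rule integrable_gauss[OF continuous_SUP_inner])
  have "\<bar>SUP z\<in>K. h \<bullet> z\<bar> \<le> norm h" for h
  proof -
    obtain z where z: "z \<in> K" using K by auto
    have "- h \<bullet> z \<le> norm (- h)" by (rule inner_sphere_le[OF z])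
    then have "- norm h \<le> h \<bullet> z" by simp
    then show ?thesis
      using SUP_inner_ge[OF z, of h] cSUP_least[OF K(2), of "\<lambda>z. h \<bullet> z" "norm h"] inner_sphere_le
      by (simp add: abs_le_iff)
  qed
  then show "exp_bounded (\<lambda>h. SUP z\<in>K. h \<bullet> z)"
    by (intro exp_bounded_linear_growth[of _ 0 1]) auto
qed

end

lemma gaussian_mean_width_eq:
  "K \<noteq> {} \<Longrightarrow> gaussian_mean_width K = (\<integral>h. (SUP z\<in>K. h \<bullet> z) \<partial>gauss)"
  by (simp add: gaussian_mean_width_def std_gaussian_vec_eq_gauss)

lemma integral_gauss_inner: "(\<integral>h. h \<bullet> z \<partial>gauss) = 0"
proof -
  have "(\<integral>h. (h \<bullet> z) * 1 \<partial>gauss) = (\<integral>h. 0 \<partial>(gauss :: 'a measure))"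
    by (rule gauss_integration_by_parts) (auto intro: exp_bounded_const)
  then show ?thesis by simp
qed

text \<open>The supremum dominates a single linear functional, which has mean 0.\<close>

lemma gaussian_mean_width_nonneg:
  assumes "K \<subseteq> sphere 0 1"
  shows "0 \<le> gaussian_mean_width K"
proof (cases "K = {}")
  case False
  then obtain z where z: "z \<in> K" by auto
  have "(\<integral>h. h \<bullet> z \<partial>gauss) \<le> (\<integral>h. (SUP z\<in>K. h \<bullet> z) \<partial>gauss)"
    using assms False z
    by (intro integral_mono integrable_SUP_inner SUP_inner_ge integrable_gauss continuous_intros exp_bounded_inner) auto
  then show ?thesis using False by (simp add: integral_gauss_inner gaussian_mean_width_eq)
qed (simp add: gaussian_mean_width_def)

text \<open>A Chernoff bound with parameter s = \<eta>, the minimizer of s^2 / 2 - s \<eta>. The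
  width of the larger set K enters, so the bound is uniform over finite subsets Z; the error ln
  (card Z) / \<alpha> of the soft maximum vanishes in the limit.\<close>

lemma gauss_matrix_tail_finite:
  fixes N :: "real^'m \<Rightarrow> real" and K :: "(real^'n) set"
  assumes N: "bounded_C2 N D Q" and D: "\<And>p v. \<bar>D p v\<bar> \<le> norm v"
    and K: "K \<subseteq> sphere 0 1" and Z: "finite Z" "Z \<subseteq> K" and \<eta>: "0 < \<eta>"
  shows "measure gauss {A::real^'n^'m. \<exists>z\<in>Z. (\<integral>g. N g \<partial>gauss) + gaussian_mean_width K + \<eta> < N (A *v z)}
     \<le> exp (- \<eta>\<^sup>2 / 2)" (is "measure gauss ?bad \<le> _")
proof (cases "Z = {}")
  case False
  then have Kne: "K \<noteq> {}" using Z by auto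
  define w where "w = gaussian_mean_width K"
  define m where "m = (\<integral>g. N g \<partial>gauss)"
  have Zn: "norm z = 1" if "z \<in> Z" for z using that Z K by auto
  have le: "measure gauss ?bad \<le> exp (- \<eta>\<^sup>2 / 2 + \<eta> * (ln (real (card Z)) / \<alpha>))" if \<alpha>: "\<eta> \<le> \<alpha>" for \<alpha>
  proof -
    have \<alpha>0: "0 < \<alpha>" using \<alpha> \<eta> by simp
    let ?s = "\<lambda>A::real^'n^'m. softmax \<alpha> Z (\<lambda>z. N (A *v z))"
    let ?c = "exp (\<eta> * (m + w + \<eta>))"
    have sm: "bounded_C2 ?s
        (\<lambda>p v. \<Sum>z\<in>Z. softmax_weight \<alpha> Z (\<lambda>z. N (p *v z)) z * D (p *v z) (v *v z))
        (\<lambda>p v. (\<Sum>z\<in>Z. softmax_weight \<alpha> Z (\<lambda>z. N (p *v z)) z * (Q (p *v z) (v *v z) + \<alpha> * (D (p *v z) (v *v z))\<^sup>2))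
           - \<alpha> * (\<Sum>z\<in>Z. softmax_weight \<alpha> Z (\<lambda>z. N (p *v z)) z * D (p *v z) (v *v z))\<^sup>2)"
      by (rule C2_softmax[OF \<alpha>0 Z(1) False C2_compose_linear[OF N linear_matrix_apply]])
    have lin: "linear (\<lambda>h::real^'n. h \<bullet> z)" for z
      by (intro bounded_linear.linear bounded_linear_inner_left)
    note sm_h = C2_softmax[OF \<alpha>0 Z(1) False C2_linear[OF lin]]
    have "(\<integral>h. softmax \<alpha> Z (\<lambda>z. h \<bullet> z) \<partial>gauss) \<le> (\<integral>h. (SUP z\<in>K. h \<bullet> z) + ln (real (card Z)) / \<alpha> \<partial>gauss)"
      using Z by (intro integral_mono C2_integrable[OF sm_h] Bochner_Integration.integrable_add
          integrable_SUP_inner[OF K Kne] softmax_le[OF \<alpha>0 Z(1) False] SUP_inner_ge[OF K Kne]) auto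
    also have "\<dots> = w + ln (real (card Z)) / \<alpha>"
      by (simp add: w_def gaussian_mean_width_eq[OF Kne] integrable_SUP_inner[OF K Kne])
    finally have h: "(\<integral>h. softmax \<alpha> Z (\<lambda>z. h \<bullet> z) \<partial>gauss) \<le> w + ln (real (card Z)) / \<alpha>" .
    have int: "integrable gauss (\<lambda>A. exp (\<eta> * ?s A))" by (rule C2_integrable_exp[OF sm])
    have "measure gauss ?bad \<le> measure gauss {A \<in> space gauss. ?c \<le> exp (\<eta> * ?s A)}"
    proof (rule gauss.finite_measure_mono)
      show "?bad \<subseteq> {A \<in> space gauss. ?c \<le> exp (\<eta> * ?s A)}"
      proof
        fix A :: "real^'n^'m" assume "A \<in> ?bad"
        then obtain z where z: "z \<in> Z" "(\<integral>g. N g \<partial>gauss) + gaussian_mean_width K + \<eta> < N (A *v z)"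
          by auto
        then have "m + w + \<eta> \<le> ?s A"
          using softmax_ge[OF \<alpha>0 Z(1) False z(1), of "\<lambda>z. N (A *v z)"] by (simp add: m_def w_def)
        then show "A \<in> {A \<in> space gauss. ?c \<le> exp (\<eta> * ?s A)}" using \<eta> by simp
      qed
      show "{A \<in> space gauss. ?c \<le> exp (\<eta> * ?s A)} \<in> sets gauss"
        using borel_measurable_integrable[OF int] by measurable
    qed
    also have "\<dots> \<le> (\<integral>A. exp (\<eta> * ?s A) \<partial>gauss) / ?c"
      by (rule integral_Markov_inequality_measure[OF int]) auto
    also have "\<dots> \<le> exp (\<eta>\<^sup>2 / 2 + \<eta> * (m + (w + ln (real (card Z)) / \<alpha>))) / ?c"
    proof (rule divide_right_mono)
      have "(\<integral>A. exp (\<eta> * ?s A) \<partial>gauss) \<le> exp (\<eta>\<^sup>2 / 2 + \<eta> * (m + (\<integral>h. softmax \<alpha> Z (\<lambda>z. h \<bullet> z) \<partial>gauss)))"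
        unfolding m_def using \<alpha> \<eta> by (intro gauss_matrix_laplace[OF N D Z(1) False Zn]) auto
      also have "\<dots> \<le> exp (\<eta>\<^sup>2 / 2 + \<eta> * (m + (w + ln (real (card Z)) / \<alpha>)))"
        using h \<eta> by auto
      finally show "(\<integral>A. exp (\<eta> * ?s A) \<partial>gauss) \<le> exp (\<eta>\<^sup>2 / 2 + \<eta> * (m + (w + ln (real (card Z)) / \<alpha>)))" .
    qed simp
    also have "\<dots> = exp (- \<eta>\<^sup>2 / 2 + \<eta> * (ln (real (card Z)) / \<alpha>))"
      unfolding exp_diff[symmetric] by (rule arg_cong[where f = exp]) (simp add: algebra_simps power2_eq_square)
    finally show ?thesis .
  qed
  \<comment> \<open>The choice \<alpha> = \<eta> + k respects \<eta> \<le> \<alpha> and tends to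
    infinity.\<close>
  have le': "measure gauss ?bad \<le> exp (- \<eta>\<^sup>2 / 2 + \<eta> * (ln (real (card Z)) / (\<eta> + real k)))" for k
    by (rule le) simp
  have "(\<lambda>k. exp (- \<eta>\<^sup>2 / 2 + \<eta> * (ln (real (card Z)) / (\<eta> + real k)))) \<longlonglongrightarrow> exp (- \<eta>\<^sup>2 / 2 + \<eta> * 0)"
    by (intro tendsto_intros tendsto_divide_0[OF tendsto_const] filterlim_at_top_imp_at_infinity
        filterlim_tendsto_add_at_top[OF tendsto_const] filterlim_real_sequentially)
  then have "measure gauss ?bad \<le> exp (- \<eta>\<^sup>2 / 2 + \<eta> * 0)"
    by (rule LIMSEQ_le_const) (use le' in blast)
  then show ?thesis by simp
qed simp

text \<open>The event is a union of open sets, hence open for every index set.\<close>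

lemma sets_matrix_tail:
  fixes N :: "real^'m \<Rightarrow> real" and Z :: "(real^'n) set"
  assumes N: "continuous_on UNIV N"
  shows "{A::real^'n^'m. \<exists>z\<in>Z. c < N (A *v z)} \<in> sets borel"
proof -
  have "open {A::real^'n^'m. c < N (A *v z)}" for z
  proof (rule open_Collect_less)
    have "continuous_on UNIV (\<lambda>A::real^'n^'m. A *v z)"
      using linear_matrix_apply linear_conv_bounded_linear linear_continuous_on by blast
    then show "continuous_on UNIV (\<lambda>A::real^'n^'m. N (A *v z))"
      by (rule continuous_on_compose2[OF N]) auto
  qed simp
  moreover have "{A::real^'n^'m. \<exists>z\<in>Z. c < N (A *v z)} = (\<Union>z\<in>Z. {A. c < N (A *v z)})" by auto
  ultimately have "open {A::real^'n^'m. \<exists>z\<in>Z. c < N (A *v z)}"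
    by (simp add: open_UN)
  then show ?thesis by (rule borel_open)
qed

text \<open>Continuity of measure along the events for initial segments of an enumeration of Z; the
  bound for finite sets does not see the segment.\<close>

lemma gauss_matrix_tail_C2:
  fixes N :: "real^'m \<Rightarrow> real" and K :: "(real^'n) set"
  assumes N: "bounded_C2 N D Q" and D: "\<And>p v. \<bar>D p v\<bar> \<le> norm v"
    and K: "K \<subseteq> sphere 0 1" and Z: "countable Z" "Z \<subseteq> K" and \<eta>: "0 < \<eta>"
  shows "measure gauss {A::real^'n^'m. \<exists>z\<in>Z. (\<integral>g. N g \<partial>gauss) + gaussian_mean_width K + \<eta> < N (A *v z)}
     \<le> exp (- \<eta>\<^sup>2 / 2)"
proof (cases "Z = {}")
  case False
  define c where "c = (\<integral>g. N g \<partial>gauss) + gaussian_mean_width K + \<eta>"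
  define U where "U k = {A::real^'n^'m. \<exists>z\<in>from_nat_into Z ` {..k}. c < N (A *v z)}" for k :: nat
  have "{A::real^'n^'m. \<exists>z\<in>Z. c < N (A *v z)} = {A. \<exists>z\<in>range (from_nat_into Z). c < N (A *v z)}"
    using Z False by simp
  also have "\<dots> = (\<Union>k. U k)"
    unfolding U_def by auto
  finally have eq: "{A::real^'n^'m. \<exists>z\<in>Z. c < N (A *v z)} = (\<Union>k. U k)" .
  have "(\<lambda>k. measure gauss (U k)) \<longlonglongrightarrow> measure gauss (\<Union>k. U k)"
  proof (rule gauss.finite_Lim_measure_incseq)
    show "range U \<subseteq> sets gauss" unfolding sets_gauss
      unfolding U_def using sets_matrix_tail[OF C2_continuous[OF N]] by blast
    show "incseq U"
      unfolding incseq_def U_def by fastforce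
  qed
  moreover have "measure gauss (U k) \<le> exp (- \<eta>\<^sup>2 / 2)" for k
    unfolding U_def c_def
    using from_nat_into[OF False] Z by (intro gauss_matrix_tail_finite[OF N D K _ _ \<eta>]) auto
  ultimately have "measure gauss (\<Union>k. U k) \<le> exp (- \<eta>\<^sup>2 / 2)"
    by (intro LIMSEQ_le_const2) auto
  then show ?thesis using eq by (simp add: c_def)
qed simp

text \<open>The approximants are themselves 1-Lipschitz, as the Laplace bound demands. Their second
  derivatives may blow up as \<epsilon> tends to 0, because the tail bound does not depend on
  them.\<close>

definition C2_approximable :: "('a::euclidean_space \<Rightarrow> real) \<Rightarrow> bool" where
  "C2_approximable N \<longleftrightarrow> continuous_on UNIV N \<and> exp_bounded N \<and>
     (\<forall>\<epsilon>>0. \<exists>F D Q. bounded_C2 F D Q \<and> (\<forall>p v. \<bar>D p v\<bar> \<le> norm v) \<and> (\<forall>x. \<bar>F x - N x\<bar> \<le> \<epsilon>))"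

text \<open>Passing to an approximant costs \<epsilon> in the mean and \<epsilon> in the value, so
  \<eta> becomes \<eta> - 2 \<epsilon>; the bound is continuous in \<epsilon>.\<close>

theorem gauss_matrix_tail:
  fixes N :: "real^'m \<Rightarrow> real" and K :: "(real^'n) set"
  assumes N: "C2_approximable N"
    and K: "K \<subseteq> sphere 0 1" and Z: "countable Z" "Z \<subseteq> K" and \<eta>: "0 < \<eta>"
  shows "measure gauss {A::real^'n^'m. \<exists>z\<in>Z. (\<integral>g. N g \<partial>gauss) + gaussian_mean_width K + \<eta> < N (A *v z)}
     \<le> exp (- \<eta>\<^sup>2 / 2)" (is "measure gauss ?bad \<le> _")
proof -
  have intN: "integrable gauss N" using N by (auto simp: C2_approximable_def intro: integrable_gauss)
  have le: "measure gauss ?bad \<le> exp (- (\<eta> - 2 * \<epsilon>)\<^sup>2 / 2)" if \<epsilon>: "0 < \<epsilon>" "\<epsilon> < \<eta> / 2" for \<epsilon>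
  proof -
    obtain F D Q where F: "bounded_C2 F D Q" "\<And>p v. \<bar>D p v\<bar> \<le> norm v" "\<And>x. \<bar>F x - N x\<bar> \<le> \<epsilon>"
      using N \<epsilon> unfolding C2_approximable_def by metis
    have "(\<integral>g. F g \<partial>gauss) \<le> (\<integral>g. N g + \<epsilon> \<partial>gauss)"
    proof (rule integral_mono)
      show "F g \<le> N g + \<epsilon>" for g using F(3)[of g] by (simp add: abs_le_iff)
    qed (use intN C2_integrable[OF F(1)] in auto)
    then have "(\<integral>g. F g \<partial>gauss) \<le> (\<integral>g. N g \<partial>gauss) + \<epsilon>" by (simp add: intN)
    then have "?bad \<subseteq> {A. \<exists>z\<in>Z. (\<integral>g. F g \<partial>gauss) + gaussian_mean_width K + (\<eta> - 2 * \<epsilon>) < F (A *v z)}"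
    proof safe
      fix A :: "real^'n^'m" and z
      assume "z \<in> Z" "(\<integral>g. N g \<partial>gauss) + gaussian_mean_width K + \<eta> < N (A *v z)"
        and "(\<integral>g. F g \<partial>gauss) \<le> (\<integral>g. N g \<partial>gauss) + \<epsilon>"
      then show "\<exists>z\<in>Z. (\<integral>g. F g \<partial>gauss) + gaussian_mean_width K + (\<eta> - 2 * \<epsilon>) < F (A *v z)"
        using F(3)[of "A *v z"] by (intro bexI[of _ z]) auto
    qed
    then have "measure gauss ?bad \<le> measure gauss {A::real^'n^'m. \<exists>z\<in>Z. (\<integral>g. F g \<partial>gauss) + gaussian_mean_width K + (\<eta> - 2 * \<epsilon>) < F (A *v z)}"
      using sets_matrix_tail[OF C2_continuous[OF F(1)]] by (intro gauss.finite_measure_mono) auto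
    also have "\<dots> \<le> exp (- (\<eta> - 2 * \<epsilon>)\<^sup>2 / 2)"
      using \<epsilon> by (intro gauss_matrix_tail_C2[OF F(1,2) K Z]) auto
    finally show ?thesis .
  qed
  have "((\<lambda>\<epsilon>. exp (- (\<eta> - 2 * \<epsilon>)\<^sup>2 / 2)) \<longlongrightarrow> exp (- (\<eta> - 2 * 0)\<^sup>2 / 2)) (at_right 0)"
    by (intro tendsto_intros) auto
  moreover have "eventually (\<lambda>\<epsilon>. measure gauss ?bad \<le> exp (- (\<eta> - 2 * \<epsilon>)\<^sup>2 / 2)) (at_right 0)"
    by (rule eventually_at_rightI[of 0 "\<eta> / 2"]) (use \<eta> le in auto)
  ultimately show ?thesis
    using tendsto_lowerbound[of _ _ "at_right (0::real)"] by fastforce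
qed

text \<open>Removes the singularity of the norm at the origin: it stays within \<epsilon> of the
  norm and 1-Lipschitz, at the price of a second derivative of order 1 / \<epsilon>.\<close>

definition smooth_norm :: "real \<Rightarrow> 'a::euclidean_space \<Rightarrow> real" where
  "smooth_norm \<epsilon> x = sqrt (\<epsilon>\<^sup>2 + x \<bullet> x)"

context
  fixes \<epsilon> :: real assumes \<epsilon>: "0 < \<epsilon>"
begin

lemma smooth_norm_ge: "\<epsilon> \<le> smooth_norm \<epsilon> x"
  unfolding smooth_norm_def by (rule real_le_rsqrt) simp

lemma smooth_norm_ge_norm: "norm x \<le> smooth_norm \<epsilon> x"
  unfolding smooth_norm_def norm_eq_sqrt_inner by simp

lemma smooth_norm_le: "smooth_norm \<epsilon> x \<le> norm x + \<epsilon>"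
  unfolding smooth_norm_def using \<epsilon>
  by (intro real_le_lsqrt) (auto simp: power2_sum power2_norm_eq_inner)

lemma smooth_norm_square: "(smooth_norm \<epsilon> x)\<^sup>2 = \<epsilon>\<^sup>2 + x \<bullet> x"
  unfolding smooth_norm_def by simp

lemma smooth_norm_abs_inner: "\<bar>p \<bullet> v\<bar> \<le> smooth_norm \<epsilon> p * norm v"
  using Cauchy_Schwarz_ineq2[of p v] mult_right_mono[OF smooth_norm_ge_norm[of p], of "norm v"] by simp

lemma smooth_norm_C2:
  "bounded_C2 (smooth_norm \<epsilon> :: 'a::euclidean_space \<Rightarrow> real) (\<lambda>p v. (p \<bullet> v) / smooth_norm \<epsilon> p)
     (\<lambda>p v. (v \<bullet> v) / smooth_norm \<epsilon> p - (p \<bullet> v)\<^sup>2 / (smooth_norm \<epsilon> p)^3)"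
proof -
  let ?n = "smooth_norm \<epsilon> :: 'a \<Rightarrow> real"
  have pos: "0 < ?n x" for x using smooth_norm_ge[of x] \<epsilon> by linarith
  have pos': "0 < \<epsilon>\<^sup>2 + x \<bullet> x" for x :: 'a using \<epsilon> by (simp add: add_pos_nonneg)
  have 1: "(?n has_derivative (\<lambda>v. (p \<bullet> v) / ?n p)) (at p)" for p :: 'a
    unfolding smooth_norm_def[abs_def] using pos'[of p]
    by (auto intro!: derivative_eq_intros simp: field_simps inner_commute)
  have cont: "continuous_on UNIV ?n"
    using 1 by (meson continuous_at_imp_continuous_on has_derivative_continuous)
  have 2: "((\<lambda>t. ((p + t *\<^sub>R v) \<bullet> v) / ?n (p + t *\<^sub>R v)) has_real_derivative
      (v \<bullet> v) / ?n p - (p \<bullet> v)\<^sup>2 / (?n p)^3) (at 0)" for p v :: 'a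
  proof -
    have pv: "((\<lambda>t. p + t *\<^sub>R v) has_derivative (\<lambda>h. h *\<^sub>R v)) (at 0)"
      by (auto intro!: derivative_eq_intros)
    have "((\<lambda>t. ?n (p + t *\<^sub>R v)) has_derivative (\<lambda>h. (p \<bullet> (h *\<^sub>R v)) / ?n p)) (at 0)"
      using has_derivative_compose[OF pv, of ?n "\<lambda>v. (p \<bullet> v) / ?n p"] 1[of p] by simp
    then have d: "((\<lambda>t. ?n (p + t *\<^sub>R v)) has_real_derivative (p \<bullet> v) / ?n p) (at 0)"
      by (rule has_derivative_imp_has_field_derivative) simp
    have n: "((\<lambda>t. (p + t *\<^sub>R v) \<bullet> v) has_real_derivative v \<bullet> v) (at 0)"
      by (auto intro!: derivative_eq_intros simp: inner_add_left)
    show ?thesis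
      using DERIV_divide[OF n d] pos[of p]
      by (simp add: less_imp_neq[symmetric] field_simps power2_eq_square power3_eq_cube)
  qed
  have 3: "\<bar>(p \<bullet> v) / ?n p\<bar> \<le> 1 * norm v" for p v :: 'a
    using smooth_norm_abs_inner[of p v] pos[of p] by (simp add: abs_divide pos_divide_le_eq mult.commute)
  have 4: "\<bar>(v \<bullet> v) / ?n p - (p \<bullet> v)\<^sup>2 / (?n p)^3\<bar> \<le> (2 / \<epsilon>) * (norm v)\<^sup>2" for p v :: 'a
  proof -
    have a: "(norm v)\<^sup>2 / ?n p \<le> (norm v)\<^sup>2 / \<epsilon>"
      using smooth_norm_ge[of p] \<epsilon> by (intro divide_left_mono) (auto intro: mult_pos_pos pos)
    have "(p \<bullet> v)\<^sup>2 \<le> (?n p)\<^sup>2 * (norm v)\<^sup>2"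
      using power_mono[OF smooth_norm_abs_inner[of p v], of 2] by (simp add: power_mult_distrib)
    then have "(p \<bullet> v)\<^sup>2 / (?n p)^3 \<le> (?n p)\<^sup>2 * (norm v)\<^sup>2 / (?n p)^3"
      using pos[of p] by (intro divide_right_mono) auto
    also have "\<dots> = (norm v)\<^sup>2 / ?n p"
      using pos[of p] by (simp add: power2_eq_square power3_eq_cube field_simps)
    finally have b: "(p \<bullet> v)\<^sup>2 / (?n p)^3 \<le> (norm v)\<^sup>2 / ?n p" .
    have c: "0 \<le> (p \<bullet> v)\<^sup>2 / (?n p)^3" "0 \<le> (norm v)\<^sup>2 / ?n p"
      using pos[of p] by auto
    show ?thesis
      using a b c unfolding power2_norm_eq_inner[symmetric] by (simp add: abs_le_iff)
  qed
  show ?thesis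
    unfolding bounded_C2_def
  proof (intro conjI allI)
    show "\<exists>B. \<forall>p v. \<bar>(p \<bullet> v) / ?n p\<bar> \<le> B * norm v" using 3 by blast
    show "\<exists>B. \<forall>p v. \<bar>(v \<bullet> v) / ?n p - (p \<bullet> v)\<^sup>2 / (?n p)^3\<bar> \<le> B * (norm v)\<^sup>2" using 4 by blast
  qed (use 1 2 pos in \<open>auto intro!: continuous_intros cont simp: less_imp_neq[symmetric]\<close>)
qed

lemma smooth_norm_lipschitz: "\<bar>(p \<bullet> v) / smooth_norm \<epsilon> p\<bar> \<le> norm v"
  using smooth_norm_abs_inner[of p v] smooth_norm_ge[of p] \<epsilon>
  by (simp add: abs_divide pos_divide_le_eq mult.commute)

end

lemma C2_approximable_norm: "C2_approximable (norm :: 'a::euclidean_space \<Rightarrow> real)"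
  unfolding C2_approximable_def
proof (intro conjI allI impI)
  fix \<epsilon> :: real assume \<epsilon>: "0 < \<epsilon>"
  have "\<bar>smooth_norm \<epsilon> x - norm x\<bar> \<le> \<epsilon>" for x :: 'a
    using smooth_norm_ge_norm[OF \<epsilon>, of x] smooth_norm_le[OF \<epsilon>, of x] by linarith
  then show "\<exists>F D Q. bounded_C2 F D Q \<and> (\<forall>p v. \<bar>D p v\<bar> \<le> norm v) \<and> (\<forall>x::'a. \<bar>F x - norm x\<bar> \<le> \<epsilon>)"
    using smooth_norm_C2[OF \<epsilon>] smooth_norm_lipschitz[OF \<epsilon>] by blast
qed (auto intro!: continuous_intros exp_bounded_linear_growth[of _ 0 1])

lemma C2_approximable_minus:
  assumes "C2_approximable N"
  shows "C2_approximable (\<lambda>x. - N x)"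
  unfolding C2_approximable_def
proof (intro conjI allI impI)
  fix \<epsilon> :: real assume \<epsilon>: "0 < \<epsilon>"
  then obtain F D Q where F: "bounded_C2 F D Q" "\<And>p v. \<bar>D p v\<bar> \<le> norm v" "\<And>x. \<bar>F x - N x\<bar> \<le> \<epsilon>"
    using assms unfolding C2_approximable_def by metis
  have "\<bar>-1 * D p v\<bar> \<le> norm v" "\<bar>-1 * F x - - N x\<bar> \<le> \<epsilon>" for p v x
    using F(2)[of p v] F(3)[of x] by auto
  with C2_cmult[OF F(1), of "-1"]
  show "\<exists>F D Q. bounded_C2 F D Q \<and> (\<forall>p v. \<bar>D p v\<bar> \<le> norm v) \<and> (\<forall>x. \<bar>F x - - N x\<bar> \<le> \<epsilon>)"
    by blast
qed (use assms in \<open>auto simp: C2_approximable_def exp_bounded_def intro!: continuous_intros\<close>)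

lemma C2_approximable_inner:
  fixes u :: "'a::euclidean_space"
  assumes "norm u \<le> 1"
  shows "C2_approximable (\<lambda>x. x \<bullet> u)"
  unfolding C2_approximable_def
proof (intro conjI allI impI)
  fix \<epsilon> :: real assume \<epsilon>: "0 < \<epsilon>"
  have "linear (\<lambda>x. x \<bullet> u)"
    by (intro bounded_linear.linear bounded_linear_inner_left)
  moreover have "\<bar>v \<bullet> u\<bar> \<le> norm v" for v
    using Cauchy_Schwarz_ineq2[of v u] mult_left_mono[OF assms, of "norm v"] by simp
  moreover have "\<bar>x \<bullet> u - x \<bullet> u\<bar> \<le> \<epsilon>" for x
    using \<epsilon> by simp
  ultimately show "\<exists>F D Q. bounded_C2 F D Q \<and> (\<forall>p v. \<bar>D p v\<bar> \<le> norm v) \<and> (\<forall>x. \<bar>F x - x \<bullet> u\<bar> \<le> \<epsilon>)"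
    using C2_linear[of "\<lambda>x. x \<bullet> u"] by blast
qed (auto intro!: continuous_intros exp_bounded_inner)

section \<open>Mean norm and random matrices\<close>

text \<open>Integrates exp t + exp (- t) \<ge> 2 twice from 0. Its purpose is to extract a variance
  from the two-sided Laplace transform.\<close>

lemma exp_add_exp_minus_ge: "2 + x\<^sup>2 \<le> exp x + exp (- x)" for x :: real
proof -
  have nonneg: "2 + x\<^sup>2 \<le> exp x + exp (- x)" if "0 \<le> x" for x :: real
  proof -
    have 1: "0 \<le> exp y - exp (- y) - 2 * y" if "0 \<le> y" for y :: real
    proof -
      have "exp 0 - exp (- 0) - 2 * 0 \<le> exp y - exp (- y) - 2 * y"
      proof (rule DERIV_nonneg_imp_nondecreasing[OF that])
        fix t :: real
        have "((\<lambda>y. exp y - exp (- y) - 2 * y) has_real_derivative exp t + exp (- t) - 2) (at t)"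
          by (auto intro!: derivative_eq_intros)
        moreover have "0 \<le> exp t + exp (- t) - 2"
          using exp_ge_add_one_self[of t] exp_ge_add_one_self[of "- t"] by linarith
        ultimately show "\<exists>d. ((\<lambda>y. exp y - exp (- y) - 2 * y) has_real_derivative d) (at t) \<and> 0 \<le> d" by blast
      qed
      then show ?thesis by simp
    qed
    have "exp 0 + exp (- 0) - 2 - 0\<^sup>2 \<le> exp x + exp (- x) - 2 - x\<^sup>2"
    proof (rule DERIV_nonneg_imp_nondecreasing[OF that])
      fix t :: real assume "0 \<le> t"
      have "((\<lambda>y. exp y + exp (- y) - 2 - y\<^sup>2) has_real_derivative exp t - exp (- t) - 2 * t) (at t)"
        by (auto intro!: derivative_eq_intros)
      then show "\<exists>d. ((\<lambda>y. exp y + exp (- y) - 2 - y\<^sup>2) has_real_derivative d) (at t) \<and> 0 \<le> d"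
        using 1[OF \<open>0 \<le> t\<close>] by blast
    qed
    then show ?thesis by simp
  qed
  show ?thesis using nonneg[of x] nonneg[of "- x"] by (cases "0 \<le> x") auto
qed

text \<open>The Poincare inequality for 1-Lipschitz functions, read off from concentration: 2 + l^2
  Var F \<le> E exp (l (F - m)) + E exp (- l (F - m)) \<le> 2 exp (l^2 / 2), and then l tends to
  0.\<close>

lemma gauss_second_moment_le:
  fixes F :: "'a::euclidean_space \<Rightarrow> real"
  assumes F: "bounded_C2 F D Q" and D: "\<And>p v. \<bar>D p v\<bar> \<le> norm v"
  shows "(\<integral>x. (F x)\<^sup>2 \<partial>gauss) \<le> (\<integral>x. F x \<partial>gauss)\<^sup>2 + 1"
proof -
  define m where "m = (\<integral>x. F x \<partial>gauss)"
  have int: "integrable gauss F" "integrable gauss (\<lambda>x. (F x)\<^sup>2)"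
    unfolding power2_eq_square
    by (auto intro!: integrable_gauss exp_bounded_mult C2_exp_bounded[OF F] continuous_intros C2_continuous[OF F])
  have int2: "integrable gauss (\<lambda>x. (F x - m)\<^sup>2)"
    using int by (simp add: power2_diff)
  have var: "(\<integral>x. (F x - m)\<^sup>2 \<partial>gauss) = (\<integral>x. (F x)\<^sup>2 \<partial>gauss) - m\<^sup>2"
    using int by (simp add: power2_diff m_def[symmetric]) (simp add: power2_eq_square)
  have F': "bounded_C2 (\<lambda>x. -1 * F x) (\<lambda>p v. -1 * D p v) (\<lambda>p v. -1 * Q p v)" by (rule C2_cmult[OF F])
  have "(\<integral>x. (F x - m)\<^sup>2 \<partial>gauss) \<le> (exp u - exp 0) / (u - 0)" if u: "u \<in> {0<..<1}" for u
  proof -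
    \<comment> \<open>With l^2 / 2 = u the bound becomes a difference quotient of exp at 0, whose
      limit is 1.\<close>
    define l where "l = sqrt (2 * u)"
    have l: "0 \<le> l" "l\<^sup>2 = 2 * u" using u by (auto simp: l_def)
    have split: "exp (l * (F x - m)) = exp (l * F x) * exp (- (l * m))"
      "exp (- (l * (F x - m))) = exp (- l * F x) * exp (l * m)" for x
      by (simp_all add: mult_exp_exp algebra_simps)
    have i: "integrable gauss (\<lambda>x. exp (l * (F x - m)))" "integrable gauss (\<lambda>x. exp (- (l * (F x - m))))"
      unfolding split by (intro integrable_mult_left C2_integrable_exp[OF F])+
    have e: "(\<integral>x. exp (l * (F x - m)) \<partial>gauss) \<le> exp u"
    proof -
      have "(\<integral>x. exp (l * (F x - m)) \<partial>gauss) = (\<integral>x. exp (l * F x) \<partial>gauss) / exp (l * m)"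
        by (simp add: right_diff_distrib exp_diff)
      also have "\<dots> \<le> exp (l\<^sup>2 / 2 + l * m) / exp (l * m)"
        unfolding m_def by (intro divide_right_mono gauss_concentration[OF F D l(1)]) auto
      also have "\<dots> = exp u" by (simp add: exp_add l(2))
      finally show ?thesis .
    qed
    have e': "(\<integral>x. exp (- (l * (F x - m))) \<partial>gauss) \<le> exp u"
    proof -
      have "(\<integral>x. exp (- (l * (F x - m))) \<partial>gauss) = (\<integral>x. exp (l * (-1 * F x)) \<partial>gauss) * exp (l * m)"
        unfolding split by simp
      also have "\<dots> \<le> exp (l\<^sup>2 / 2 + l * (\<integral>x. -1 * F x \<partial>gauss)) * exp (l * m)"
        using D by (intro mult_right_mono gauss_concentration[OF F' _ l(1)]) auto
      also have "\<dots> = exp u"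
        by (simp add: mult_exp_exp l(2) m_def)
      finally show ?thesis .
    qed
    have "(\<integral>x. 2 + (2 * u) * (F x - m)\<^sup>2 \<partial>gauss) \<le> (\<integral>x. exp (l * (F x - m)) + exp (- (l * (F x - m))) \<partial>gauss)"
    proof (rule integral_mono)
      show "2 + 2 * u * (F x - m)\<^sup>2 \<le> exp (l * (F x - m)) + exp (- (l * (F x - m)))" for x
        using exp_add_exp_minus_ge[of "l * (F x - m)"] by (simp add: power_mult_distrib l(2))
    qed (use i int2 in auto)
    then have "2 + (2 * u) * (\<integral>x. (F x - m)\<^sup>2 \<partial>gauss) \<le> 2 * exp u"
      using i int2 e e' by simp
    then show ?thesis using u by (simp add: field_simps)
  qed
  then have "eventually (\<lambda>u. (\<integral>x. (F x - m)\<^sup>2 \<partial>gauss) \<le> (exp u - exp 0) / (u - 0)) (at_right (0::real))"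
    by (intro eventually_at_rightI[of 0 1]) auto
  moreover have "((\<lambda>u::real. (exp u - exp 0) / (u - 0)) \<longlongrightarrow> 1) (at_right 0)"
    using DERIV_exp[of "0::real"] has_field_derivative_iff[of exp 1 "0::real" UNIV]
    by (auto intro: tendsto_within_subset)
  ultimately have "(\<integral>x. (F x - m)\<^sup>2 \<partial>gauss) \<le> 1"
    by (intro tendsto_lowerbound[of _ 1 "at_right (0::real)"]) auto
  then show ?thesis using var by (simp add: m_def)
qed

lemma integral_gauss_inner_self: "(\<integral>x. x \<bullet> x \<partial>(gauss :: 'a::euclidean_space measure)) = DIM('a)"
proof -
  have "(\<integral>x. (x \<bullet> b) * (x \<bullet> b) \<partial>(gauss :: 'a measure)) = (\<integral>x. 1 \<partial>(gauss :: 'a measure))" if "b \<in> Basis" for b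
    using that
    by (intro gauss_integration_by_parts)
      (auto intro!: exp_bounded_inner exp_bounded_const continuous_intros derivative_eq_intros simp: inner_add_left)
  moreover have "integrable gauss (\<lambda>x::'a. (x \<bullet> b) * (x \<bullet> b))" for b
    by (intro integrable_gauss exp_bounded_mult exp_bounded_inner continuous_intros)
  ultimately show ?thesis
    by (subst euclidean_inner) simp
qed

lemma gaussian_mean_norm_eq: "gaussian_mean_norm TYPE('m::finite) = (\<integral>x. norm x \<partial>(gauss :: (real^'m) measure))"
  by (simp add: gaussian_mean_norm_def std_gaussian_vec_eq_gauss)

lemma integrable_gauss_norm: "integrable gauss (norm :: 'a::euclidean_space \<Rightarrow> real)"
  by (intro integrable_gauss continuous_intros exp_bounded_linear_growth[of norm 0 1]) auto

text \<open>The norm has second moment \<open>CARD('m)\<close> and variance at most 1. This links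
  the dimension condition for convergence to b.\<close>

lemma gaussian_mean_norm_square_ge: "real CARD('m) - 1 \<le> (gaussian_mean_norm TYPE('m::finite))\<^sup>2"
proof -
  define b where "b = gaussian_mean_norm TYPE('m)"
  have b0: "0 \<le> b" by (simp add: b_def gaussian_mean_norm_eq)
  have "real CARD('m) - 1 \<le> (b + \<epsilon>)\<^sup>2" if \<epsilon>: "0 < \<epsilon>" for \<epsilon>
  proof -
    let ?F = "smooth_norm \<epsilon> :: real^'m \<Rightarrow> real"
    have i: "integrable gauss (\<lambda>x::real^'m. x \<bullet> x)"
      by (intro integrable_gauss continuous_intros, subst euclidean_inner,
          intro exp_bounded_sum exp_bounded_mult exp_bounded_inner)
    have "\<epsilon>\<^sup>2 + real CARD('m) = (\<integral>x. (?F x)\<^sup>2 \<partial>gauss)"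
      using i by (simp add: smooth_norm_square[OF \<epsilon>] integral_gauss_inner_self)
    also have "\<dots> \<le> (\<integral>x. ?F x \<partial>gauss)\<^sup>2 + 1"
      by (rule gauss_second_moment_le[OF smooth_norm_C2[OF \<epsilon>] smooth_norm_lipschitz[OF \<epsilon>]])
    also have "(\<integral>x. ?F x \<partial>gauss)\<^sup>2 \<le> (b + \<epsilon>)\<^sup>2"
    proof (rule power_mono)
      have "(\<integral>x. ?F x \<partial>gauss) \<le> (\<integral>x. norm x + \<epsilon> \<partial>(gauss :: (real^'m) measure))"
        by (intro integral_mono C2_integrable[OF smooth_norm_C2[OF \<epsilon>]] Bochner_Integration.integrable_add
            integrable_gauss_norm smooth_norm_le \<epsilon>) auto
      then show "(\<integral>x. ?F x \<partial>gauss) \<le> b + \<epsilon>"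
        by (simp add: integrable_gauss_norm b_def gaussian_mean_norm_eq)
      show "0 \<le> (\<integral>x. ?F x \<partial>gauss)"
        by (intro integral_nonneg_AE AE_I2) (simp add: smooth_norm_def)
    qed
    finally show ?thesis by (smt (verit) zero_le_power2)
  qed
  then have "eventually (\<lambda>\<epsilon>. real CARD('m) - 1 \<le> (b + \<epsilon>)\<^sup>2) (at_right (0::real))"
    by (intro eventually_at_rightI[of 0 1]) auto
  moreover have "((\<lambda>\<epsilon>. (b + \<epsilon>)\<^sup>2) \<longlongrightarrow> (b + 0)\<^sup>2) (at_right 0)"
    by (intro tendsto_intros)
  ultimately have "real CARD('m) - 1 \<le> (b + 0)\<^sup>2"
    by (intro tendsto_lowerbound[of _ _ "at_right (0::real)"]) auto
  then show ?thesis by (simp add: b_def)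
qed

section \<open>Law of the random matrix and tail events on the probability space\<close>

lemma matrix_measurable:
  fixes A :: "'w \<Rightarrow> real^'n^'m"
  assumes "\<And>i j. (\<lambda>\<omega>. A \<omega> $ i $ j) \<in> borel_measurable M"
  shows "A \<in> borel_measurable M"
  using assms by (subst borel_measurable_euclidean_space) (auto simp: Basis_vec_def inner_axis)

text \<open>Open boxes are stable under intersection and generate the Borel sets. On a box,
  independence factors the probability over the entries, and Fubini factors the Gaussian integral in
  the same way.\<close>

lemma distr_matrix_eq_gauss:
  fixes A :: "'w \<Rightarrow> real^'n^'m"
  assumes M: "prob_space M"
    and indep: "prob_space.indep_vars M (\<lambda>_. borel) (\<lambda>(i, j) \<omega>. A \<omega> $ i $ j) UNIV"
    and distr: "\<And>i j. distributed M lborel (\<lambda>\<omega>. A \<omega> $ i $ j) std_normal_density"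
  shows "distr M borel A = gauss"
proof -
  interpret prob_space M by fact
  have meas: "A \<in> borel_measurable M"
    using distr[THEN distributed_measurable] by (intro matrix_measurable) simp
  define E where "E p = (axis (fst p) (axis (snd p) 1) :: real^'n^'m)" for p :: "'m \<times> 'n"
  have B: "(Basis :: (real^'n^'m) set) = E ` UNIV"
    by (auto simp: E_def Basis_vec_def image_iff; blast)
  have inj: "inj E" by (auto simp: E_def inj_on_def axis_eq_axis prod_eq_iff)
  have inner: "x \<bullet> E p = x $ fst p $ snd p" for x p by (simp add: E_def inner_axis)
  have box: "emeasure (distr M borel A) (box l u) = emeasure gauss (box l u)" for l u
  proof -
    define I where "I p = {l \<bullet> E p <..< u \<bullet> E p}" for p
    define J where "J p = (\<integral>\<^sup>+t. ennreal (std_normal_density t) * indicator (I p) t \<partial>lborel)" for p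
    have "emeasure (distr M borel A) (box l u) = emeasure M (A -` box l u \<inter> space M)"
      by (simp add: emeasure_distr meas)
    also have "A -` box l u \<inter> space M = (\<Inter>p\<in>UNIV. (\<lambda>(i, j) \<omega>. A \<omega> $ i $ j) p -` I p \<inter> space M)"
      by (auto simp: box_def B I_def inner case_prod_beta)
    also have "emeasure M \<dots> = ennreal (\<Prod>p\<in>UNIV. prob ((\<lambda>(i, j) \<omega>. A \<omega> $ i $ j) p -` I p \<inter> space M))"
      unfolding emeasure_eq_measure
      by (subst indep_varsD_finite[OF indep]) (auto simp: I_def)
    also have "\<dots> = (\<Prod>p\<in>UNIV. J p)"
    proof (subst prod_ennreal[symmetric], simp, rule prod.cong[OF refl])
      fix p :: "'m \<times> 'n"
      have "emeasure M ((\<lambda>\<omega>. A \<omega> $ fst p $ snd p) -` I p \<inter> space M) = J p"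
        unfolding J_def by (rule distributed_emeasure[OF distr]) (simp add: I_def)
      then show "ennreal (prob ((case p of (i, j) \<Rightarrow> \<lambda>\<omega>. A \<omega> $ i $ j) -` I p \<inter> space M)) = J p"
        by (simp add: emeasure_eq_measure case_prod_beta)
    qed
    also have "\<dots> = (\<Prod>b\<in>(Basis :: (real^'n^'m) set). \<integral>\<^sup>+t. ennreal (std_normal_density t) * indicator {l \<bullet> b <..< u \<bullet> b} t \<partial>lborel)"
      unfolding B by (subst prod.reindex[OF inj]) (simp add: J_def I_def)
    also have "\<dots> = (\<integral>\<^sup>+x. (\<Prod>b\<in>Basis. ennreal (std_normal_density (x \<bullet> b)) * indicator {l \<bullet> b <..< u \<bullet> b} (x \<bullet> b)) \<partial>(lborel :: (real^'n^'m) measure))"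
      by (rule nn_integral_lborel_prod[symmetric]) auto
    also have "\<dots> = (\<integral>\<^sup>+x. ennreal (gauss_density x) * indicator (box l u) x \<partial>(lborel :: (real^'n^'m) measure))"
    proof (rule nn_integral_cong)
      fix x :: "real^'n^'m"
      have "(\<Prod>b\<in>Basis. indicator {l \<bullet> b <..< u \<bullet> b} (x \<bullet> b)) = (indicator (box l u) x :: ennreal)"
        by (auto simp: box_def split: split_indicator)
      then show "(\<Prod>b\<in>Basis. ennreal (std_normal_density (x \<bullet> b)) * indicator {l \<bullet> b <..< u \<bullet> b} (x \<bullet> b))
          = ennreal (gauss_density x) * indicator (box l u) x"
        by (simp add: prod.distrib prod_ennreal gauss_density_eq_prod)
    qed
    also have "\<dots> = emeasure gauss (box l u)"
      unfolding gauss_def by (subst emeasure_density) auto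
    finally show ?thesis .
  qed
  show ?thesis
  proof (rule measure_eqI_generator_eq)
    let ?E = "range (\<lambda>(a, b). box a b :: (real^'n^'m) set)"
    show "Int_stable ?E" by (auto simp: Int_stable_def box_Int_box)
    show "?E \<subseteq> Pow UNIV" "sets (distr M borel A) = sigma_sets UNIV ?E" "sets gauss = sigma_sets UNIV ?E"
      by (simp_all add: borel_eq_box)
    let ?A = "\<lambda>n::nat. box (- (real n *\<^sub>R One)) (real n *\<^sub>R One) :: (real^'n^'m) set"
    show "range ?A \<subseteq> ?E" "(\<Union>i. ?A i) = UNIV"
      unfolding UN_box_eq_UNIV by auto
    show "emeasure (distr M borel A) (?A i) \<noteq> \<infinity>" for i by (simp add: box)
    show "emeasure (distr M borel A) X = emeasure gauss X" if "X \<in> ?E" for X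
      using that box by auto
  qed
qed

lemma random_matrix_tail:
  fixes A :: "'w \<Rightarrow> real^'n^'m" and K :: "(real^'n) set"
  assumes M: "prob_space M" and meas: "A \<in> borel_measurable M" and law: "distr M borel A = gauss"
    and N: "C2_approximable N"
    and K: "K \<subseteq> sphere 0 1" and Z: "countable Z" "Z \<subseteq> K" and \<eta>: "0 < \<eta>"
  defines "bad \<equiv> {\<omega>\<in>space M. \<exists>z\<in>Z. (\<integral>g. N g \<partial>gauss) + gaussian_mean_width K + \<eta> < N (A \<omega> *v z)}"
  shows "bad \<in> sets M" "measure M bad \<le> exp (- \<eta>\<^sup>2 / 2)"
proof -
  let ?B = "{A::real^'n^'m. \<exists>z\<in>Z. (\<integral>g. N g \<partial>gauss) + gaussian_mean_width K + \<eta> < N (A *v z)}"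
  have B: "?B \<in> sets borel"
    using N by (intro sets_matrix_tail) (simp add: C2_approximable_def)
  have eq: "bad = A -` ?B \<inter> space M" by (auto simp: bad_def)
  show "bad \<in> sets M"
    unfolding eq using meas B by (rule measurable_sets)
  have "measure M bad = measure (distr M borel A) ?B"
    unfolding eq using meas B by (subst measure_distr) auto
  also have "\<dots> \<le> exp (- \<eta>\<^sup>2 / 2)"
    unfolding law by (rule gauss_matrix_tail[OF N K Z \<eta>])
  finally show "measure M bad \<le> exp (- \<eta>\<^sup>2 / 2)" .
qed

text \<open>Turns independence of the generated sigma-algebras into a product law, the form in which
  Fubini applies.\<close>

lemma indep_set_imp_distr_pair:
  assumes M: "prob_space M" and X: "X \<in> measurable M S" and Y: "Y \<in> measurable M T"
    and indep: "prob_space.indep_set M (sets (vimage_algebra (space M) X S)) (sets (vimage_algebra (space M) Y T))"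
  shows "distr M (S \<Otimes>\<^sub>M T) (\<lambda>\<omega>. (X \<omega>, Y \<omega>)) = distr M S X \<Otimes>\<^sub>M distr M T Y"
proof (rule pair_measure_eqI[symmetric])
  interpret prob_space M by fact
  interpret X: prob_space "distr M S X" by (rule prob_space_distr) (rule X)
  interpret Y: prob_space "distr M T Y" by (rule prob_space_distr) (rule Y)
  show "sigma_finite_measure (distr M S X)" "sigma_finite_measure (distr M T Y)" ..
  show "sets (distr M S X \<Otimes>\<^sub>M distr M T Y) = sets (distr M (S \<Otimes>\<^sub>M T) (\<lambda>\<omega>. (X \<omega>, Y \<omega>)))"
    by (simp cong: sets_pair_measure_cong)
  fix a b assume ab: "a \<in> sets (distr M S X)" "b \<in> sets (distr M T Y)"
  have "prob ((X -` a \<inter> space M) \<inter> (Y -` b \<inter> space M)) = prob (X -` a \<inter> space M) * prob (Y -` b \<inter> space M)"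
    using ab by (intro indep_setD[OF indep] in_vimage_algebra) auto
  moreover have "(\<lambda>\<omega>. (X \<omega>, Y \<omega>)) -` (a \<times> b) \<inter> space M = (X -` a \<inter> space M) \<inter> (Y -` b \<inter> space M)" by auto
  moreover have "(\<lambda>\<omega>. (X \<omega>, Y \<omega>)) \<in> measurable M (S \<Otimes>\<^sub>M T)" using X Y by simp
  ultimately show "emeasure (distr M S X) a * emeasure (distr M T Y) b
      = emeasure (distr M (S \<Otimes>\<^sub>M T) (\<lambda>\<omega>. (X \<omega>, Y \<omega>))) (a \<times> b)"
    using ab X Y by (simp add: emeasure_distr emeasure_eq_measure ennreal_mult)
qed

text \<open>Conditioning on the noise: for fixed u \<noteq> 0 the event is a tail event of the
  linear functional given by u / norm u, which has mean 0, and its bound does not depend on u. The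
  joint law is a product, so these slices can be integrated over the law of e.\<close>

lemma random_noise_tail:
  fixes A :: "'w \<Rightarrow> real^'n^'m" and e :: "'w \<Rightarrow> real^'m" and K :: "(real^'n) set"
  assumes M: "prob_space M" and law: "distr M borel A = gauss"
    and meas: "A \<in> borel_measurable M" "e \<in> borel_measurable M"
    and indep: "prob_space.indep_set M (sets (vimage_algebra (space M) A borel))
      (sets (vimage_algebra (space M) e borel))"
    and K: "K \<subseteq> sphere 0 1" and Z: "countable Z" "Z \<subseteq> K" and \<eta>: "0 < \<eta>"
  defines "bad \<equiv> {\<omega>\<in>space M. \<exists>z\<in>Z. (gaussian_mean_width K + \<eta>) * norm (e \<omega>) < (A \<omega> *v z) \<bullet> e \<omega>}"
  shows "bad \<in> sets M" "measure M bad \<le> exp (- \<eta>\<^sup>2 / 2)"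
proof -
  interpret prob_space M by fact
  interpret e: prob_space "distr M borel e" by (rule prob_space_distr) (rule meas)
  interpret P: pair_sigma_finite "gauss :: (real^'n^'m) measure" "distr M borel e" ..
  let ?B = "{(A::real^'n^'m, u). \<exists>z\<in>Z. (gaussian_mean_width K + \<eta>) * norm u < (A *v z) \<bullet> u}"
  have "open {p::(real^'n^'m) \<times> (real^'m). (gaussian_mean_width K + \<eta>) * norm (snd p) < (fst p *v z) \<bullet> snd p}" for z
  proof (rule open_Collect_less)
    have "continuous_on UNIV (\<lambda>A::real^'n^'m. A *v z)"
      using linear_matrix_apply linear_conv_bounded_linear linear_continuous_on by blast
    then have "continuous_on UNIV (\<lambda>p::(real^'n^'m) \<times> (real^'m). fst p *v z)"
      by (rule continuous_on_compose2) (auto intro!: continuous_intros)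
    then show "continuous_on UNIV (\<lambda>p::(real^'n^'m) \<times> (real^'m). (fst p *v z) \<bullet> snd p)"
      by (intro continuous_intros)
  qed (intro continuous_intros)
  moreover have "?B = (\<Union>z\<in>Z. {p. (gaussian_mean_width K + \<eta>) * norm (snd p) < (fst p *v z) \<bullet> snd p})" by auto
  ultimately have "open ?B" by (simp add: open_UN)
  then have "?B \<in> sets borel" by (rule borel_open)
  then have B: "?B \<in> sets (borel \<Otimes>\<^sub>M borel)" by (simp only: borel_prod)
  have eq: "bad = (\<lambda>\<omega>. (A \<omega>, e \<omega>)) -` ?B \<inter> space M" by (auto simp: bad_def)
  have pair: "(\<lambda>\<omega>. (A \<omega>, e \<omega>)) \<in> measurable M (borel \<Otimes>\<^sub>M borel)" using meas by simp
  show "bad \<in> sets M" unfolding eq by (rule measurable_sets[OF pair B])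
  \<comment> \<open>For u = 0 the slice is empty, because the defining inequality is strict.\<close>
  have slice: "emeasure gauss ((\<lambda>A. (A, u)) -` ?B) \<le> ennreal (exp (- \<eta>\<^sup>2 / 2))" for u :: "real^'m"
  proof (cases "u = 0")
    case False
    define v where "v = u /\<^sub>R norm u"
    have v: "norm v \<le> 1" "u = norm u *\<^sub>R v" using False by (auto simp: v_def)
    have pos: "0 < norm u" using False by simp
    have "(gaussian_mean_width K + \<eta>) * norm u < (A *v z) \<bullet> u \<longleftrightarrow> gaussian_mean_width K + \<eta> < (A *v z) \<bullet> v"
      for A :: "real^'n^'m" and z
    proof -
      have "(A *v z) \<bullet> u = ((A *v z) \<bullet> v) * norm u" by (subst v(2)) simp
      then show ?thesis using pos by simp
    qed
    then have "(\<lambda>A. (A, u)) -` ?B = {A. \<exists>z\<in>Z. (\<integral>g. g \<bullet> v \<partial>gauss) + gaussian_mean_width K + \<eta> < (A *v z) \<bullet> v}"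
      by (simp add: integral_gauss_inner)
    then show ?thesis
      using gauss_matrix_tail[OF C2_approximable_inner[OF v(1)] K Z \<eta>]
      by (simp add: gauss.emeasure_eq_measure)
  qed simp
  have "emeasure M bad = emeasure (distr M (borel \<Otimes>\<^sub>M borel) (\<lambda>\<omega>. (A \<omega>, e \<omega>))) ?B"
    unfolding eq by (rule emeasure_distr[OF pair B, symmetric])
  also have "distr M (borel \<Otimes>\<^sub>M borel) (\<lambda>\<omega>. (A \<omega>, e \<omega>)) = gauss \<Otimes>\<^sub>M distr M borel e"
    using indep_set_imp_distr_pair[OF M meas indep] by (simp add: law)
  also have "emeasure (gauss \<Otimes>\<^sub>M distr M borel e) ?B = (\<integral>\<^sup>+u. emeasure gauss ((\<lambda>A. (A, u)) -` ?B) \<partial>distr M borel e)"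
    by (rule P.emeasure_pair_measure_alt2) (use B in \<open>simp cong: sets_pair_measure_cong\<close>)
  also have "\<dots> \<le> (\<integral>\<^sup>+u. ennreal (exp (- \<eta>\<^sup>2 / 2)) \<partial>distr M borel e)"
    by (rule nn_integral_mono) (rule slice)
  also have "\<dots> = ennreal (exp (- \<eta>\<^sup>2 / 2))" using e.emeasure_space_1 by simp
  finally show "measure M bad \<le> exp (- \<eta>\<^sup>2 / 2)" by (simp add: emeasure_eq_measure)
qed

section \<open>Deterministic analysis of the algorithm\<close>

context
  fixes V :: "'a::euclidean_space set"
  assumes V: "subspace V"
begin

text \<open>Justifies the definite description: two candidates differ by a vector of V that is
  orthogonal to itself.\<close>

lemma orth_proj_props:
  "orth_proj V x \<in> V \<and> (\<forall>v\<in>V. orthogonal (x - orth_proj V x) v)"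
  unfolding orth_proj_def
proof (rule theI')
  obtain y z where yz: "y \<in> span V" "\<And>w. w \<in> span V \<Longrightarrow> orthogonal z w" "x = y + z"
    using orthogonal_subspace_decomp_exists[of V x] by metis
  have span: "span V = V" using V by (rule span_eq_iff[THEN iffD2])
  show "\<exists>!p. p \<in> V \<and> (\<forall>v\<in>V. orthogonal (x - p) v)"
  proof (rule ex1I[of _ y])
    fix p assume p: "p \<in> V \<and> (\<forall>v\<in>V. orthogonal (x - p) v)"
    have d: "p - y \<in> V" using p yz(1) span V by (auto intro: subspace_diff)
    have "(x - p) \<bullet> (p - y) = 0" using p d by (auto simp: orthogonal_def)
    moreover have "(x - y) \<bullet> (p - y) = 0" using yz d span by (auto simp: orthogonal_def)
    ultimately have "(p - y) \<bullet> (p - y) = 0" by (simp add: algebra_simps)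
    then show "p = y" by simp
  qed (use yz span in auto)
qed

lemma orth_proj_in: "orth_proj V x \<in> V"
  and orth_proj_orthogonal: "v \<in> V \<Longrightarrow> (x - orth_proj V x) \<bullet> v = 0"
  using orth_proj_props by (auto simp: orthogonal_def)

lemma orth_proj_pythagoras:
  assumes "v \<in> V"
  shows "(norm (x - v))\<^sup>2 = (norm (x - orth_proj V x))\<^sup>2 + (norm (orth_proj V x - v))\<^sup>2"
proof -
  have "(x - orth_proj V x) \<bullet> (orth_proj V x - v) = 0"
    using assms by (intro orth_proj_orthogonal subspace_diff V orth_proj_in)
  then have "(norm ((x - orth_proj V x) + (orth_proj V x - v)))\<^sup>2
      = (norm (x - orth_proj V x))\<^sup>2 + (norm (orth_proj V x - v))\<^sup>2"
    by (intro norm_add_Pythagorean) (simp add: orthogonal_def)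
  then show ?thesis by simp
qed

lemma orth_proj_closest: "v \<in> V \<Longrightarrow> norm (x - orth_proj V x) \<le> norm (x - v)"
  using orth_proj_pythagoras[of v x] by (simp add: power2_le_imp_le)

end

section \<open>Sums of subspaces of the family\<close>

lemma subspace_set_plus: "subspace V \<Longrightarrow> subspace W \<Longrightarrow> subspace (V + W)"
  using subspace_sums[of V W] unfolding set_plus_def
  by (rule back_subst[of subspace]) auto

lemma subspace_set_plus_self: "subspace V \<Longrightarrow> V + V = V"
  unfolding set_plus_def using subspace_0 by (force intro: subspace_add)

lemma subset_set_plus1: "subspace W \<Longrightarrow> V \<subseteq> V + W"
  unfolding set_plus_def using subspace_0 by force

lemma subset_set_plus2: "subspace V \<Longrightarrow> W \<subseteq> V + W"
  unfolding set_plus_def using subspace_0 by force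

lemma subspace_sums_0: "subspace_sums 0 S = {0}"
  by (auto simp: subspace_sums_def)

lemma subspace_sums_Suc: "subspace_sums (Suc B) S = {U + W | U W. U \<in> subspace_sums B S \<and> W \<in> S}"
proof safe
  fix X assume "X \<in> subspace_sums (Suc B) S"
  then obtain V where "X = (\<Sum>i<Suc B. V i)" "\<forall>i<Suc B. V i \<in> S" by (auto simp: subspace_sums_def)
  then show "\<exists>U W. X = U + W \<and> U \<in> subspace_sums B S \<and> W \<in> S"
    by (intro exI[of _ "\<Sum>i<B. V i"] exI[of _ "V B"]) (auto simp: subspace_sums_def)
next
  fix U W assume "U \<in> subspace_sums B S" and W: "W \<in> S"
  then obtain V where V: "U = (\<Sum>i<B. V i)" "\<forall>i<B. V i \<in> S" by (auto simp: subspace_sums_def)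
  then have "U + W = (\<Sum>i<Suc B. (V(B := W)) i)" by simp
  moreover have "\<forall>i<Suc B. (V(B := W)) i \<in> S" using V W by auto
  ultimately show "U + W \<in> subspace_sums (Suc B) S" unfolding subspace_sums_def by blast
qed

lemma subspace_sums_1: "subspace_sums 1 S = S"
proof -
  have "{0} + W = W" for W :: "'a set" by (simp flip: set_zero)
  then show ?thesis by (auto simp: subspace_sums_Suc subspace_sums_0)
qed

lemma subspace_sums_add:
  "V \<in> subspace_sums a S \<Longrightarrow> W \<in> subspace_sums b S \<Longrightarrow> V + W \<in> subspace_sums (a + b) S"
proof (induction b arbitrary: W)
  case (Suc b)
  then obtain U W' where "W = U + W'" "U \<in> subspace_sums b S" "W' \<in> S"
    by (auto simp: subspace_sums_Suc)
  with Suc show ?case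
    by (auto simp: subspace_sums_Suc add.assoc[symmetric])
qed (simp add: subspace_sums_0)

lemma subspace_subspace_sums:
  assumes "\<forall>V\<in>S. subspace V"
  shows "V \<in> subspace_sums B S \<Longrightarrow> subspace V"
proof (induction B arbitrary: V)
  case 0
  then show ?case by (simp add: subspace_sums_0 set_zero)
next
  case (Suc B)
  then show ?case using assms by (auto simp: subspace_sums_Suc intro: subspace_set_plus)
qed

text \<open>Repeating a summand changes nothing, as W + W = W. This pads the first iteration, where
  the current subspace {0} need not belong to S. An empty sum has no summand to repeat, hence 1
  \<le> a.\<close>

lemma subspace_sums_mono:
  assumes S: "\<forall>V\<in>S. subspace V" and "1 \<le> a" "a \<le> b"
  shows "subspace_sums a S \<subseteq> subspace_sums b S"
  using \<open>a \<le> b\<close>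
proof (induction b rule: dec_induct)
  case (step b)
  have "V \<in> subspace_sums (Suc b) S" if V: "V \<in> subspace_sums b S" for V
  proof -
    obtain c where c: "b = Suc c" using step assms by (cases b) auto
    then obtain U W where "V = U + W" "U \<in> subspace_sums c S" "W \<in> S"
      using V by (auto simp: subspace_sums_Suc)
    then have "V = V + W" using S by (simp add: add.assoc subspace_set_plus_self)
    then show ?thesis using V \<open>W \<in> S\<close> by (auto simp: subspace_sums_Suc)
  qed
  with step show ?case by auto
qed simp

lemma union_sums_scale:
  assumes "\<forall>V\<in>S. subspace V" "v \<in> union_sums B S"
  shows "c *\<^sub>R v \<in> union_sums B S"
  using assms subspace_subspace_sums[OF assms(1)] unfolding union_sums_def by (blast intro: subspace_scale)

lemma error_quadratic:
  fixes \<rho> k h p q :: real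
  assumes \<rho>: "0 \<le> \<rho>" "\<rho> < 1" and k: "0 \<le> k" and h: "0 \<le> h" and p: "0 \<le> p" and q: "0 \<le> q"
    and pyth: "h\<^sup>2 = p\<^sup>2 + q\<^sup>2" and qle: "q \<le> \<rho> * h + k"
  shows "h \<le> p / sqrt (1 - \<rho>\<^sup>2) + k / (1 - \<rho>)"
proof -
  define c where "c = k / (1 - \<rho>)"
  define s where "s = sqrt (1 - \<rho>\<^sup>2)"
  have \<rho>2: "\<rho>\<^sup>2 < 1" using \<rho> by (simp add: abs_square_less_1)
  then have s: "0 < s" "s\<^sup>2 = 1 - \<rho>\<^sup>2" by (auto simp: s_def)
  have c: "0 \<le> c" "k = (1 - \<rho>) * c" using \<rho> k by (auto simp: c_def)
  show ?thesis
  proof (cases "h \<le> c")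
    case True
    then show ?thesis using p s by (simp add: c_def s_def add_increasing)
  next
    case False
    define d where "d = h - c"
    have d: "0 < d" "h = d + c" using False by (auto simp: d_def)
    have "h\<^sup>2 \<le> p\<^sup>2 + (\<rho> * h + k)\<^sup>2"
      using pyth power_mono[OF qle q, of 2] by simp
    then have "(1 - \<rho>\<^sup>2) * d\<^sup>2 + 2 * (1 - \<rho>) * (d * c) \<le> p\<^sup>2"
      unfolding c(2) d(2) by (simp add: power2_eq_square algebra_simps)
    moreover have "0 \<le> 2 * (1 - \<rho>) * (d * c)" using \<rho> d c by simp
    ultimately have "(s * d)\<^sup>2 \<le> p\<^sup>2" by (simp add: power_mult_distrib s(2))
    then have "s * d \<le> p" using p by (rule power2_le_imp_le)
    then have "d \<le> p / s" using s by (simp add: pos_le_divide_eq mult.commute)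
    then show ?thesis using d by (simp add: c_def s_def)
  qed
qed

section \<open>Error of one iteration under the restricted estimates\<close>

context
  fixes A :: "real^'n^'m" and S :: "(real^'n) set set" and e :: "real^'m"
    and l L s3 s4 :: real
  assumes S: "\<forall>V\<in>S. subspace V"
    and lL: "0 < l" "l < L" and s34: "0 \<le> s3" "0 \<le> s4"
    and lower: "\<And>v. v \<in> union_sums 4 S \<Longrightarrow> l * norm v \<le> norm (A *v v)"
    and upper: "\<And>v. v \<in> union_sums 4 S \<Longrightarrow> norm (A *v v) \<le> L * norm v"
    and noise3: "\<And>v. v \<in> union_sums 3 S \<Longrightarrow> (A *v v) \<bullet> e \<le> s3 * norm v * norm e"
    and noise4: "\<And>v. v \<in> union_sums 4 S \<Longrightarrow> (A *v v) \<bullet> e \<le> s4 * norm v * norm e"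
begin

text \<open>The constants l, L, s3, s4 stand for b - w4 - \<eta>, b + w4 + \<eta>, w3 + \<eta>, w4 +
  \<eta>, so that \<open>1 - \<mu> * l\<^sup>2\<close> is \<open>rho_param\<close>.\<close>

lemma rho_bounds:
  assumes "0 < \<mu>" "\<mu> \<le> 1 / L\<^sup>2"
  shows "0 < 1 - \<mu> * l\<^sup>2" "1 - \<mu> * l\<^sup>2 < 1" "\<mu> * L\<^sup>2 \<le> 1"
proof -
  show 1: "\<mu> * L\<^sup>2 \<le> 1" using assms lL by (simp add: pos_le_divide_eq)
  have "\<mu> * l\<^sup>2 < \<mu> * L\<^sup>2" using assms lL by (intro mult_strict_left_mono power_strict_mono) auto
  with 1 show "0 < 1 - \<mu> * l\<^sup>2" by simp
  show "1 - \<mu> * l\<^sup>2 < 1" using assms lL by simp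
qed

text \<open>The form \<open>u \<bullet> v - \<mu> * (A u \<bullet> A v)\<close> is positive semidefinite on each subspace of the family, so polarization
  bounds it by its values on the diagonal.\<close>

lemma restricted_identity:
  assumes \<mu>: "0 < \<mu>" "\<mu> \<le> 1 / L\<^sup>2" and F: "F \<in> subspace_sums 4 S" and uv: "u \<in> F" "v \<in> F"
  shows "u \<bullet> v - \<mu> * ((A *v u) \<bullet> (A *v v)) \<le> (1 - \<mu> * l\<^sup>2) * norm u * norm v"
proof -
  have subF: "subspace F" by (rule subspace_subspace_sums[OF S F])
  define q where "q v = v \<bullet> v - \<mu> * ((A *v v) \<bullet> (A *v v))" for v
  have q: "0 \<le> q v" "q v \<le> (1 - \<mu> * l\<^sup>2) * (v \<bullet> v)" if "v \<in> F" for v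
  proof -
    have vU: "v \<in> union_sums 4 S" using that F by (auto simp: union_sums_def)
    have "(l * norm v)\<^sup>2 \<le> (norm (A *v v))\<^sup>2" "(norm (A *v v))\<^sup>2 \<le> (L * norm v)\<^sup>2"
      using lower[OF vU] upper[OF vU] lL by (auto intro!: power_mono)
    then have "\<mu> * (l\<^sup>2 * (v \<bullet> v)) \<le> \<mu> * ((A *v v) \<bullet> (A *v v))" "\<mu> * ((A *v v) \<bullet> (A *v v)) \<le> \<mu> * (L\<^sup>2 * (v \<bullet> v))"
      using \<mu> by (auto simp: power_mult_distrib power2_norm_eq_inner)
    moreover have "\<mu> * L\<^sup>2 * (v \<bullet> v) \<le> 1 * (v \<bullet> v)"
      using rho_bounds(3)[OF \<mu>] by (intro mult_right_mono) auto
    ultimately show "0 \<le> q v" "q v \<le> (1 - \<mu> * l\<^sup>2) * (v \<bullet> v)"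
      by (auto simp: q_def algebra_simps)
  qed
  have unit: "a \<bullet> c - \<mu> * ((A *v a) \<bullet> (A *v c)) \<le> 1 - \<mu> * l\<^sup>2"
    if "a \<in> F" "c \<in> F" "norm a = 1" "norm c = 1" for a c
  proof -
    \<comment> \<open>The nonnegative q (a - c) is dropped, and the 4 is matched by
      \<open>norm (a + c) \<le> 2\<close>.\<close>
    have "4 * (a \<bullet> c - \<mu> * ((A *v a) \<bullet> (A *v c))) = q (a + c) - q (a - c)"
      by (simp add: q_def matrix_vector_right_distrib matrix_vector_mult_diff_distrib inner_add inner_diff
          inner_commute algebra_simps)
    also have "\<dots> \<le> (1 - \<mu> * l\<^sup>2) * ((a + c) \<bullet> (a + c))"
      using q(1)[OF subspace_diff[OF subF that(1,2)]] q(2)[OF subspace_add[OF subF that(1,2)]] by linarith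
    also have "(a + c) \<bullet> (a + c) = (norm (a + c))\<^sup>2" by (simp add: power2_norm_eq_inner)
    also have "(1 - \<mu> * l\<^sup>2) * (norm (a + c))\<^sup>2 \<le> (1 - \<mu> * l\<^sup>2) * 2\<^sup>2"
      using norm_triangle_ineq[of a c] that rho_bounds(1)[OF \<mu>]
      by (intro mult_left_mono power_mono) auto
    finally show ?thesis by simp
  qed
  show ?thesis
  proof (cases "u = 0 \<or> v = 0")
    case False
    define a c where "a = u /\<^sub>R norm u" and "c = v /\<^sub>R norm v"
    have ac: "a \<in> F" "c \<in> F" "norm a = 1" "norm c = 1"
      using False uv subF by (auto simp: a_def c_def subspace_scale)
    have eq: "u = norm u *\<^sub>R a" "v = norm v *\<^sub>R c" using False by (auto simp: a_def c_def)
    have "u \<bullet> v - \<mu> * ((A *v u) \<bullet> (A *v v)) = (norm u * norm v) * (a \<bullet> c - \<mu> * ((A *v a) \<bullet> (A *v c)))"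
      by (subst eq(1), subst (2) eq(1), subst eq(2), subst (2) eq(2)) (simp add: matrix_vector_mult_scaleR algebra_simps)
    also have "\<dots> \<le> (norm u * norm v) * (1 - \<mu> * l\<^sup>2)"
      using unit[OF ac] by (intro mult_left_mono) auto
    finally show ?thesis by (simp add: mult_ac)
  qed auto
qed

text \<open>Three estimates are chained. In \<open>p_le\<close> the selected W brings V + W near x;
  in \<open>h_le\<close> least squares on V + W adds an error controlled by
  \<open>error_quadratic\<close>; finally V' is at least as good as V0 for approximating z, which
  doubles the error.\<close>

lemma gcosamp_step_error:
  assumes \<mu>1: "0 < \<mu>1" "\<mu>1 \<le> 1 / L\<^sup>2" and \<mu>2: "0 < \<mu>2" "\<mu>2 \<le> 1 / L\<^sup>2"
    and V0: "V0 \<in> S" "x \<in> V0" and V: "V \<in> insert {0} S" "xp \<in> V"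
    and step: "gcosamp_step A (A *v x + e) S xp V x' V'"
  shows "V' \<in> S" "x' \<in> V'"
    "norm (x' - x) \<le> error_coeff (1 - \<mu>1 * l\<^sup>2) (1 - \<mu>2 * l\<^sup>2) * norm (xp - x)
        + noise_coeff (1 - \<mu>1 * l\<^sup>2) (\<mu>1 * s3) (\<mu>2 * s4) * norm e"
proof -
  define y where "y = A *v x + e"
  define v where "v = transpose A *v (y - A *v xp)"
  obtain W z where W: "is_arg_min (\<lambda>U. norm (v - orth_proj U v)) (\<lambda>U. U \<in> subspace_sums 2 S) W"
    and z: "is_arg_min (\<lambda>u. norm (y - A *v u)) (\<lambda>u. u \<in> V + W) z"
    and V': "is_arg_min (\<lambda>U. norm (z - orth_proj U z)) (\<lambda>U. U \<in> S) V'"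
    and x': "x' = orth_proj V' z"
    using step unfolding gcosamp_step_def Let_def y_def v_def by blast
  have WS: "W \<in> subspace_sums 2 S" using W by (simp add: is_arg_min_def)
  show V'S: "V' \<in> S" using V' by (simp add: is_arg_min_def)
  have sub: "subspace V0" "subspace V" "subspace W" "subspace V'"
    using S V0 V V'S subspace_subspace_sums[OF S WS] by auto
  show "x' \<in> V'" unfolding x' by (rule orth_proj_in[OF sub(4)])
  \<comment> \<open>Contains x - xp and is a sum of two members of S, padded if V = {0}, so it
    competes with W in the selection.\<close>
  define D where "D = V + V0"
  have V01: "V0 \<in> subspace_sums 1 S" using V0 by (simp only: subspace_sums_1)
  have DS: "D \<in> subspace_sums 2 S"
  proof (cases "V = {0}")
    case True
    then have "D = V0" by (simp add: D_def flip: set_zero)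
    then show ?thesis using subspace_sums_mono[OF S, of 1 2] V01 by auto
  next
    case False
    then have "V \<in> subspace_sums 1 S" using V(1) unfolding subspace_sums_1 by simp
    from subspace_sums_add[OF this V01] show ?thesis by (simp add: D_def numeral_2_eq_2)
  qed
  have VW: "V + W \<in> subspace_sums 3 S"
  proof (cases "V = {0}")
    case True
    then have "V + W = W" by (simp flip: set_zero)
    then show ?thesis using subspace_sums_mono[OF S, of 2 3] WS by auto
  next
    case False
    then have "V \<in> subspace_sums 1 S" using V(1) unfolding subspace_sums_1 by simp
    from subspace_sums_add[OF this WS] show ?thesis by (simp add: numeral_3_eq_3 numeral_2_eq_2)
  qed
  have subD: "subspace D" and subVW: "subspace (V + W)"
    using sub by (auto simp: D_def intro: subspace_set_plus)
  \<comment> \<open>The vector v need not lie in a sum of four subspaces, so the comparison takes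
    place inside F, with v replaced by its projection \<open>pF\<close>.\<close>
  define F where "F = D + W"
  have FS: "F \<in> subspace_sums 4 S" unfolding F_def using subspace_sums_add[OF DS WS] by simp
  have subF: "subspace F" by (rule subspace_subspace_sums[OF S FS])
  have DF: "D \<subseteq> F" and WF: "W \<subseteq> F"
    unfolding F_def by (rule subset_set_plus1[OF sub(3)], rule subset_set_plus2[OF subD])
  define d where "d = x - xp"
  have dD: "d \<in> D"
    unfolding d_def D_def using subset_set_plus1[OF sub(1), of V] subset_set_plus2[OF sub(2), of V0] V0 V
    by (intro subspace_diff subD[unfolded D_def]) auto
  define pF pW where "pF = orth_proj F v" and "pW = orth_proj W v"
  have pF: "pF \<in> F" and pW: "pW \<in> W"
    unfolding pF_def pW_def by (rule orth_proj_in[OF subF], rule orth_proj_in[OF sub(3)])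
  have v_inner: "v \<bullet> u = (A *v d + e) \<bullet> (A *v u)" for u
    by (simp add: v_def y_def d_def dot_lmul_matrix[symmetric] transpose_matrix_vector
        matrix_vector_mult_diff_distrib algebra_simps)
  \<comment> \<open>Without noise, v is d multiplied by A and then by its transpose, which by
    \<open>restricted_identity\<close> acts roughly like division by \<mu>2. This suggests the
    competitor d / \<mu>2, which D contains along with d.\<close>
  define c where "c = d /\<^sub>R \<mu>2"
  have cD: "c \<in> D" unfolding c_def by (intro subspace_scale subD dD)
  have "norm (v - pW) \<le> norm (v - orth_proj D v)"
    using W DS by (auto simp: is_arg_min_def pW_def not_less)
  also have "\<dots> \<le> norm (v - c)" by (rule orth_proj_closest[OF subD cD])
  finally have "(norm (v - pW))\<^sup>2 \<le> (norm (v - c))\<^sup>2" by (intro power_mono) auto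
  moreover have "pW \<in> F" "c \<in> F" using pW WF cD DF by auto
  \<comment> \<open>Both points lie in F, so Pythagoras removes the common distance of v from
    F.\<close>
  ultimately have "(norm (pF - pW))\<^sup>2 \<le> (norm (pF - c))\<^sup>2"
    using orth_proj_pythagoras[OF subF, of pW v] orth_proj_pythagoras[OF subF, of c v]
    unfolding pF_def by linarith
  then have sel: "norm (pF - pW) \<le> norm (pF - c)" by (rule power2_le_imp_le) simp
  \<comment> \<open>The error of a gradient step with projected gradient. As g lies in F, its inner
    products with \<open>pF\<close> and v agree, which brings in the restricted identity for g and
    d.\<close>
  define g where "g = d - \<mu>2 *\<^sub>R pF"
  have gF: "g \<in> F" unfolding g_def using dD DF pF by (intro subspace_diff subspace_scale subF) auto
  have g_le: "norm g \<le> (1 - \<mu>2 * l\<^sup>2) * norm d + \<mu>2 * s4 * norm e"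
  proof -
    have "(v - pF) \<bullet> g = 0" unfolding pF_def by (rule orth_proj_orthogonal[OF subF gF])
    then have "g \<bullet> pF = g \<bullet> v" by (simp add: inner_diff inner_commute)
    then have "(norm g)\<^sup>2 = g \<bullet> d - \<mu>2 * (g \<bullet> v)"
      unfolding power2_norm_eq_inner by (subst (2) g_def) (simp add: inner_diff_right)
    also have "\<dots> = (g \<bullet> d - \<mu>2 * ((A *v g) \<bullet> (A *v d))) + \<mu>2 * ((A *v (- g)) \<bullet> e)"
    proof -
      have "g \<bullet> v = (A *v g) \<bullet> (A *v d) + (A *v g) \<bullet> e"
        unfolding inner_commute[of g v] v_inner by (simp add: inner_add inner_commute)
      moreover have "(A *v (- g)) \<bullet> e = - ((A *v g) \<bullet> e)"
        by (simp add: linear_neg[OF matrix_vector_mul_linear])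
      ultimately show ?thesis by (simp add: distrib_left)
    qed
    also have "\<dots> \<le> (1 - \<mu>2 * l\<^sup>2) * norm g * norm d + \<mu>2 * (s4 * norm (- g) * norm e)"
    proof (intro add_mono mult_left_mono)
      show "g \<bullet> d - \<mu>2 * ((A *v g) \<bullet> (A *v d)) \<le> (1 - \<mu>2 * l\<^sup>2) * norm g * norm d"
        using restricted_identity[OF \<mu>2 FS gF] dD DF by blast
      have "- g \<in> union_sums 4 S" using subspace_neg[OF subF gF] FS by (auto simp: union_sums_def)
      then show "(A *v (- g)) \<bullet> e \<le> s4 * norm (- g) * norm e" by (rule noise4)
    qed (use \<mu>2 in auto)
    finally have "norm g * norm g \<le> norm g * ((1 - \<mu>2 * l\<^sup>2) * norm d + \<mu>2 * s4 * norm e)"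
      by (simp add: power2_eq_square algebra_simps)
    then show ?thesis
      using rho_bounds[OF \<mu>2] s34 \<mu>2 by (cases "g = 0") auto
  qed
  \<comment> \<open>Replacing \<open>pF\<close> by \<open>pW\<close> costs \<mu>2 norm (pF - pW),
    which the selection bounds by norm g; hence the factor 2.\<close>
  have dW: "norm (d - \<mu>2 *\<^sub>R pW) \<le> 2 * norm g"
  proof -
    have "norm (d - \<mu>2 *\<^sub>R pW) = norm (g + \<mu>2 *\<^sub>R (pF - pW))"
      by (simp add: g_def algebra_simps)
    also have "\<dots> \<le> norm g + \<mu>2 * norm (pF - pW)"
      using norm_triangle_ineq[of g "\<mu>2 *\<^sub>R (pF - pW)"] \<mu>2 by simp
    also have "\<dots> \<le> norm g + \<mu>2 * norm (pF - c)"
      using sel \<mu>2 by simp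
    also have "\<mu>2 * norm (pF - c) = norm (\<mu>2 *\<^sub>R (pF - c))" using \<mu>2 by simp
    also have "\<mu>2 *\<^sub>R (pF - c) = - g" using \<mu>2 by (simp add: g_def c_def scaleR_diff_right)
    finally show ?thesis by simp
  qed
  define xP where "xP = orth_proj (V + W) x"
  have xP: "xP \<in> V + W" unfolding xP_def by (rule orth_proj_in[OF subVW])
  have p_le: "norm (x - xP) \<le> 2 * ((1 - \<mu>2 * l\<^sup>2) * norm d + \<mu>2 * s4 * norm e)"
  proof -
    \<comment> \<open>The gradient step from xp along \<open>pW\<close> stays in V + W, so it bounds
      the distance of x from that space.\<close>
    have "xp + \<mu>2 *\<^sub>R pW \<in> V + W"
      using V pW subspace_scale[OF sub(3) pW] by (auto simp: set_plus_def)
    from orth_proj_closest[OF subVW this, of x]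
    have "norm (x - xP) \<le> norm (d - \<mu>2 *\<^sub>R pW)" by (simp add: xP_def d_def algebra_simps)
    also note dW
    also have "2 * norm g \<le> 2 * ((1 - \<mu>2 * l\<^sup>2) * norm d + \<mu>2 * s4 * norm e)"
      using g_le by (rule mult_left_mono) simp
    finally show ?thesis .
  qed
  have zVW: "z \<in> V + W" using z by (simp add: is_arg_min_def)
  \<comment> \<open>The normal equations: by minimality, A z is the orthogonal projection of y onto
    the image of V + W.\<close>
  have ls: "(y - A *v z) \<bullet> (A *v u) = 0" if u: "u \<in> V + W" for u
  proof -
    define R where "R = (*v) A ` (V + W)"
    have subR: "subspace R"
      unfolding R_def by (rule linear_subspace_image[OF matrix_vector_mul_linear subVW])
    define q where "q = orth_proj R y"
    have "q \<in> R" unfolding q_def by (rule orth_proj_in[OF subR])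
    then have "norm (y - A *v z) \<le> norm (y - q)"
      using z by (auto simp: is_arg_min_def R_def not_less)
    then have "(norm (y - A *v z))\<^sup>2 \<le> (norm (y - q))\<^sup>2" by (intro power_mono) auto
    then have "(norm (q - A *v z))\<^sup>2 \<le> 0"
      using orth_proj_pythagoras[OF subR, of "A *v z" y] zVW by (simp add: q_def R_def)
    then have "q = A *v z" by simp
    then show ?thesis
      using orth_proj_orthogonal[OF subR, of "A *v u" y] u by (simp add: q_def R_def)
  qed
  define h where "h = z - x"
  define p where "p = z - xP"
  have pVW: "p \<in> V + W" unfolding p_def by (intro subspace_diff subVW zVW xP)
  have orth: "(x - xP) \<bullet> p = 0" unfolding xP_def by (rule orth_proj_orthogonal[OF subVW pVW])
  have pyth: "(norm h)\<^sup>2 = (norm (x - xP))\<^sup>2 + (norm p)\<^sup>2"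
  proof -
    have "(norm (p' - a))\<^sup>2 = (norm a)\<^sup>2 + (norm p')\<^sup>2" if "a \<bullet> p' = 0" for a p' :: "real^'n"
      using that by (simp add: power2_norm_eq_inner inner_diff inner_commute)
    from this[OF orth] show ?thesis by (simp add: h_def p_def)
  qed
  \<comment> \<open>The second sum of four subspaces, this one containing the error z - x.\<close>
  define G where "G = V0 + (V + W)"
  have GS: "G \<in> subspace_sums 4 S" unfolding G_def using subspace_sums_add[OF V01 VW] by simp
  have subG: "subspace G" by (rule subspace_subspace_sums[OF S GS])
  have VWG: "V + W \<subseteq> G" and V0G: "V0 \<subseteq> G"
    unfolding G_def by (rule subset_set_plus2[OF sub(1)], rule subset_set_plus1[OF subVW])
  have hG: "h \<in> G" unfolding h_def using zVW VWG V0 V0G by (intro subspace_diff subG) auto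
  \<comment> \<open>The vector p is the part of the error inside V + W. The normal equations turn
    the inner product of A h and A p into the noise tested on p, which lies in a sum of three
    subspaces; this is the origin of w3.\<close>
  have q_le: "norm p \<le> (1 - \<mu>1 * l\<^sup>2) * norm h + \<mu>1 * s3 * norm e"
  proof -
    have hp: "h \<bullet> p = (norm p)\<^sup>2"
    proof -
      have "h = p - (x - xP)" by (simp add: h_def p_def)
      then show ?thesis using orth by (simp add: inner_diff_left power2_norm_eq_inner)
    qed
    have "y - A *v z = e - A *v h" by (simp add: y_def h_def matrix_vector_mult_diff_distrib)
    then have Ahp: "(A *v h) \<bullet> (A *v p) = (A *v p) \<bullet> e"
      using ls[OF pVW] by (simp add: inner_diff inner_commute)
    have "(norm p)\<^sup>2 = (h \<bullet> p - \<mu>1 * ((A *v h) \<bullet> (A *v p))) + \<mu>1 * ((A *v p) \<bullet> e)"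
      by (simp add: hp Ahp)
    also have "\<dots> \<le> (1 - \<mu>1 * l\<^sup>2) * norm h * norm p + \<mu>1 * (s3 * norm p * norm e)"
    proof (intro add_mono mult_left_mono)
      show "h \<bullet> p - \<mu>1 * ((A *v h) \<bullet> (A *v p)) \<le> (1 - \<mu>1 * l\<^sup>2) * norm h * norm p"
        using restricted_identity[OF \<mu>1 GS hG] pVW VWG by blast
      show "(A *v p) \<bullet> e \<le> s3 * norm p * norm e"
        using pVW VW by (intro noise3) (auto simp: union_sums_def)
    qed (use \<mu>1 in auto)
    finally have "norm p * norm p \<le> norm p * ((1 - \<mu>1 * l\<^sup>2) * norm h + \<mu>1 * s3 * norm e)"
      by (simp add: power2_eq_square algebra_simps)
    then show ?thesis
      using rho_bounds[OF \<mu>1] s34 \<mu>1 by (cases "p = 0") auto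
  qed
  let ?\<rho>1 = "1 - \<mu>1 * l\<^sup>2" and ?\<rho>2 = "1 - \<mu>2 * l\<^sup>2"
  have h_le: "norm h \<le> norm (x - xP) / sqrt (1 - ?\<rho>1\<^sup>2) + \<mu>1 * s3 * norm e / (1 - ?\<rho>1)"
    using rho_bounds[OF \<mu>1] s34 \<mu>1 by (intro error_quadratic[OF _ _ _ _ _ _ pyth q_le]) auto
  have sq: "0 < sqrt (1 - ?\<rho>1\<^sup>2)"
    using rho_bounds[OF \<mu>1] by (simp add: abs_square_less_1)
  \<comment> \<open>V0 competes with V' and contains x, so x' is no farther from z than x
    is.\<close>
  have "norm (z - x') \<le> norm (z - orth_proj V0 z)"
    using V' V0 by (auto simp: is_arg_min_def x' not_less)
  also have "\<dots> \<le> norm (z - x)" by (rule orth_proj_closest[OF sub(1) V0(2)])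
  finally have "norm (x' - x) \<le> 2 * norm h"
    using norm_triangle_ineq[of "x' - z" "z - x"] by (simp add: h_def norm_minus_commute)
  also have "\<dots> \<le> 2 * (2 * (?\<rho>2 * norm d + \<mu>2 * s4 * norm e) / sqrt (1 - ?\<rho>1\<^sup>2) + \<mu>1 * s3 * norm e / (1 - ?\<rho>1))"
    using sq by (intro mult_left_mono order_trans[OF h_le add_right_mono[OF divide_right_mono[OF p_le]]]) auto
  also have "\<dots> = error_coeff ?\<rho>1 ?\<rho>2 * norm (xp - x) + noise_coeff ?\<rho>1 (\<mu>1 * s3) (\<mu>2 * s4) * norm e"
  proof -
    have "2 * (2 * (r2 * a + k2 * f) / q + k1 * f / r) = 4 * r2 / q * a + (4 * k2 / q + 2 * k1 / r) * f"
      for r2 a k2 f q k1 r :: real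
      by (simp add: add_divide_distrib distrib_left distrib_right)
    then show ?thesis
      unfolding error_coeff_def noise_coeff_def d_def norm_minus_commute[of x xp] .
  qed
  finally show "norm (x' - x) \<le> error_coeff ?\<rho>1 ?\<rho>2 * norm (xp - x)
      + noise_coeff ?\<rho>1 (\<mu>1 * s3) (\<mu>2 * s4) * norm e" .
qed

lemma gcosamp_run_error:
  assumes \<mu>1: "0 < \<mu>1" "\<mu>1 \<le> 1 / L\<^sup>2" and \<mu>2: "0 < \<mu>2" "\<mu>2 \<le> 1 / L\<^sup>2"
    and x: "x \<in> union_sums 1 S" and run: "gcosamp_run A (A *v x + e) S T X" and t: "t < T"
  shows "norm (X (Suc t) - x) \<le> error_coeff (1 - \<mu>1 * l\<^sup>2) (1 - \<mu>2 * l\<^sup>2) * norm (X t - x)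
        + noise_coeff (1 - \<mu>1 * l\<^sup>2) (\<mu>1 * s3) (\<mu>2 * s4) * norm e"
proof -
  obtain V0 where V0: "V0 \<in> S" "x \<in> V0"
    using x unfolding union_sums_def subspace_sums_1 by blast
  obtain V where V: "X 0 = 0" "V 0 = {0}"
    "\<And>t. t < T \<Longrightarrow> gcosamp_step A (A *v x + e) S (X t) (V t) (X (Suc t)) (V (Suc t))"
    using run unfolding gcosamp_run_def by blast
  \<comment> \<open>The invariant needed by \<open>gcosamp_step_error\<close>; the value {0} covers
    the start.\<close>
  have "t < T \<Longrightarrow> V t \<in> insert {0} S \<and> X t \<in> V t" for t
  proof (induction t)
    case (Suc t)
    then show ?case
      using gcosamp_step_error(1,2)[OF \<mu>1 \<mu>2 V0 _ _ V(3)[of t]] by auto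
  qed (use V in auto)
  with t have "V t \<in> insert {0} S" "X t \<in> V t" by auto
  from gcosamp_step_error(3)[OF \<mu>1 \<mu>2 V0 this V(3)[OF t]] show ?thesis .
qed

text \<open>\<open>\<gamma> / (1 - \<kappa>)\<close> is the sum of the geometric series of noise
  contributions, and norm x is the initial error because X 0 = 0.\<close>

lemma gcosamp_run_geometric:
  assumes \<mu>1: "0 < \<mu>1" "\<mu>1 \<le> 1 / L\<^sup>2" and \<mu>2: "0 < \<mu>2" "\<mu>2 \<le> 1 / L\<^sup>2"
    and x: "x \<in> union_sums 1 S" and run: "gcosamp_run A (A *v x + e) S T X"
    and \<kappa>: "\<kappa> = error_coeff (1 - \<mu>1 * l\<^sup>2) (1 - \<mu>2 * l\<^sup>2)" "0 \<le> \<kappa>" "\<kappa> < 1"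
    and \<gamma>: "\<gamma> = noise_coeff (1 - \<mu>1 * l\<^sup>2) (\<mu>1 * s3) (\<mu>2 * s4)"
  shows "t \<le> T \<Longrightarrow> norm (X t - x) \<le> \<kappa> ^ t * norm x + \<gamma> / (1 - \<kappa>) * norm e"
proof (induction t)
  case 0
  have "X 0 = 0" using run by (auto simp: gcosamp_run_def)
  moreover have "0 \<le> \<gamma>"
    unfolding \<gamma> noise_coeff_def using \<mu>1 \<mu>2 s34 rho_bounds[OF \<mu>1]
    by (intro add_nonneg_nonneg divide_nonneg_nonneg) (auto simp: abs_square_le_1)
  ultimately show ?case using \<kappa> by simp
next
  case (Suc t)
  have "norm (X (Suc t) - x) \<le> \<kappa> * norm (X t - x) + \<gamma> * norm e"
    using gcosamp_run_error[OF \<mu>1 \<mu>2 x run] Suc unfolding \<kappa>(1) \<gamma> by simp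
  also have "\<dots> \<le> \<kappa> * (\<kappa> ^ t * norm x + \<gamma> / (1 - \<kappa>) * norm e) + \<gamma> * norm e"
    using Suc \<kappa> by (intro add_right_mono mult_left_mono) auto
  also have "\<dots> = \<kappa> ^ Suc t * norm x + \<gamma> / (1 - \<kappa>) * norm e"
    using \<kappa> by (simp add: field_simps)
  finally show ?case .
qed

end

text \<open>With both parameters equal to \<rho> \<ge> 0, contraction means 4 \<rho> < sqrt (1 -
  \<rho>^2), that is, \<rho> < 1 / sqrt 17. For \<rho> = 1 - ((b - s) / (b + s))^2 this asks for b /
  s above roughly 14.42, rounded up to 14.5.\<close>

lemma error_coeff_less_1:
  fixes b s :: real
  assumes s: "0 < s" and b: "14.5 * s < b"
  defines "\<rho> \<equiv> 1 - 1 / (b + s)\<^sup>2 * (b - s)\<^sup>2"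
  shows "0 \<le> error_coeff \<rho> \<rho>" "error_coeff \<rho> \<rho> < 1"
proof -
  define t where "t = (b - s) / (b + s)"
  have \<rho>: "\<rho> = 1 - t\<^sup>2" by (simp add: \<rho>_def t_def power_divide)
  \<comment> \<open>27 / 31 = (14.5 - 1) / (14.5 + 1), and 232 / 961 = 1 - (27 / 31)^2 lies just
    below 1 / sqrt 17.\<close>
  have t: "27 / 31 < t" "t < 1" using s b by (auto simp: t_def pos_less_divide_eq)
  then have t2: "(27 / 31)\<^sup>2 < t\<^sup>2" "t\<^sup>2 < 1"
    by (auto intro!: power_strict_mono simp: abs_square_less_1)
  then have \<rho>01: "0 \<le> \<rho>" "\<rho> < 232 / 961" by (auto simp: \<rho> power2_eq_square)
  then have "\<rho>\<^sup>2 < (232 / 961)\<^sup>2" by (intro power_strict_mono) auto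
  then have \<rho>2: "16 * \<rho>\<^sup>2 < 1 - \<rho>\<^sup>2" "0 < 1 - \<rho>\<^sup>2" by (auto simp: power2_eq_square)
  show "0 \<le> error_coeff \<rho> \<rho>" using \<rho>01 \<rho>2 by (simp add: error_coeff_def)
  have "4 * \<rho> < sqrt (1 - \<rho>\<^sup>2)"
    using \<rho>2 by (intro real_less_rsqrt) (simp add: power_mult_distrib)
  then show "error_coeff \<rho> \<rho> < 1" using \<rho>2 by (simp add: error_coeff_def)
qed

section \<open>The convergence theorem\<close>

text \<open>The tail events control only a countable dense part of the sphere, for which the
  probability bound is available; continuity recovers the rest of the sphere and homogeneity all of
  U.\<close>

lemma homogeneous_le_0_from_sphere:
  fixes f :: "'a::euclidean_space \<Rightarrow> real"
  assumes cont: "continuous_on UNIV f" and homog: "\<And>c v. 0 \<le> c \<Longrightarrow> f (c *\<^sub>R v) = c * f v"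
    and Z: "U \<inter> sphere 0 1 \<subseteq> closure Z" "\<And>z. z \<in> Z \<Longrightarrow> f z \<le> 0"
    and U: "\<And>c v. v \<in> U \<Longrightarrow> c *\<^sub>R v \<in> U" and v: "v \<in> U"
  shows "f v \<le> 0"
proof (cases "v = 0")
  case True
  then show ?thesis using homog[of 0 v] by simp
next
  case False
  have "closed {z. f z \<le> 0}"
    by (rule closed_Collect_le[OF cont continuous_on_const])
  then have "closure Z \<subseteq> {z. f z \<le> 0}"
    using Z(2) by (intro closure_minimal) auto
  moreover have "v /\<^sub>R norm v \<in> U \<inter> sphere 0 1"
    using U[OF v] False by simp
  ultimately have "f (v /\<^sub>R norm v) \<le> 0" using Z(1) by blast
  moreover have "f v = norm v * f (v /\<^sub>R norm v)"
    using homog[of "norm v" "v /\<^sub>R norm v"] False by simp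
  ultimately show ?thesis by (simp add: mult_nonneg_nonpos)
qed

text \<open>The event E constructed in the proof depends on neither \<mu>1 nor \<mu>2, which belong
  to the analysis and not to the algorithm. Convergence can therefore be stated on the same event
  with parameters \<open>\<nu>1\<close>, \<open>\<nu>2\<close> of its own. The condition
  \<open>w4 + \<eta> < b\<close> makes the lower restricted bound positive.\<close>

theorem theorem1:
  fixes M :: "'w measure"
    and S :: "(real^'n) set set"
    and A :: "'w \<Rightarrow> real^'n^'m"
    and e :: "'w \<Rightarrow> real^'m"
    and x :: "real^'n"
    and \<eta> \<mu>1 \<mu>2 b w3 w4 :: real
  assumes "prob_space M"
    and "CARD('m) < CARD('n)"
    and "\<forall>V\<in>S. subspace V"
    and "x \<in> union_sums 1 S"
    and "prob_space.indep_vars M (\<lambda>_. borel) (\<lambda>(i, j) \<omega>. A \<omega> $ i $ j) UNIV"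
    and "\<forall>i j. distributed M lborel (\<lambda>\<omega>. A \<omega> $ i $ j) std_normal_density"
    and "e \<in> borel_measurable M"
    and "prob_space.indep_set M (sets (vimage_algebra (space M) A borel))
           (sets (vimage_algebra (space M) e borel))"
    and "\<exists>C. \<forall>\<omega>\<in>space M. norm (e \<omega>) \<le> C"
    and b: "b = gaussian_mean_norm TYPE('m)"
    and w3: "w3 = gaussian_mean_width (union_sums 3 S \<inter> sphere 0 1)"
    and w4: "w4 = gaussian_mean_width (union_sums 4 S \<inter> sphere 0 1)"
    and "0 < \<eta>" "0 < \<mu>1" "0 < \<mu>2"
    and "\<mu>1 \<le> 1 / (b + w4 + \<eta>)\<^sup>2"
    and "\<mu>2 \<le> 1 / (b + w4 + \<eta>)\<^sup>2"
    and "w4 + \<eta> < b"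
  shows "\<exists>E\<in>sets M. measure M E \<ge> 1 - 6 * exp (- \<eta>\<^sup>2 / 2) \<and>
    (\<forall>\<omega>\<in>E. \<forall>T X. gcosamp_run (A \<omega>) (A \<omega> *v x + e \<omega>) S T X \<longrightarrow>
      (\<forall>t\<in>{1..T}. norm (X t - x)
         \<le> error_coeff (rho_param b w4 \<eta> \<mu>1) (rho_param b w4 \<eta> \<mu>2) * norm (X (t - 1) - x)
          + noise_coeff (rho_param b w4 \<eta> \<mu>1) (xi_param w3 \<eta> \<mu>1) (xi_param w4 \<eta> \<mu>2)
              * norm (e \<omega>))) \<and>
    (real CARD('m) > 14.5\<^sup>2 * (w4 + \<eta>)\<^sup>2 + 1 \<longrightarrow>
      (\<exists>\<nu>1 \<nu>2 \<kappa> \<gamma>. 0 < \<nu>1 \<and> \<nu>1 \<le> 1 / (b + w4 + \<eta>)\<^sup>2 \<and> 0 < \<nu>2 \<and> \<nu>2 \<le> 1 / (b + w4 + \<eta>)\<^sup>2 \<and>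
        \<kappa> = error_coeff (rho_param b w4 \<eta> \<nu>1) (rho_param b w4 \<eta> \<nu>2) \<and>
        \<gamma> = noise_coeff (rho_param b w4 \<eta> \<nu>1) (xi_param w3 \<eta> \<nu>1) (xi_param w4 \<eta> \<nu>2) \<and>
        0 \<le> \<kappa> \<and> \<kappa> < 1 \<and>
        (\<forall>\<omega>\<in>E. \<forall>T X. gcosamp_run (A \<omega>) (A \<omega> *v x + e \<omega>) S T X \<longrightarrow>
          (\<forall>t\<le>T. norm (X t - x) \<le> \<kappa> ^ t * norm x + \<gamma> / (1 - \<kappa>) * norm (e \<omega>)))) \<and>
      (\<forall>\<omega>\<in>E. \<forall>X. (\<forall>T. gcosamp_run (A \<omega>) (A \<omega> *v x + e \<omega>) S T X) \<and> e \<omega> = 0 \<longrightarrow>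
          X \<longlonglongrightarrow> x))"
proof -
  interpret prob_space M by fact
  note S = assms(3) and x = assms(4) and \<eta> = \<open>0 < \<eta>\<close> and less = \<open>w4 + \<eta> < b\<close>
  have measA: "A \<in> borel_measurable M"
    using assms(6)[rule_format, THEN distributed_measurable] by (intro matrix_measurable) simp
  have law: "distr M borel A = gauss"
    by (rule distr_matrix_eq_gauss[OF assms(1,5)]) (use assms(6) in blast)
  define K where "K B = union_sums B S \<inter> sphere 0 1" for B
  have Ksph: "K B \<subseteq> sphere 0 1" for B by (simp add: K_def)
  have w: "w3 = gaussian_mean_width (K 3)" "w4 = gaussian_mean_width (K 4)"
    by (simp_all add: w3 w4 K_def)
  have w_nonneg: "0 \<le> w3" "0 \<le> w4"
    unfolding w by (intro gaussian_mean_width_nonneg Ksph)+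
  have b': "b = (\<integral>g. norm g \<partial>(gauss :: (real^'m) measure))" by (simp add: b gaussian_mean_norm_eq)
  obtain Z where Z: "\<And>B. countable (Z B)" "\<And>B. Z B \<subseteq> K B" "\<And>B. K B \<subseteq> closure (Z B)"
  proof -
    have "\<exists>T. countable T \<and> T \<subseteq> K B \<and> K B \<subseteq> closure T" for B
      by (rule separable[of "K B"]) blast
    then show ?thesis using that by metis
  qed
  define up where "up = {\<omega>\<in>space M. \<exists>z\<in>Z 4. b + w4 + \<eta> < norm (A \<omega> *v z)}"
  define lo where "lo = {\<omega>\<in>space M. \<exists>z\<in>Z 4. - b + w4 + \<eta> < - norm (A \<omega> *v z)}"
  define noise where "noise B s = {\<omega>\<in>space M. \<exists>z\<in>Z B. s * norm (e \<omega>) < (A \<omega> *v z) \<bullet> e \<omega>}" for B s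
  have up: "up \<in> sets M" "prob up \<le> exp (- \<eta>\<^sup>2 / 2)"
    using random_matrix_tail[OF assms(1) measA law C2_approximable_norm Ksph Z(1,2) \<eta>, of 4]
    by (simp_all add: up_def b' w(2))
  have lo: "lo \<in> sets M" "prob lo \<le> exp (- \<eta>\<^sup>2 / 2)"
    using random_matrix_tail[OF assms(1) measA law C2_approximable_minus[OF C2_approximable_norm] Ksph Z(1,2) \<eta>, of 4]
    by (simp_all add: lo_def b' w(2))
  have noise: "noise B (gaussian_mean_width (K B) + \<eta>) \<in> sets M"
    "prob (noise B (gaussian_mean_width (K B) + \<eta>)) \<le> exp (- \<eta>\<^sup>2 / 2)" for B
    unfolding noise_def
    using random_noise_tail[OF assms(1) law measA assms(7,8) Ksph Z(1,2) \<eta>, of B] by simp_all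
  note noise3 = noise[of 3, folded w] and noise4 = noise[of 4, folded w]
  define E where "E = space M - (up \<union> lo \<union> noise 3 (w3 + \<eta>) \<union> noise 4 (w4 + \<eta>))"
  have E: "E \<in> sets M" using up lo noise3 noise4 by (auto simp: E_def)
  have "prob (up \<union> lo \<union> noise 3 (w3 + \<eta>) \<union> noise 4 (w4 + \<eta>))
      \<le> prob up + prob lo + prob (noise 3 (w3 + \<eta>)) + prob (noise 4 (w4 + \<eta>))"
    using up lo noise3 noise4
    by (intro order_trans[OF measure_Un_le] add_mono order_refl) auto
  \<comment> \<open>Four exceptional events, one exponential each, within the 6 of the
    claim.\<close>
  also have "\<dots> \<le> 4 * exp (- \<eta>\<^sup>2 / 2)" using up(2) lo(2) noise3(2) noise4(2) by simp
  also have "\<dots> \<le> 6 * exp (- \<eta>\<^sup>2 / 2)" by simp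
  finally have prob_E: "1 - 6 * exp (- \<eta>\<^sup>2 / 2) \<le> prob E"
    using up lo noise3 noise4 unfolding E_def by (subst prob_compl) auto
  define l where "l = b - w4 - \<eta>"
  define L where "L = b + w4 + \<eta>"
  have lL: "0 < l" "l < L" using less w_nonneg \<eta> by (auto simp: l_def L_def)
  have s34: "0 \<le> w3 + \<eta>" "0 \<le> w4 + \<eta>" using w_nonneg \<eta> by auto
  have scale: "c *\<^sub>R v \<in> union_sums B S" if "v \<in> union_sums B S" for c v B
    using union_sums_scale[OF S that] .
  have contA: "continuous_on UNIV (\<lambda>v. A \<omega> *v v)" for \<omega>
    using matrix_vector_mul_linear linear_conv_bounded_linear linear_continuous_on by blast
  have nZ: "norm z = 1" if "z \<in> Z B" for z B using Z(2)[of B] Ksph[of B] that by auto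
  have dense: "union_sums B S \<inter> sphere 0 1 \<subseteq> closure (Z B)" for B using Z(3)[of B] by (simp add: K_def)
  have upper: "norm (A \<omega> *v v) \<le> L * norm v" if \<omega>: "\<omega> \<in> E" and v: "v \<in> union_sums 4 S" for \<omega> v
  proof -
    have "norm (A \<omega> *v v) - L * norm v \<le> 0"
    proof (rule homogeneous_le_0_from_sphere[OF _ _ dense _ scale v])
      fix z assume "z \<in> Z 4"
      then show "norm (A \<omega> *v z) - L * norm z \<le> 0"
        using \<omega> nZ by (auto simp: E_def up_def L_def not_less)
    qed (auto intro!: continuous_intros contA simp: matrix_vector_mult_scaleR algebra_simps)
    then show ?thesis by simp
  qed
  have lower: "l * norm v \<le> norm (A \<omega> *v v)" if \<omega>: "\<omega> \<in> E" and v: "v \<in> union_sums 4 S" for \<omega> v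
  proof -
    have "l * norm v - norm (A \<omega> *v v) \<le> 0"
    proof (rule homogeneous_le_0_from_sphere[OF _ _ dense _ scale v])
      fix z assume "z \<in> Z 4"
      then show "l * norm z - norm (A \<omega> *v z) \<le> 0"
        using \<omega> nZ by (force simp: E_def lo_def l_def not_less)
    qed (auto intro!: continuous_intros contA simp: matrix_vector_mult_scaleR algebra_simps)
    then show ?thesis by simp
  qed
  have noise_le: "(A \<omega> *v v) \<bullet> e \<omega> \<le> s * norm v * norm (e \<omega>)"
    if \<omega>: "\<omega> \<in> space M" "\<omega> \<notin> noise B s" and v: "v \<in> union_sums B S" for \<omega> v B s
  proof -
    have "(A \<omega> *v v) \<bullet> e \<omega> - s * norm v * norm (e \<omega>) \<le> 0"
    proof (rule homogeneous_le_0_from_sphere[OF _ _ dense _ scale v])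
      fix z assume "z \<in> Z B"
      then show "(A \<omega> *v z) \<bullet> e \<omega> - s * norm z * norm (e \<omega>) \<le> 0"
        using \<omega> nZ by (auto simp: noise_def not_less)
    qed (auto intro!: continuous_intros contA simp: matrix_vector_mult_scaleR algebra_simps)
    then show ?thesis by simp
  qed
  have n3: "(A \<omega> *v v) \<bullet> e \<omega> \<le> (w3 + \<eta>) * norm v * norm (e \<omega>)" if "\<omega> \<in> E" "v \<in> union_sums 3 S" for \<omega> v
    using that by (intro noise_le[of _ 3]) (auto simp: E_def)
  have n4: "(A \<omega> *v v) \<bullet> e \<omega> \<le> (w4 + \<eta>) * norm v * norm (e \<omega>)" if "\<omega> \<in> E" "v \<in> union_sums 4 S" for \<omega> v
    using that by (intro noise_le[of _ 4]) (auto simp: E_def)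
  have params: "rho_param b w4 \<eta> \<mu> = 1 - \<mu> * l\<^sup>2" "xi_param w3 \<eta> \<mu> = \<mu> * (w3 + \<eta>)"
    "xi_param w4 \<eta> \<mu> = \<mu> * (w4 + \<eta>)" for \<mu>
    by (simp_all add: rho_param_def xi_param_def l_def)
  have \<mu>: "0 < \<mu>1" "\<mu>1 \<le> 1 / L\<^sup>2" "0 < \<mu>2" "\<mu>2 \<le> 1 / L\<^sup>2"
    using assms by (auto simp: L_def)
  show ?thesis
  proof (intro bexI[OF _ E] conjI ballI allI impI)
    show "1 - 6 * exp (- \<eta>\<^sup>2 / 2) \<le> prob E" by (rule prob_E)
  next
    fix \<omega> T X t
    assume \<omega>: "\<omega> \<in> E" and run: "gcosamp_run (A \<omega>) (A \<omega> *v x + e \<omega>) S T X" and t: "t \<in> {1..T}"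
    then obtain t' where "t = Suc t'" "t' < T" by (cases t) auto
    with gcosamp_run_error[OF S lL s34 lower[OF \<omega>] upper[OF \<omega>] n3[OF \<omega>] n4[OF \<omega>] \<mu> x run, of t']
    show "norm (X t - x) \<le> error_coeff (rho_param b w4 \<eta> \<mu>1) (rho_param b w4 \<eta> \<mu>2) * norm (X (t - 1) - x)
          + noise_coeff (rho_param b w4 \<eta> \<mu>1) (xi_param w3 \<eta> \<mu>1) (xi_param w4 \<eta> \<mu>2) * norm (e \<omega>)"
      by (simp add: params)
  next
    assume m: "real CARD('m) > 14.5\<^sup>2 * (w4 + \<eta>)\<^sup>2 + 1"
    \<comment> \<open>The largest admissible value makes both \<rho> parameters smallest, namely 1 -
      (l / L)^2, the form that \<open>error_coeff_less_1\<close> expects.\<close>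
    define \<nu> where "\<nu> = 1 / L\<^sup>2"
    have \<nu>: "0 < \<nu>" "\<nu> \<le> 1 / L\<^sup>2" using lL by (auto simp: \<nu>_def)
    define \<kappa> where "\<kappa> = error_coeff (1 - \<nu> * l\<^sup>2) (1 - \<nu> * l\<^sup>2)"
    define \<gamma> where "\<gamma> = noise_coeff (1 - \<nu> * l\<^sup>2) (\<nu> * (w3 + \<eta>)) (\<nu> * (w4 + \<eta>))"
    \<comment> \<open>The lower bound \<open>CARD('m)\<close> - 1 for b^2 is the reason for the + 1
      in the dimension condition.\<close>
    have "(14.5 * (w4 + \<eta>))\<^sup>2 < b\<^sup>2"
      using m gaussian_mean_norm_square_ge[where 'm = 'm]
      unfolding b power_mult_distrib by linarith
    then have "14.5 * (w4 + \<eta>) < b"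
      using less w_nonneg \<eta> by (intro power_less_imp_less_base[of _ 2 b]) auto
    from error_coeff_less_1[OF _ this] have \<kappa>: "0 \<le> \<kappa>" "\<kappa> < 1"
      using w_nonneg \<eta> by (simp_all add: \<kappa>_def \<nu>_def l_def L_def diff_diff_eq add.assoc)
    have geometric: "norm (X t - x) \<le> \<kappa> ^ t * norm x + \<gamma> / (1 - \<kappa>) * norm (e \<omega>)"
      if \<omega>: "\<omega> \<in> E" and run: "gcosamp_run (A \<omega>) (A \<omega> *v x + e \<omega>) S T X" and t: "t \<le> T" for \<omega> T X t
      by (rule gcosamp_run_geometric[OF S lL s34 lower[OF \<omega>] upper[OF \<omega>] n3[OF \<omega>] n4[OF \<omega>]
            \<nu> \<nu> x run \<kappa>_def \<kappa> \<gamma>_def t])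
    show "\<exists>\<nu>1 \<nu>2 \<kappa> \<gamma>. 0 < \<nu>1 \<and> \<nu>1 \<le> 1 / (b + w4 + \<eta>)\<^sup>2 \<and> 0 < \<nu>2 \<and> \<nu>2 \<le> 1 / (b + w4 + \<eta>)\<^sup>2 \<and>
        \<kappa> = error_coeff (rho_param b w4 \<eta> \<nu>1) (rho_param b w4 \<eta> \<nu>2) \<and>
        \<gamma> = noise_coeff (rho_param b w4 \<eta> \<nu>1) (xi_param w3 \<eta> \<nu>1) (xi_param w4 \<eta> \<nu>2) \<and>
        0 \<le> \<kappa> \<and> \<kappa> < 1 \<and>
        (\<forall>\<omega>\<in>E. \<forall>T X. gcosamp_run (A \<omega>) (A \<omega> *v x + e \<omega>) S T X \<longrightarrow>
          (\<forall>t\<le>T. norm (X t - x) \<le> \<kappa> ^ t * norm x + \<gamma> / (1 - \<kappa>) * norm (e \<omega>)))"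
      by (rule exI[of _ \<nu>], rule exI[of _ \<nu>], rule exI[of _ \<kappa>], rule exI[of _ \<gamma>])
        (use \<nu> \<kappa> geometric in \<open>simp add: params L_def \<kappa>_def[symmetric] \<gamma>_def[symmetric]\<close>)
    fix \<omega> X
    assume \<omega>: "\<omega> \<in> E" and run: "(\<forall>T. gcosamp_run (A \<omega>) (A \<omega> *v x + e \<omega>) S T X) \<and> e \<omega> = 0"
    have "norm (X t - x) \<le> \<kappa> ^ t * norm x" for t
      using geometric[OF \<omega> run[THEN conjunct1, rule_format, of t], of t] run by simp
    moreover have "(\<lambda>t. \<kappa> ^ t * norm x) \<longlonglongrightarrow> 0 * norm x"
      using \<kappa> by (intro tendsto_intros LIMSEQ_power_zero) auto
    ultimately have "(\<lambda>t. X t - x) \<longlonglongrightarrow> 0"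
      by (intro Lim_null_comparison[of "\<lambda>t. X t - x" "\<lambda>t. \<kappa> ^ t * norm x"]) auto
    then show "X \<longlonglongrightarrow> x" by (simp add: LIM_zero_iff)
  qed
qed

end
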